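(* Let $k$ be a field, $R$ an affine factorial $k$-domain and $K=\mathrm{Frac}(R)$. Let $\Omega_3$ be the family of $R$-algebras of the form $$B_{d,e}^R=\frac{R[X,Y,Z,T]}{(X^dY-P(X,Z),\ X^eT-Q(X,Y,Z))}$$ such that $d,e\geq 1$; $P$ is monic in $Z$ as a polynomial in $R[X,Z]$ with $\deg_ZP>1$; $Q\in R[X,Y,Z]$ is almost monic in $Y$ as a polynomial in $K[X,Y,Z]$ with $\deg_YQ>1$; $(P(0,Z),P'(0,Z))=R[Z]$; and $(P(0,Z),Q(0,Y,Z),Q'(0,Y,Z))=R[Y,Z]$, where $P'=\partial_ZP$ and $Q'=\partial_YQ$. Then the family $\Omega_3$ consists of infinitely many rings which are pairwise non-isomorphic as $R$-algebras and counterexamples to the Generalized Cancellation Problem over $R$.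
   Context: All rings are commutative Noetherian with unity. $A^{[1]}$ denotes the polynomial ring in one variable over $A$, and $\cong_R$ denotes isomorphism of $R$-algebras. An affine factorial $k$-domain is a unique factorization domain that is finitely generated as a $k$-algebra. $X,Y,Z,T$ are indeterminates over $R$. $\partial_Z P$ and $\partial_Y Q$ are the formal partial derivatives of $P$ with respect to $Z$ and of $Q$ with respect to $Y$. "$Q$ is almost monic in $Y$ as a polynomial in $K[X,Y,Z]$" means that the coefficient of the highest power of $Y$ in $Q$ is a unit in $K[X,Z]$, i.e. (as $Q\in R[X,Y,Z]$) a non-zero element of $R$. Generalized Cancellation Problem over $R$: if $A,B$ are $R$-domains with $A^{[1]}\cong_RB^{[1]}$, does it follow that $A\cong_RB$? *)

theory Defs
  imports
    "HOL-Algebra.Algebraic_Closure_Type"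
    "HOL-Algebra.UnivPoly"
    "HOL-Algebra.QuotRing"
    "HOL-Algebra.Ring_Divisibility"
    "HOL-Algebra.Generated_Rings"
    "HOL-Computational_Algebra.Computational_Algebra"
begin

text \<open>
  The base ring \<open>R\<close> is a type \<open>'r :: idom\<close> and its polynomial rings are iterated \<open>poly\<close> types,
  the variables being adjoined in the order \<open>X, Z, Y, T\<close>:
  \<open>P \<in> R[X,Z]\<close> has type \<open>'r poly poly\<close> (outermost variable \<open>Z\<close>),
  \<open>Q \<in> R[X,Y,Z]\<close> has type \<open>'r poly poly poly\<close> (outermost variable \<open>Y\<close>), and
  \<open>R[X,Y,Z,T]\<close> is \<open>'r poly poly poly poly\<close> (outermost variable \<open>T\<close>).
  Quotient rings and the polynomial rings over them are \<^theory>\<open>HOL-Algebra.QuotRing\<close> and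
  \<^theory>\<open>HOL-Algebra.UnivPoly\<close> structures.
\<close>

text \<open>\<open>\<iota>\<close> is the structure map of the \<open>k\<close>-algebra \<open>R\<close>.\<close>

definition affine_algebra :: "('k::field \<Rightarrow> 'r::idom) \<Rightarrow> bool" where
  "affine_algebra \<iota> \<longleftrightarrow>
     \<iota> \<in> ring_hom ring_of_type_algebra ring_of_type_algebra \<and>
     (\<exists>S. finite S \<and> generate_ring ring_of_type_algebra (range \<iota> \<union> S) = UNIV)"

section \<open>Algebras over \<open>R\<close>\<close>

text \<open>An \<open>R\<close>-algebra is a ring together with its structure map.\<close>

type_synonym ('r, 'a, 'm) R_alg = "('a, 'm) ring_scheme \<times> ('r \<Rightarrow> 'a)"

definition R_domain :: "('r::idom, 'a, 'm) R_alg \<Rightarrow> bool" where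
  "R_domain A \<longleftrightarrow> domain (fst A) \<and> snd A \<in> ring_hom ring_of_type_algebra (fst A)"

definition R_isomorphic :: "('r::idom, 'a, 'm) R_alg \<Rightarrow> ('r, 'b, 'n) R_alg \<Rightarrow> bool" where
  "R_isomorphic A B \<longleftrightarrow> (\<exists>h \<in> ring_iso (fst A) (fst B). \<forall>r. h (snd A r) = snd B r)"

definition poly_alg where
  "poly_alg (A :: ('r::idom, 'a, 'm) R_alg) =
     (UP (fst A), \<lambda>r. up_ring.monom (UP (fst A)) (snd A r) 0)"

definition gcp_counterexample :: "('r::idom, 'a, 'm) R_alg \<Rightarrow> ('r, 'b, 'n) R_alg \<Rightarrow> bool" where
  "gcp_counterexample A B \<longleftrightarrow>
     R_domain A \<and> R_domain B \<and> R_isomorphic (poly_alg A) (poly_alg B) \<and> \<not> R_isomorphic A B"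

section \<open>The family \<open>\<Omega>\<^sub>3\<close>\<close>

definition unit_ideal :: "'a::comm_ring_1 set \<Rightarrow> bool" where
  "unit_ideal S \<longleftrightarrow> Idl\<^bsub>ring_of_type_algebra\<^esub> S = UNIV"

text \<open>Substitution of \<open>0\<close> for \<open>X\<close>, in \<open>R[X,Z]\<close> and in \<open>R[X,Y,Z]\<close>.\<close>

definition P_at0 :: "'r::idom poly poly \<Rightarrow> 'r poly" where
  "P_at0 P = map_poly (\<lambda>c. poly c 0) P"

definition Q_at0 :: "'r::idom poly poly poly \<Rightarrow> 'r poly poly" where
  "Q_at0 Q = map_poly P_at0 Q"

definition almost_monic :: "'r::idom poly poly poly \<Rightarrow> bool" where
  "almost_monic Q \<longleftrightarrow>
     is_unit (Polynomial.lead_coeff (map_poly (map_poly (map_poly to_fract)) Q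
                :: 'r fract poly poly poly))"

definition admissible :: "'r::idom poly poly \<Rightarrow> 'r poly poly poly \<Rightarrow> bool" where
  "admissible P Q \<longleftrightarrow>
     Polynomial.lead_coeff P = 1 \<and> Polynomial.degree P > 1 \<and>
     almost_monic Q \<and> Polynomial.degree Q > 1 \<and>
     unit_ideal {P_at0 P, P_at0 (pderiv P)} \<and>
     unit_ideal {[:P_at0 P:], Q_at0 Q, Q_at0 (pderiv Q)}"

definition B_ideal ::
  "nat \<Rightarrow> nat \<Rightarrow> 'r::idom poly poly \<Rightarrow> 'r poly poly poly \<Rightarrow> 'r poly poly poly poly set" where
  "B_ideal d e P Q =
     (let x = [:[:[:[:0, 1:]:]:]:]; y = [:[:0, 1:]:]; t = [:0, 1:]
      in Idl\<^bsub>ring_of_type_algebra\<^esub> {x ^ d * y - [:[:P:]:], x ^ e * t - [:Q:]})"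

definition B_alg ::
  "nat \<Rightarrow> nat \<Rightarrow> 'r::idom poly poly \<Rightarrow> 'r poly poly poly
     \<Rightarrow> ('r, 'r poly poly poly poly set, unit) R_alg" where
  "B_alg d e P Q =
     (ring_of_type_algebra Quot B_ideal d e P Q,
      \<lambda>r. B_ideal d e P Q +>\<^bsub>ring_of_type_algebra\<^esub> [:[:[:[:r:]:]:]:])"

definition Omega3 :: "('r::idom, 'r poly poly poly poly set, unit) R_alg set" where
  "Omega3 = {B_alg d e P Q | d e P Q. d \<ge> 1 \<and> e \<ge> 1 \<and> admissible P Q}"

end

theory Submission
  imports Defs
begin

text \<open>
  Write \<open>r = deg\<^sub>Z P\<close>, \<open>s = deg\<^sub>Y Q\<close> and \<open>A = B\<^sub>d\<^sub>,\<^sub>e\<close>, with \<open>x, z, y, t\<close> for the images of the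
  variables. Everything rests on the third claim of the theorem: for fixed \<open>P\<close> and \<open>Q\<close>, different
  exponents give domains that are stably isomorphic but not isomorphic. The other two claims follow,
  as \<open>Z\<^sup>2 + Z\<close> and \<open>Y\<^sup>2 + Y\<close> are admissible over every ring.

  \<^bold>\<open>A concrete model.\<close> After inverting \<open>x\<close>, the variables \<open>y\<close> and \<open>t\<close> are determined by \<open>x\<close> and \<open>z\<close>.
  So \<open>A\<close> maps to the field of Laurent series in \<open>X\<close> over \<open>F(Z)\<close>, where \<open>F\<close> is an algebraically
  closed field containing \<open>R\<close>. This map is injective (\<open>model_eq_0_iff\<close>): modulo \<open>X\<close> the two
  defining equations become \<open>P(0,Z)\<close>, monic in \<open>Z\<close>, and \<open>Q(0,Y,Z)\<close>, whose leading coefficient in \<open>Y\<close>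
  is a non-zero constant, hence a regular sequence; so \<open>x\<close> is a non-zero-divisor modulo them. In
  particular \<open>A\<close> is a domain.

  \<^bold>\<open>Stable isomorphism.\<close> Geometrically \<open>A\<close> is a torsor under the additive group over the line on which
  \<open>X = 0\<close> is replaced by the scheme \<open>P(0,Z) = Q(0,Y,Z) = 0\<close>, and this base does not depend on the
  exponents. The product of two such torsors over the base is trivial over each factor. In
  terms of equations: by the unimodularity conditions \<open>P'\<close> and \<open>Q'\<close> are invertible modulo \<open>x\<close>, so
  Newton's method (\<open>lift_solution\<close>) finds in \<open>A\<close> an approximation \<open>g\<close> to the coordinate \<open>z'\<close> of
  the other surface; and two solutions on the same branch over \<open>X = 0\<close> agree modulo a power of \<open>X\<close>
  (\<open>solution_unique\<close>). Then \<open>z' = g + x\<^sup>d\<^sup>'\<^sup>+\<^sup>e\<^sup>' W\<close> identifies \<open>A[W]\<close> with the analogous polynomial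
  ring over the other algebra (\<open>crossing_map_exists\<close>, \<open>crossing_maps_inverse\<close>).

  \<^bold>\<open>Pole orders.\<close> An element of \<open>A\<close> is a Laurent polynomial in \<open>x\<close> over \<open>R[z]\<close>. Suppose that it has
  a pole of order \<open>m\<close> along \<open>x = 0\<close> and that its leading coefficient has degree \<open>D\<close> in \<open>z\<close>. Then
  \<open>m \<le> (D div r) d + (D div r s) e\<close> (\<open>pole_bound\<close>), with equality for \<open>y\<close> and \<open>t\<close>. Indeed the relations
  allow monomials with exponent of \<open>z\<close> less than \<open>r\<close> and exponent of \<open>y\<close> less than \<open>s\<close> as leading
  terms, and the leading coefficients of these have distinct degrees.

  \<^bold>\<open>Non-isomorphism.\<close> The translations \<open>z' \<mapsto> z' + U\<close> of a second surface that is isomorphic to \<open>A\<close>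
  deform the inclusion of \<open>A\<close> and fix the function \<open>x'\<close>. They also fix \<open>x\<close>
  (\<open>deformation_fixes_X\<close>), which replaces the computation of the Makar-Limanov invariant. If they did
  not, rescale \<open>U\<close> by the critical fractional power of \<open>x\<close> and reduce modulo \<open>x\<close>. The result consists of
  polynomials \<open>a, b, f\<close> in \<open>U\<close> over \<open>F(Z)\<close>, \<open>a\<close> and \<open>b\<close> not both constant, with \<open>a\<^sup>N f = q P(0,b)\<^sup>s\<close> and
  \<open>N = s d + e\<close>, where \<open>a\<close>, \<open>b\<close> take the values \<open>1\<close>, \<open>Z\<close> at \<open>U = 0\<close>. As \<open>x'\<close> is invariant, the bound
  on pole orders makes \<open>f\<close> constant. But \<open>N > s\<close>, so \<open>b - l\<close> is then an \<open>n\<close>-th power up to its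
  leading coefficient, for one \<open>n \<ge> 2\<close> and every root \<open>l\<close> of \<open>P(0,Z)\<close>, and comparing two roots at
  \<open>U = 0\<close> makes \<open>(Z - l\<^sub>1)/(Z - l\<^sub>2)\<close> an \<open>n\<close>-th power in \<open>F(Z)\<close> (\<open>pcompose_not_power\<close>).

  It follows that \<open>x\<close> is a polynomial in \<open>x'\<close>, then that \<open>x' = u x\<close> with a unit \<open>u\<close> and that
  \<open>z'\<close> is a polynomial in \<open>x\<close> and \<open>z\<close>, linear in \<open>z\<close> also for \<open>x = 0\<close>. So pole orders and degrees
  of leading coefficients are the same for both surfaces, and the bound applied to \<open>y'\<close> and \<open>t'\<close> gives
  \<open>d' \<le> d\<close> and \<open>s d' + e' \<le> s d + e\<close> (\<open>exponents_le\<close>). By symmetry the exponents agree.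
\<close>

section \<open>Ring homomorphisms and evaluation of iterated polynomials\<close>

text \<open>Homomorphisms are total functions between types, which avoids carrier conditions when they are
  composed and evaluated.\<close>

definition is_hom :: "('a::comm_ring_1 \<Rightarrow> 'b::comm_ring_1) \<Rightarrow> bool" where
  "is_hom f \<longleftrightarrow> f 1 = 1 \<and> (\<forall>a b. f (a + b) = f a + f b) \<and> (\<forall>a b. f (a * b) = f a * f b)"

lemma is_homI:
  assumes "f 1 = 1" "\<And>a b. f (a + b) = f a + f b" "\<And>a b. f (a * b) = f a * f b"
  shows "is_hom f"
  using assms by (simp add: is_hom_def)

lemma hom_add: "is_hom f \<Longrightarrow> f (a + b) = f a + f b"
  and hom_mult: "is_hom f \<Longrightarrow> f (a * b) = f a * f b"
  and hom_1: "is_hom f \<Longrightarrow> f 1 = 1"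
  by (auto simp: is_hom_def)

lemma hom_0: "is_hom f \<Longrightarrow> f 0 = 0"
  using hom_add[of f 0 0] by simp

lemma hom_uminus: "is_hom f \<Longrightarrow> f (- a) = - f a"
  using hom_add[of f a "- a"] hom_0[of f] by (simp add: eq_neg_iff_add_eq_0 add.commute)

lemma hom_diff: "is_hom f \<Longrightarrow> f (a - b) = f a - f b"
  using hom_add[of f a "- b"] hom_uminus[of f b] by simp

lemma hom_power: "is_hom f \<Longrightarrow> f (a ^ n) = f a ^ n"
  by (induction n) (auto simp: hom_1 hom_mult)

lemma hom_sum: "is_hom f \<Longrightarrow> f (sum g S) = (\<Sum>s\<in>S. f (g s))"
  by (induction S rule: infinite_finite_induct) (auto simp: hom_0 hom_add)

lemmas hom_simps = hom_0 hom_1 hom_add hom_mult hom_uminus hom_diff hom_power hom_sum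

lemma is_hom_comp: "is_hom f \<Longrightarrow> is_hom g \<Longrightarrow> is_hom (\<lambda>u. f (g u))"
  by (simp add: is_hom_def)

lemma is_hom_id: "is_hom (\<lambda>u. u)"
  by (simp add: is_hom_def)

lemma is_hom_const_poly: "is_hom (\<lambda>u. [:u:])"
  by (intro is_homI) (auto simp: one_pCons)

lemma is_hom_to_fract: "is_hom to_fract"
  by (intro is_homI) simp_all

lemma is_hom_fls_const: "is_hom (fls_const :: 'a::comm_ring_1 \<Rightarrow> _)"
  by (intro is_homI) (auto simp: fls_plus_const)

lemma is_hom_fps_const: "is_hom (fps_const :: 'a::comm_ring_1 \<Rightarrow> _)"
  by (intro is_homI) (auto simp: fps_const_add)

lemma is_hom_fps_to_fls: "is_hom (fps_to_fls :: 'a::comm_ring_1 fps \<Rightarrow> _)"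
  by (intro is_homI) (auto simp: fls_times_fps_to_fls)

lemma is_hom_fps_nth_0: "is_hom (\<lambda>f :: 'a::comm_ring_1 fps. fps_nth f 0)"
  by (intro is_homI) auto

lemma is_hom_poly: "is_hom (\<lambda>p. poly p a)"
  by (intro is_homI) auto

text \<open>Iterating \<open>ev\<close> evaluates a polynomial in several variables at arbitrary points, along a map of
  the constants.\<close>

definition ev :: "('a::comm_ring_1 \<Rightarrow> 'b::comm_ring_1) \<Rightarrow> 'b \<Rightarrow> 'a poly \<Rightarrow> 'b" where
  "ev f a p = poly (map_poly f p) a"

lemma ev_pCons: "is_hom f \<Longrightarrow> ev f a (pCons c p) = f c + a * ev f a p"
  by (simp add: ev_def map_poly_pCons hom_0)

lemma ev_0: "is_hom f \<Longrightarrow> ev f a 0 = 0"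
  by (simp add: ev_def)

lemma ev_const: "is_hom f \<Longrightarrow> ev f a [:c:] = f c"
  by (simp add: ev_pCons ev_0)

lemma ev_var: "is_hom f \<Longrightarrow> ev f a [:0, 1:] = a"
  by (simp add: ev_pCons ev_0 hom_simps)

lemma is_hom_ev:
  assumes f: "is_hom f"
  shows "is_hom (ev f a)"
proof (rule is_homI)
  show "ev f a 1 = 1"
    using f by (simp add: one_pCons ev_pCons ev_0 hom_1)
  show add: "ev f a (p + q) = ev f a p + ev f a q" for p q
    by (induction p q rule: poly_induct2) (simp_all add: f ev_pCons ev_0 hom_add algebra_simps)
  have smult: "ev f a (smult c q) = f c * ev f a q" for c q
    by (induction q) (simp_all add: f ev_pCons ev_0 hom_mult algebra_simps)
  show "ev f a (p * q) = ev f a p * ev f a q" for p q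
    by (induction p) (simp_all add: f add smult ev_pCons ev_0 hom_0 algebra_simps)
qed

lemma hom_ev:
  assumes "is_hom h" "is_hom f"
  shows "h (ev f a p) = ev (\<lambda>u. h (f u)) (h a) p"
  by (induction p)
    (simp_all add: ev_pCons ev_0 assms is_hom_comp[OF assms] hom_add[OF assms(1)]
      hom_mult[OF assms(1)] hom_0[OF assms(1)])

lemma hom_eq_ev:
  assumes "is_hom h"
  shows "h p = ev (\<lambda>c. h [:c:]) (h [:0, 1:]) p"
proof (induction p)
  case 0
  then show ?case by (simp add: ev_def hom_0 assms)
next
  case (pCons a p)
  have "pCons a p = [:a:] + [:0, 1:] * p" by simp
  then have "h (pCons a p) = h [:a:] + h [:0, 1:] * h p"
    by (metis assms hom_add hom_mult)
  then show ?case
    using pCons is_hom_comp[OF assms is_hom_const_poly] by (simp add: ev_pCons)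
qed

lemma map_poly_eq_ev:
  assumes "is_hom f"
  shows "map_poly f p = ev (\<lambda>c. [:f c:]) [:0, 1:] p"
  by (induction p)
    (simp_all add: ev_0 ev_pCons map_poly_pCons assms hom_0 is_hom_comp[OF is_hom_const_poly assms])

lemma is_hom_map_poly: "is_hom f \<Longrightarrow> is_hom (map_poly f)"
  using is_hom_ev[OF is_hom_comp[OF is_hom_const_poly], of f "[:0, 1:]"]
  by (subst ext[of "map_poly f" "ev (\<lambda>c. [:f c:]) [:0, 1:]"]) (auto simp: map_poly_eq_ev)

lemma coeff_map_hom: "is_hom f \<Longrightarrow> coeff (map_poly f p) n = f (coeff p n)"
  by (simp add: coeff_map_poly hom_0)

lemma ev_altdef:
  assumes "is_hom f" "degree p \<le> n"
  shows "ev f a p = (\<Sum>i\<le>n. f (coeff p i) * a ^ i)"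
proof -
  have "ev f a p = (\<Sum>i\<le>degree (map_poly f p). f (coeff p i) * a ^ i)"
    by (simp add: ev_def poly_altdef coeff_map_hom assms)
  also have "\<dots> = (\<Sum>i\<le>n. f (coeff p i) * a ^ i)"
  proof (rule sum.mono_neutral_left)
    show "{..degree (map_poly f p)} \<subseteq> {..n}"
      using degree_le[of n "map_poly f p"] assms by (auto simp: coeff_map_hom coeff_eq_0 hom_0)
    show "\<forall>i\<in>{..n} - {..degree (map_poly f p)}. f (coeff p i) * a ^ i = 0"
    proof
      fix i assume "i \<in> {..n} - {..degree (map_poly f p)}"
      then have "coeff (map_poly f p) i = 0" by (intro coeff_eq_0) auto
      then show "f (coeff p i) * a ^ i = 0" by (simp add: coeff_map_hom[OF assms(1)])
    qed
  qed simp
  finally show ?thesis .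
qed

abbreviation ev2 where "ev2 c x z \<equiv> ev (ev c x) z"
abbreviation ev3 where "ev3 c x z y \<equiv> ev (ev2 c x z) y"
abbreviation ev4 where "ev4 c x z y t \<equiv> ev (ev3 c x z y) t"

lemma hom_ev2: "is_hom h \<Longrightarrow> is_hom c \<Longrightarrow>
    h (ev2 c x z p) = ev2 (\<lambda>r. h (c r)) (h x) (h z) p"
  by (simp add: hom_ev is_hom_ev)

lemma hom_ev3: "is_hom h \<Longrightarrow> is_hom c \<Longrightarrow>
    h (ev3 c x z y p) = ev3 (\<lambda>r. h (c r)) (h x) (h z) (h y) p"
  by (simp add: hom_ev is_hom_ev)

lemma hom_ev4: "is_hom h \<Longrightarrow> is_hom c \<Longrightarrow>
    h (ev4 c x z y t p) = ev4 (\<lambda>r. h (c r)) (h x) (h z) (h y) (h t) p"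
  by (simp add: hom_ev is_hom_ev)

abbreviation "vX \<equiv> [:[:[:[:0, 1:]:]:]:]"
abbreviation "vZ \<equiv> [:[:[:0, 1:]:]:]"
abbreviation "vY \<equiv> [:[:0, 1:]:]"
abbreviation "vT \<equiv> [:0, 1:]"
abbreviation const4 :: "'r::comm_ring_1 \<Rightarrow> 'r poly poly poly poly" where
  "const4 r \<equiv> [:[:[:[:r:]:]:]:]"

lemma is_hom_const4: "is_hom const4"
  by (intro is_hom_comp[OF is_hom_const_poly] is_hom_const_poly)

text \<open>The universal property of \<open>R[X,Z,Y,T]\<close>: a homomorphism is determined by its values on constants
  and variables.\<close>

lemma hom_eq_ev4:
  assumes h: "is_hom h"
  shows "h p = ev4 (\<lambda>r. h (const4 r)) (h vX) (h vZ) (h vY) (h vT) p"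
proof -
  note c = is_hom_comp[OF h is_hom_const_poly]
  note c' = is_hom_comp[OF c is_hom_const_poly]
  note c'' = is_hom_comp[OF c' is_hom_const_poly]
  have "h p = ev (\<lambda>u. h [:u:]) (h vT) p" by (rule hom_eq_ev[OF h])
  also have "(\<lambda>u. h [:u:]) = ev (\<lambda>u. h [:[:u:]:]) (h vY)"
    by (rule ext, rule hom_eq_ev[OF c])
  also have "(\<lambda>u. h [:[:u:]:]) = ev (\<lambda>u. h [:[:[:u:]:]:]) (h vZ)"
    by (rule ext, rule hom_eq_ev[OF c'])
  also have "(\<lambda>u. h [:[:[:u:]:]:]) = ev (\<lambda>u. h (const4 u)) (h vX)"
    by (rule ext, rule hom_eq_ev[OF c''])
  finally show ?thesis .
qed

lemma ev4_self: "ev4 const4 vX vZ vY vT p = p"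
  using hom_eq_ev4[OF is_hom_id, of p] by simp

lemma ev3_self: "ev3 const4 vX vZ vY p = [:p:]"
  using ev4_self[of "[:p:]"] by (simp add: ev_const is_hom_ev is_hom_const4)

lemma ev2_self: "ev2 const4 vX vZ p = [:[:p:]:]"
  using ev3_self[of "[:p:]"] by (simp add: ev_const is_hom_ev is_hom_const4)

lemma poly_closed:
  fixes S :: "'a::comm_ring_1 poly set"
  assumes "\<And>c. [:c:] \<in> S" "[:0, 1:] \<in> S"
    and "\<And>p q. p \<in> S \<Longrightarrow> q \<in> S \<Longrightarrow> p + q \<in> S" "\<And>p q. p \<in> S \<Longrightarrow> q \<in> S \<Longrightarrow> p * q \<in> S"
  shows "p \<in> S"
proof (induction p)
  case 0
  then show ?case using assms(1)[of 0] by simp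
next
  case (pCons a p)
  have "pCons a p = [:a:] + [:0, 1:] * p" by simp
  then show ?case using pCons assms by metis
qed

lemma poly4_closed:
  assumes c: "\<And>r. const4 r \<in> S" and gens: "vX \<in> S" "vZ \<in> S" "vY \<in> S" "vT \<in> S"
    and add: "\<And>p q. p \<in> S \<Longrightarrow> q \<in> S \<Longrightarrow> p + q \<in> S"
    and mult: "\<And>p q. p \<in> S \<Longrightarrow> q \<in> S \<Longrightarrow> p * q \<in> S"
  shows "p \<in> S"
proof -
  have 1: "[:[:[:a:]:]:] \<in> S" for a
  proof -
    have "a \<in> {a. [:[:[:a:]:]:] \<in> S}"
    proof (rule poly_closed)
      fix p q assume "p \<in> {a. [:[:[:a:]:]:] \<in> S}" "q \<in> {a. [:[:[:a:]:]:] \<in> S}"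
      then show "p + q \<in> {a. [:[:[:a:]:]:] \<in> S}" "p * q \<in> {a. [:[:[:a:]:]:] \<in> S}"
        using add[of "[:[:[:p:]:]:]" "[:[:[:q:]:]:]"] mult[of "[:[:[:p:]:]:]" "[:[:[:q:]:]:]"] by
            (auto simp: mult.commute)
    qed (use c gens in auto)
    then show ?thesis by simp
  qed
  have 2: "[:[:a:]:] \<in> S" for a
  proof -
    have "a \<in> {a. [:[:a:]:] \<in> S}"
    proof (rule poly_closed)
      fix p q assume "p \<in> {a. [:[:a:]:] \<in> S}" "q \<in> {a. [:[:a:]:] \<in> S}"
      then show "p + q \<in> {a. [:[:a:]:] \<in> S}" "p * q \<in> {a. [:[:a:]:] \<in> S}"
        using add[of "[:[:p:]:]" "[:[:q:]:]"] mult[of "[:[:p:]:]" "[:[:q:]:]"] by (auto simp: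
            mult.commute)
    qed (use 1 gens in auto)
    then show ?thesis by simp
  qed
  have 3: "[:a:] \<in> S" for a
  proof -
    have "a \<in> {a. [:a:] \<in> S}"
    proof (rule poly_closed)
      fix p q assume "p \<in> {a. [:a:] \<in> S}" "q \<in> {a. [:a:] \<in> S}"
      then show "p + q \<in> {a. [:a:] \<in> S}" "p * q \<in> {a. [:a:] \<in> S}"
        using add[of "[:p:]" "[:q:]"] mult[of "[:p:]" "[:q:]"] by (auto simp: mult.commute)
    qed (use 2 gens in auto)
    then show ?thesis by simp
  qed
  show ?thesis
    by (rule poly_closed) (use 3 gens add mult in auto)
qed

section \<open>The defining ideal as the kernel of an evaluation\<close>

lemma rta_simps:
  "carrier (ring_of_type_algebra :: 'a::comm_ring_1 ring) = UNIV"
  "x \<oplus>\<^bsub>ring_of_type_algebra\<^esub> y = x + (y :: 'a)"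
  "x \<otimes>\<^bsub>ring_of_type_algebra\<^esub> y = x * (y :: 'a)"
  "\<zero>\<^bsub>ring_of_type_algebra\<^esub> = (0 :: 'a)" "\<one>\<^bsub>ring_of_type_algebra\<^esub> = (1 :: 'a)"
  by (simp_all add: ring_of_type_algebra_def)

lemma ideal_typeI:
  fixes I :: "'a::comm_ring_1 set"
  assumes "0 \<in> I" "\<And>a b. a \<in> I \<Longrightarrow> b \<in> I \<Longrightarrow> a + b \<in> I" "\<And>a b. a \<in> I \<Longrightarrow> b * a \<in> I"
  shows "ideal I ring_of_type_algebra"
proof -
  interpret cring "ring_of_type_algebra :: 'a ring" by blast
  have inv: "\<ominus>\<^bsub>ring_of_type_algebra\<^esub> a = - a" for a :: 'a
    using minus_equality[of "- a" a] by (simp add: rta_simps)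
  show ?thesis
  proof (rule idealI)
    show "subgroup I (add_monoid ring_of_type_algebra)"
    proof (rule add.subgroupI)
      show "\<ominus>\<^bsub>ring_of_type_algebra\<^esub> a \<in> I" if "a \<in> I" for a
        using assms(3)[OF that, of "- 1"] by (simp add: inv)
    qed (use assms in \<open>auto simp: rta_simps\<close>)
  qed (use assms(3) ring_axioms in \<open>auto simp: rta_simps mult.commute\<close>)
qed

lemma Idl_three:
  fixes a b c :: "'a::comm_ring_1"
  shows "Idl\<^bsub>ring_of_type_algebra\<^esub> {a, b, c} = {u * a + v * b + w * c | u v w. True}"
    (is "?I = ?J")
proof -
  interpret cring "ring_of_type_algebra :: 'a ring" by blast
  have I: "ideal ?I ring_of_type_algebra" "{a, b, c} \<subseteq> ?I"
    by (intro genideal_ideal genideal_self; simp add: rta_simps)+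
  then have abc: "a \<in> ?I" "b \<in> ?I" "c \<in> ?I" by (auto simp only: insert_subset)
  have mult: "u * p \<in> ?I" if "p \<in> ?I" for u p
    using ideal.I_l_closed[OF I(1) that, of u] by (simp add: rta_simps)
  have add: "p + q \<in> ?I" if "p \<in> ?I" "q \<in> ?I" for p q
    using additive_subgroup.a_closed[OF ideal.axioms(1)[OF I(1)] that] by (simp add: rta_simps)
  show ?thesis
  proof
    show "?J \<subseteq> ?I"
      using abc by (auto intro!: add mult)
    have "ideal ?J ring_of_type_algebra"
    proof (rule ideal_typeI)
      have "0 = 0 * a + 0 * b + 0 * c" by simp
      then show "0 \<in> ?J" by blast
      fix p q :: 'a assume p: "p \<in> ?J"
      then obtain u v w where uvw: "p = u * a + v * b + w * c" by blast
      have "q * p = (q * u) * a + (q * v) * b + (q * w) * c"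
        by (simp add: uvw algebra_simps)
      then show "q * p \<in> ?J" by blast
      assume "q \<in> ?J"
      then obtain u' v' w' where "q = u' * a + v' * b + w' * c" by blast
      then have "p + q = (u + u') * a + (v + v') * b + (w + w') * c"
        by (simp add: uvw algebra_simps)
      then show "p + q \<in> ?J" by blast
    qed
    moreover have "a = 1 * a + 0 * b + 0 * c" "b = 0 * a + 1 * b + 0 * c"
      "c = 0 * a + 0 * b + 1 * c" by simp_all
    then have "a \<in> ?J" "b \<in> ?J" "c \<in> ?J" by blast+
    ultimately show "?I \<subseteq> ?J"
      by (intro genideal_minimal) auto
  qed
qed

lemma Idl_two:
  fixes a b :: "'a::comm_ring_1"
  shows "Idl\<^bsub>ring_of_type_algebra\<^esub> {a, b} = {u * a + v * b | u v. True}"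
proof -
  have "{a, b} = {a, b, b}" by simp
  then have "Idl\<^bsub>ring_of_type_algebra\<^esub> {a, b} = {u * a + v * b + w * b | u v w. True}"
    by (simp only: Idl_three)
  also have "\<dots> = {u * a + v * b | u v. True}"
  proof (intro equalityI subsetI)
    fix p assume "p \<in> {u * a + v * b + w * b | u v w. True}"
    then obtain u v w where "p = u * a + (v + w) * b" by (auto simp: algebra_simps)
    then show "p \<in> {u * a + v * b | u v. True}" by blast
  next
    fix p assume "p \<in> {u * a + v * b | u v. True}"
    then obtain u v where "p = u * a + v * b + 0 * b" by auto
    then show "p \<in> {u * a + v * b + w * b | u v w. True}" by blast
  qed
  finally show ?thesis .
qed

lemma is_hom_P_at0: "is_hom (P_at0 :: 'r::idom poly poly \<Rightarrow> _)"
  using is_hom_map_poly[OF is_hom_poly[of 0]] by (simp add: P_at0_def[abs_def])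

lemma is_hom_Q_at0: "is_hom (Q_at0 :: 'r::idom poly poly poly \<Rightarrow> _)"
  using is_hom_map_poly[OF is_hom_P_at0] by (simp add: Q_at0_def[abs_def])

text \<open>The units of \<open>K[X,Z]\<close> are the non-zero constants, and the leading coefficient lies in \<open>R[X,Z]\<close>.\<close>

lemma almost_monic_lead_coeff:
  assumes "almost_monic Q"
  obtains q where "q \<noteq> 0" "lead_coeff Q = [:[:q:]:]"
proof -
  let ?f = "map_poly (map_poly to_fract) :: 'a poly poly \<Rightarrow> 'a fract poly poly"
  have f1: "(map_poly to_fract p = 0) = (p = 0)" for p :: "'a poly"
    by (auto simp: poly_eq_iff coeff_map_hom is_hom_to_fract)
  have f2: "(?f p = 0) = (p = 0)" for p
    by (auto simp: poly_eq_iff[of _ 0] coeff_map_hom is_hom_map_poly is_hom_to_fract f1)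
  have deg: "degree (map_poly ?f Q) = degree Q"
    by (rule degree_map_poly) (use f2 in auto)
  have u: "?f (lead_coeff Q) dvd 1"
    using assms by (simp add: almost_monic_def deg coeff_map_hom is_hom_map_poly is_hom_to_fract)
  then obtain c where c: "?f (lead_coeff Q) = [:c:]" "c dvd 1"
    by (auto simp: is_unit_poly_iff)
  then obtain k where k: "c = [:k:]" "k dvd 1" by (auto simp: is_unit_poly_iff)
  have "degree (?f (lead_coeff Q)) = degree (lead_coeff Q)"
    by (rule degree_map_poly) (use f1 in auto)
  then obtain l where l: "lead_coeff Q = [:l:]"
    using c degree_eq_zeroE[of "lead_coeff Q"] by (metis degree_pCons_0)
  then have lc: "map_poly to_fract l = [:k:]"
    using c k by (simp add: map_poly_pCons)
  have "degree (map_poly to_fract l) = degree l"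
    by (rule degree_map_poly) auto
  then obtain q where q: "l = [:q:]"
    using lc degree_eq_zeroE[of l] by (metis degree_pCons_0)
  then have "q \<noteq> 0" using lc k by (auto simp: map_poly_pCons)
  then show thesis using that l q by blast
qed

text \<open>The exponents are not fixed here, as surfaces with the same \<open>P\<close> and \<open>Q\<close> are to be compared. The map
  \<open>\<iota>\<close> embeds \<open>R\<close> into a field over which \<open>P(0,Z)\<close> splits.\<close>

locale danielewski =
  fixes \<iota> :: "'r::idom \<Rightarrow> 'f::alg_closed_field"
    and P :: "'r poly poly" and Q :: "'r poly poly poly" and q :: 'r
  assumes hom_\<iota>: "is_hom \<iota>" and inj_\<iota>: "\<And>a. \<iota> a = 0 \<Longrightarrow> a = 0"
    and monic_P: "lead_coeff P = 1" and deg_P: "degree P > 1"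
    and lead_Q: "lead_coeff Q = [:[:q:]:]" and q_nonzero: "q \<noteq> 0" and deg_Q: "degree Q > 1"
    and unit_P: "\<exists>u v. u * P_at0 P + v * P_at0 (pderiv P) = 1"
    and unit_Q: "\<exists>u v w. u * [:P_at0 P:] + v * Q_at0 Q + w * Q_at0 (pderiv Q) = 1"
begin

text \<open>A point of the surface with values in an \<open>R\<close>-algebra with structure map \<open>c\<close>; equivalently, a
  homomorphism of \<open>R\<close>-algebras from the coordinate ring.\<close>

definition solution where
  "solution d e c x z y t \<longleftrightarrow> x ^ d * y = ev2 c x z P \<and> x ^ e * t = ev3 c x z y Q"

lemma solution_hom:
  assumes "is_hom h" "is_hom c" "solution d e c x z y t"
  shows "solution d e (\<lambda>r. h (c r)) (h x) (h z) (h y) (h t)"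
  using assms(3) unfolding solution_def
  by (metis assms(1,2) hom_ev2 hom_ev3 hom_mult hom_power)

lemma B_ideal_iff:
  "p \<in> B_ideal d e P Q \<longleftrightarrow>
     (\<exists>u v. p = u * (vX ^ d * vY - [:[:P:]:]) + v * (vX ^ e * vT - [:Q:]))"
  unfolding B_ideal_def Let_def Idl_two by blast

lemma ev4_ideal:
  assumes c: "is_hom c" and s: "solution d e c x z y t" and p: "p \<in> B_ideal d e P Q"
  shows "ev4 c x z y t p = 0"
proof -
  note h = is_hom_ev[OF is_hom_ev[OF is_hom_ev[OF is_hom_ev[OF c]]]]
  have g: "ev4 c x z y t vX = x" "ev4 c x z y t vZ = z" "ev4 c x z y t vY = y"
    "ev4 c x z y t vT = t" "ev4 c x z y t [:[:P:]:] = ev2 c x z P"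
    "ev4 c x z y t [:Q:] = ev3 c x z y Q"
    by (simp_all add: ev_const ev_var c is_hom_ev)
  obtain u v where p': "p = u * (vX ^ d * vY - [:[:P:]:]) + v * (vX ^ e * vT - [:Q:])"
    using p unfolding B_ideal_iff by blast
  show ?thesis
    using s unfolding p' solution_def
    by (simp only: hom_simps[OF h] g) simp
qed

end

lemma map_poly_kernel_multiples:
  fixes x :: "'a::idom"
  assumes f: "is_hom f" and k: "\<And>a. f a = 0 \<Longrightarrow> x dvd a" and p: "map_poly f p = 0"
  shows "[:x:] dvd p"
  using k coeff_map_hom[OF f, of p] p by (simp add: const_poly_dvd_iff)

lemma map_poly_surj:
  assumes "is_hom f" "surj f" shows "surj (map_poly f)"
proof -
  have "\<exists>p. u = map_poly f p" for u
  proof (induction u)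
    case 0
    show ?case by (rule exI[of _ 0]) simp
  next
    case (pCons a u)
    then obtain p where "u = map_poly f p" by blast
    moreover obtain b where "a = f b" using assms(2) by blast
    ultimately show ?case
      by (intro exI[of _ "pCons b p"]) (simp add: map_poly_pCons hom_0 assms(1))
  qed
  then show ?thesis by blast
qed

lemma monic_dvd_smult:
  fixes p c :: "'a::idom poly"
  assumes p: "lead_coeff p = 1" and a: "a \<noteq> 0" and dvd: "p dvd smult a c"
  shows "p dvd c"
proof -
  have p0: "p \<noteq> 0" using p by auto
  obtain s r where sr: "pseudo_divmod c p = (s, r)" by fastforce
  have c: "c = p * s + r" and r: "r = 0 \<or> degree r < degree p"
    using pseudo_divmod[OF p0 sr] p by simp_all
  have "smult a r = smult a c - p * smult a s"
    by (simp add: c smult_add_right)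
  then have "p dvd smult a r" using dvd by (simp add: dvd_diff dvd_smult)
  then have "smult a r = 0"
    using r a dvd_imp_degree_le[of p "smult a r"] by (cases "r = 0") auto
  then show ?thesis using a c by simp
qed

text \<open>\<open>R[Z]/(p)\<close> is free over \<open>R\<close>, so a non-zero constant is a non-zero-divisor there, and the leading
  coefficients in \<open>Y\<close> can be cancelled one after the other.\<close>

lemma monic_dvd_mult_cancel:
  fixes p :: "'a::idom poly" and b h :: "'a poly poly"
  assumes p: "lead_coeff p = 1" and h: "lead_coeff h = [:a:]" "a \<noteq> 0"
  shows "[:p:] dvd b * h \<Longrightarrow> [:p:] dvd b"
proof (induction "degree b" arbitrary: b rule: less_induct)
  case less
  show ?case
  proof (cases "b = 0")
    case False
    define l where "l = lead_coeff b"
    define b' where "b' = b - monom l (degree b)"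
    have "p dvd coeff (b * h) (degree b + degree h)"
      using less.prems by (simp add: const_poly_dvd_iff)
    then have "p dvd smult a l"
      by (simp add: coeff_mult_degree_sum h l_def)
    then have l: "p dvd l" by (rule monic_dvd_smult[OF p h(2)])
    then have m: "[:p:] dvd monom l (degree b)" by (simp add: const_poly_dvd_iff)
    have "[:p:] dvd b'"
    proof (cases "b' = 0")
      case False
      have "degree b' \<le> degree b" unfolding b'_def
        by (rule degree_diff_le) (auto simp: degree_monom_le)
      moreover have "coeff b' (degree b) = 0" by (simp add: b'_def l_def)
      ultimately have "degree b' < degree b"
        using False by (metis leading_coeff_0_iff order_le_less)
      moreover have "[:p:] dvd b' * h"
        using less.prems m by (simp add: b'_def left_diff_distrib dvd_diff dvd_mult2)
      ultimately show ?thesis by (rule less.hyps)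
    qed simp
    then show ?thesis using m by (metis b'_def diff_add_cancel dvd_add)
  qed simp
qed

context danielewski
begin

subsection \<open>The model in Laurent series\<close>

definition P0 where "P0 = P_at0 P"

lemma coeff_P_at0: "coeff (P_at0 p) n = coeff (coeff p n) 0"
  by (simp add: P_at0_def coeff_map_poly poly_0_coeff_0)

lemma deg_P0: "degree P0 = degree P" and monic_P0: "lead_coeff P0 = 1"
proof -
  have "degree P0 \<le> degree P" unfolding P0_def P_at0_def by (rule map_poly_degree_leq)
  moreover have "coeff P0 (degree P) = 1" using monic_P by (simp add: P0_def coeff_P_at0)
  ultimately show "degree P0 = degree P" by (simp add: le_antisym le_degree)
  with \<open>coeff P0 (degree P) = 1\<close> show "lead_coeff P0 = 1" by simp
qed

lemma coeff_Q_at0: "coeff (Q_at0 Q') n = P_at0 (coeff Q' n)"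
  by (simp add: Q_at0_def coeff_map_hom is_hom_P_at0)

lemma lead_Q0: "lead_coeff (Q_at0 Q) = [:q:]"
proof -
  have "degree (Q_at0 Q) \<le> degree Q" unfolding Q_at0_def by (rule map_poly_degree_leq)
  moreover have c: "coeff (Q_at0 Q) (degree Q) = [:q:]"
    using lead_Q by (simp add: coeff_Q_at0 P_at0_def map_poly_pCons)
  ultimately have "degree (Q_at0 Q) = degree Q"
    using q_nonzero by (simp add: le_antisym le_degree)
  with c show "lead_coeff (Q_at0 Q) = [:q:]" by simp
qed

text \<open>The surface embeds into the Laurent series in \<open>X\<close> over \<open>F(Z)\<close>: there \<open>X\<close> is invertible, so that \<open>y\<close>
  and \<open>t\<close> can be solved for, and the order in \<open>X\<close> measures poles along the fibre \<open>X = 0\<close>.\<close>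

definition \<kappa> :: "'r \<Rightarrow> 'f poly fract fls" where "\<kappa> r = fls_const (to_fract [:\<iota> r:])"
definition mZ :: "'f poly fract fls" where "mZ = fls_const (to_fract [:0, 1:])"
abbreviation mX :: "'f poly fract fls" where "mX \<equiv> fls_X"
definition mbed :: "'r poly poly \<Rightarrow> 'f poly fract fls" where "mbed = ev2 \<kappa> mX mZ"
definition mY where "mY d = mbed P / mX ^ d"
definition mT where "mT d e = ev3 \<kappa> mX mZ (mY d) Q / mX ^ e"
definition model where "model d e = ev4 \<kappa> mX mZ (mY d) (mT d e)"

lemma is_hom_\<kappa>: "is_hom \<kappa>"
  unfolding \<kappa>_def
  by (intro is_hom_comp[OF is_hom_fls_const] is_hom_comp[OF is_hom_to_fract]
      is_hom_comp[OF is_hom_const_poly] hom_\<iota>)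

lemma is_hom_mbed: "is_hom mbed"
  by (simp add: mbed_def is_hom_ev is_hom_\<kappa>)

lemma is_hom_model: "is_hom (model d e)"
  by (simp add: model_def is_hom_ev is_hom_\<kappa>)

lemma solution_model: "solution d e \<kappa> mX mZ (mY d) (mT d e)"
proof -
  have "mX ^ n * (b / mX ^ n) = b" for n b
    by (metis fls_X_nonzero nonzero_mult_div_cancel_left power_not_zero times_divide_eq_right)
  then show ?thesis by (simp only: solution_def mY_def mT_def mbed_def)
qed

lemma model_simps:
  "model d e (const4 r) = \<kappa> r" "model d e vX = mX" "model d e vZ = mZ"
  "model d e vY = mY d" "model d e vT = mT d e" "model d e [:[:p:]:] = mbed p"
  by (simp_all add: model_def mbed_def ev_const ev_var is_hom_\<kappa> is_hom_ev)

lemma model_ideal: "p \<in> B_ideal d e P Q \<Longrightarrow> model d e p = 0"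
  unfolding model_def by (rule ev4_ideal[OF is_hom_\<kappa> solution_model])

definition coeffX :: "nat \<Rightarrow> 'r poly poly \<Rightarrow> 'r poly" where
  "coeffX k p = map_poly (\<lambda>a. coeff a k) p"

lemma coeffX_0: "coeffX 0 p = P_at0 p"
  by (simp add: coeffX_def P_at0_def poly_0_coeff_0)

lemma mbed_nth: "fls_nth (mbed p) (int k) = to_fract (map_poly \<iota> (coeffX k p))"
  and mbed_nth_neg: "n < 0 \<Longrightarrow> fls_nth (mbed p) n = 0"
proof -
  have 1: "fls_nth (ev \<kappa> mX a) n = (if n < 0 then 0 else to_fract [:\<iota> (coeff a (nat n)):])" for a n
  proof (induction a arbitrary: n)
    case 0
    then show ?case by (simp add: ev_0 is_hom_\<kappa> hom_0 hom_\<iota>)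
  next
    case (pCons r a)
    have step: "fls_nth (ev \<kappa> mX (pCons r a)) n
        = (if n = 0 then to_fract [:\<iota> r:] else 0) + fls_nth (ev \<kappa> mX a) (n - 1)"
      by (simp add: ev_pCons is_hom_\<kappa> \<kappa>_def fls_X_times_conv_shift)
    consider "n < 0" | "n = 0" | k where "n = int (Suc k)"
      by (cases n rule: int_cases3) (auto simp: gr0_conv_Suc)
    then show ?case
    proof cases
      case 3
      then have "n - 1 = int k" "nat n = Suc k" by simp_all
      then show ?thesis unfolding step pCons.IH using 3 by simp
    next
      case 2
      then show ?thesis unfolding step using pCons.IH[of "- 1"] by simp
    next
      case 1
      then show ?thesis unfolding step using pCons.IH[of "n - 1"] by simp
    qed
  qed
  have 2: "fls_nth (mbed p) n = (if n < 0 then 0 else to_fract (map_poly \<iota> (coeffX (nat n) p)))" for n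
  proof (induction p)
    case 0
    then show ?case by (simp add: mbed_def ev_0 is_hom_\<kappa> is_hom_ev coeffX_def)
  next
    case (pCons a p)
    have "fls_nth (mbed (pCons a p)) n = fls_nth (ev \<kappa> mX a) n + to_fract [:0, 1:] * fls_nth (mbed p) n"
      by (simp add: mbed_def ev_pCons is_hom_\<kappa> is_hom_ev mZ_def)
    also have "\<dots> = (if n < 0 then 0 else to_fract ([:\<iota> (coeff a (nat n)):] + [:0, 1:] * map_poly \<iota>
        (coeffX (nat n) p)))"
      by (simp add: 1 pCons del: mult_pCons_left)
    finally show ?case
      by (simp add: coeffX_def map_poly_pCons hom_0 hom_\<iota>)
  qed
  show "fls_nth (mbed p) (int k) = to_fract (map_poly \<iota> (coeffX k p))" by (simp add: 2)
  show "n < 0 \<Longrightarrow> fls_nth (mbed p) n = 0" by (simp add: 2)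
qed

lemma map_\<iota>_eq_0: "map_poly \<iota> p = 0 \<longleftrightarrow> p = 0"
  using inj_\<iota> by (auto simp: poly_eq_iff coeff_map_hom hom_\<iota> hom_0)

lemma mbed_eq_0: "mbed p = 0 \<longleftrightarrow> p = 0"
proof
  assume "mbed p = 0"
  then have "coeffX k p = 0" for k
    using mbed_nth[of p k] by (simp add: map_\<iota>_eq_0)
  then show "p = 0"
    by (auto simp: poly_eq_iff coeffX_def coeff_map_poly)
qed (simp add: hom_0 is_hom_mbed)

subsection \<open>The kernel of the model\<close>

lemma B_ideal_add:
  assumes "a \<in> B_ideal d e P Q" "b \<in> B_ideal d e P Q"
  shows "a + b \<in> B_ideal d e P Q"
proof -
  have "(u * f + v * g) + (u' * f + v' * g) = (u + u') * f + (v + v') * g"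
    for u v u' v' f g :: "'r poly poly poly poly" by (simp only: algebra_simps)
  then show ?thesis using assms unfolding B_ideal_iff by blast
qed

lemma B_ideal_mult:
  assumes "a \<in> B_ideal d e P Q"
  shows "b * a \<in> B_ideal d e P Q"
proof -
  have "b * (u * f + v * g) = (b * u) * f + (b * v) * g"
    for u v f g :: "'r poly poly poly poly" by (simp only: algebra_simps)
  then show ?thesis using assms unfolding B_ideal_iff by blast
qed

lemma gens_in_B_ideal:
  "vX ^ d * vY - [:[:P:]:] \<in> B_ideal d e P Q" "vX ^ e * vT - [:Q:] \<in> B_ideal d e P Q"
proof -
  have "a = 1 * a + 0 * b" "b = 0 * a + 1 * b" for a b :: "'r poly poly poly poly" by simp_all
  then show "vX ^ d * vY - [:[:P:]:] \<in> B_ideal d e P Q" "vX ^ e * vT - [:Q:] \<in> B_ideal d e P Q"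
    unfolding B_ideal_iff by blast+
qed

definition X_at0 :: "'r poly poly poly poly \<Rightarrow> 'r poly poly poly" where
  "X_at0 = map_poly Q_at0"

lemma is_hom_X_at0: "is_hom X_at0"
  by (simp add: X_at0_def is_hom_map_poly is_hom_Q_at0)

lemma X_at0_simps:
  "X_at0 vX = 0" "X_at0 [:[:p:]:] = [:[:P_at0 p:]:]" "X_at0 [:b:] = [:Q_at0 b:]"
  by (simp_all add: X_at0_def map_poly_pCons hom_0 is_hom_Q_at0 Q_at0_def P_at0_def)

lemma X_at0_kernel: "X_at0 p = 0 \<Longrightarrow> vX dvd p"
proof -
  have 1: "[:0, 1:] dvd a" if "poly a 0 = 0" for a :: "'r poly"
    using that by (simp add: poly_eq_0_iff_dvd)
  have 2: "[:[:0, 1:]:] dvd a" if "P_at0 a = 0" for a :: "'r poly poly"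
    using that map_poly_kernel_multiples[OF is_hom_poly 1] by (simp add: P_at0_def)
  have 3: "[:[:[:0, 1:]:]:] dvd a" if "Q_at0 a = 0" for a :: "'r poly poly poly"
    using that map_poly_kernel_multiples[OF is_hom_P_at0 2] by (simp add: Q_at0_def)
  show "vX dvd p" if "X_at0 p = 0"
    using that map_poly_kernel_multiples[OF is_hom_Q_at0 3] by (simp add: X_at0_def)
qed

lemma X_at0_surj: "surj X_at0"
proof -
  have "surj (\<lambda>a :: 'r poly. poly a 0)"
    by (rule surjI[of _ "\<lambda>r. [:r:]"]) simp
  then show ?thesis
    unfolding X_at0_def Q_at0_def[abs_def] P_at0_def[abs_def]
    by (intro map_poly_surj is_hom_map_poly is_hom_poly)
qed

text \<open>Modulo \<open>X\<close> the two generators become \<open>- P(0,Z)\<close> and \<open>- Q(0,Y,Z)\<close>, which form a regular sequence. So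
  a relation \<open>u f + v g = 0\<close> modulo \<open>X\<close> is a multiple of the trivial one and can be divided by \<open>X\<close>.\<close>

lemma B_ideal_cancel_X:
  assumes de: "d \<ge> 1" "e \<ge> 1" and p: "vX * p \<in> B_ideal d e P Q"
  shows "p \<in> B_ideal d e P Q"
proof -
  define f where "f = vX ^ d * vY - [:[:P:]:]"
  define g where "g = vX ^ e * vT - [:Q:]"
  note hs = hom_simps[OF is_hom_X_at0]
  obtain u v where uv: "vX * p = u * f + v * g"
    using p unfolding B_ideal_iff f_def g_def by blast
  have f0: "X_at0 f = - [:[:P0:]:]" and g0: "X_at0 g = - [:Q_at0 Q:]"
    using de unfolding f_def g_def
    by (simp_all only: hs X_at0_simps(1) X_at0_simps(2)[of P] X_at0_simps(3)[of Q] P0_def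
        zero_power Suc_le_eq
        One_nat_def mult_zero_left diff_0)
  have rel: "X_at0 u * [:[:P0:]:] + X_at0 v * [:Q_at0 Q:] = 0"
  proof -
    have "0 = X_at0 (u * f + v * g)" unfolding uv[symmetric] by (simp only: hs X_at0_simps(1)) simp
    also have "\<dots> = - (X_at0 u * [:[:P0:]:] + X_at0 v * [:Q_at0 Q:])"
      by (simp only: hs f0 g0 mult_minus_right minus_add_distrib)
    finally show ?thesis by (metis neg_0_equal_iff_equal)
  qed
  have "X_at0 v * [:Q_at0 Q:] = [:[:P0:]:] * (- X_at0 u)"
    using rel by (simp only: eq_neg_iff_add_eq_0 mult_minus_right) (simp only: ac_simps)
  then have dvd: "[:[:P0:]:] dvd X_at0 v * [:Q_at0 Q:]" by (rule dvdI)
  have "[:[:P0:]:] dvd X_at0 v"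
    unfolding const_poly_dvd_iff[of "[:P0:]"]
  proof
    fix n
    have "coeff (X_at0 v * [:Q_at0 Q:]) n = coeff (X_at0 v) n * Q_at0 Q"
      by simp
    then have "[:P0:] dvd coeff (X_at0 v) n * Q_at0 Q"
      using dvd unfolding const_poly_dvd_iff[of "[:P0:]"] by metis
    then show "[:P0:] dvd coeff (X_at0 v) n"
      by (rule monic_dvd_mult_cancel[OF monic_P0 lead_Q0 q_nonzero])
  qed
  then obtain k where k: "X_at0 v = [:[:P0:]:] * k" by (elim dvdE)
  have "[:[:P0:]:] * (X_at0 u + k * [:Q_at0 Q:]) = 0"
    using rel unfolding k by (simp only: algebra_simps)
  moreover have "[:[:P0:]:] \<noteq> 0" using monic_P0 by auto
  ultimately have u0: "X_at0 u = - (k * [:Q_at0 Q:])"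
    by (simp only: mult_eq_0_iff eq_neg_iff_add_eq_0) simp
  \<comment> \<open>Subtracting a lift of the trivial relation makes both coefficients divisible by \<open>X\<close>.\<close>
  obtain k' where k': "X_at0 k' = k" using X_at0_surj by (metis surjD)
  have "X_at0 (u - k' * g) = 0" "X_at0 (v + k' * f) = 0"
    by (simp_all only: hs g0 f0 u0 k k' mult_minus_right diff_minus_eq_add left_minus right_minus
        mult.commute[of "[:[:P0:]:]"])
  then obtain u' v' where u': "u - k' * g = vX * u'" and v': "v + k' * f = vX * v'"
    by (metis X_at0_kernel dvdE)
  have "vX * p = (u - k' * g) * f + (v + k' * f) * g"
    unfolding uv by (simp only: algebra_simps)
  also have "\<dots> = vX * (u' * f + v' * g)"
    unfolding u' v' by (simp only: distrib_left distrib_right ac_simps)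
  finally have "p = u' * f + v' * g"
    by (simp only: mult_cancel_left) simp
  then show ?thesis unfolding B_ideal_iff f_def g_def by blast
qed

lemma B_ideal_cancel_X_power:
  assumes "d \<ge> 1" "e \<ge> 1" shows "vX ^ n * p \<in> B_ideal d e P Q \<Longrightarrow> p \<in> B_ideal d e P Q"
proof (induction n)
  case (Suc n)
  then have "vX * (vX ^ n * p) \<in> B_ideal d e P Q" by (simp only: power_Suc ac_simps)
  then show ?case using Suc.IH B_ideal_cancel_X[OF assms] by blast
qed simp

text \<open>Modulo the ideal, a power of \<open>X\<close> times \<open>Y\<close> or \<open>T\<close> is a polynomial in the preceding variables.\<close>

lemma clear_denominators: "\<exists>n a. vX ^ n * p - [:[:a:]:] \<in> B_ideal d e P Q"
proof -
  let ?I = "B_ideal d e P Q"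
  define S where "S = {p. \<exists>n a. vX ^ n * p - [:[:a:]:] \<in> ?I}"
  have SI: "p \<in> S" if "vX ^ n * p - [:[:a:]:] \<in> ?I" for n a p using that S_def by blast
  have zero: "0 \<in> ?I" using B_ideal_mult[OF gens_in_B_ideal(1), of 0] by simp
  have base: "[:[:a:]:] \<in> S" for a
    by (rule SI[of 0 _ a]) (simp add: zero)
  have mult: "p * p' \<in> S" if "p \<in> S" "p' \<in> S" for p p'
  proof -
    from that obtain n a n' a' where
      1: "vX ^ n * p - [:[:a:]:] \<in> ?I" and 2: "vX ^ n' * p' - [:[:a':]:] \<in> ?I" unfolding S_def by blast
    have "vX ^ (n + n') * (p * p') - [:[:a:]:] * [:[:a':]:]
        = (vX ^ n' * p') * (vX ^ n * p - [:[:a:]:]) + [:[:a:]:] * (vX ^ n' * p' - [:[:a':]:])"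
      by (simp only: algebra_simps power_add)
    also have "\<dots> \<in> ?I" using 1 2 by (intro B_ideal_add B_ideal_mult)
    finally show ?thesis by (intro SI[of "n + n'" _ "a * a'"]) simp
  qed
  have add: "p + p' \<in> S" if "p \<in> S" "p' \<in> S" for p p'
  proof -
    from that obtain n a n' a' where
      1: "vX ^ n * p - [:[:a:]:] \<in> ?I" and 2: "vX ^ n' * p' - [:[:a':]:] \<in> ?I" unfolding S_def by blast
    have vX: "[:[:[:[:0, 1:]:] ^ m:]:] = (vX :: 'r poly poly poly poly) ^ m" for m :: nat
      by (rule hom_power[of "\<lambda>u. [:[:u:]:]"]) (intro is_hom_comp[OF is_hom_const_poly] is_hom_const_poly)
    have "vX ^ (n + n') * (p + p') - (vX ^ n' * [:[:a:]:] + vX ^ n * [:[:a':]:])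
        = vX ^ n' * (vX ^ n * p - [:[:a:]:]) + vX ^ n * (vX ^ n' * p' - [:[:a':]:])"
      by (simp only: algebra_simps power_add)
    also have "\<dots> \<in> ?I" using 1 2 by (intro B_ideal_add B_ideal_mult)
    also have "vX ^ n' * [:[:a:]:] + vX ^ n * [:[:a':]:]
        = [:[:[:[:0, 1:]:] ^ n' * a + [:[:0, 1:]:] ^ n * a':]:]"
      unfolding vX[symmetric] by simp
    finally show ?thesis by (rule SI)
  qed
  have "p \<in> S"
  proof (rule poly4_closed)
    show "vY \<in> S" by (rule SI[OF gens_in_B_ideal(1)])
    have QS: "[:a:] \<in> S" for a
    proof -
      have "[:a:] = ev3 const4 vX vZ vY a" by (rule ev3_self[symmetric])
      have "a \<in> {a. [:a:] \<in> S}"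
      proof (rule poly_closed)
        show "[:0, 1:] \<in> {a. [:a:] \<in> S}" using SI[OF gens_in_B_ideal(1)] by simp
        show "[:c:] \<in> {a. [:a:] \<in> S}" for c using base by simp
        fix p p' assume "p \<in> {a. [:a:] \<in> S}" "p' \<in> {a. [:a:] \<in> S}"
        then show "p + p' \<in> {a. [:a:] \<in> S}" "p * p' \<in> {a. [:a:] \<in> S}"
          using add[of "[:p:]" "[:p':]"] mult[of "[:p:]" "[:p':]"] by (auto simp: mult.commute)
      qed
      then show ?thesis by simp
    qed
    then obtain n a where "vX ^ n * [:Q:] - [:[:a:]:] \<in> ?I" unfolding S_def by blast
    moreover have "vX ^ n * (vX ^ e * vT - [:Q:]) \<in> ?I"
      by (intro B_ideal_mult gens_in_B_ideal)
    ultimately have "vX ^ n * (vX ^ e * vT - [:Q:]) + (vX ^ n * [:Q:] - [:[:a:]:]) \<in> ?I"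
      by (intro B_ideal_add)
    also have "vX ^ n * (vX ^ e * vT - [:Q:]) + (vX ^ n * [:Q:] - [:[:a:]:])
        = vX ^ (n + e) * vT - [:[:a:]:]"
      by (simp only: algebra_simps power_add)
    finally show "vT \<in> S" by (rule SI)
  qed (use base add mult in auto)
  then show ?thesis by (simp add: S_def)
qed

text \<open>Denominators can be cleared, the model is injective on \<open>R[X,Z]\<close>, and the power of \<open>X\<close> can be
  cancelled again.\<close>

lemma model_eq_0_iff:
  assumes de: "d \<ge> 1" "e \<ge> 1"
  shows "model d e p = 0 \<longleftrightarrow> p \<in> B_ideal d e P Q"
proof
  note hs = hom_simps[OF is_hom_model]
  assume p: "model d e p = 0"
  obtain n a where a: "vX ^ n * p - [:[:a:]:] \<in> B_ideal d e P Q" using clear_denominators by blast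
  have "model d e (vX ^ n * p - [:[:a:]:]) = - mbed a"
    by (simp only: hs p model_simps) simp
  then have "a = 0" using model_ideal[OF a] by (simp add: mbed_eq_0)
  then have "vX ^ n * p \<in> B_ideal d e P Q" using a by simp
  then show "p \<in> B_ideal d e P Q" by (rule B_ideal_cancel_X_power[OF de])
qed (rule model_ideal)

end

section \<open>Lifting solutions along \<open>X\<close>\<close>

definition is_subring :: "'a::comm_ring_1 set \<Rightarrow> bool" where
  "is_subring C \<longleftrightarrow> 1 \<in> C \<and> (\<forall>a\<in>C. \<forall>b\<in>C. a - b \<in> C \<and> a * b \<in> C)"

lemma subring_closed:
  assumes "is_subring C"
  shows "1 \<in> C" "0 \<in> C" "a \<in> C \<Longrightarrow> b \<in> C \<Longrightarrow> a - b \<in> C" "a \<in> C \<Longrightarrow> b \<in> C \<Longrightarrow> a * b \<in> C"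
    "a \<in> C \<Longrightarrow> - a \<in> C" "a \<in> C \<Longrightarrow> b \<in> C \<Longrightarrow> a + b \<in> C" "a \<in> C \<Longrightarrow> a ^ n \<in> C"
proof -
  show 1: "1 \<in> C" using assms by (simp add: is_subring_def)
  show d: "a - b \<in> C" if "a \<in> C" "b \<in> C" for a b
    using assms that by (simp add: is_subring_def)
  show 0: "0 \<in> C" using d[OF 1 1] by simp
  show m: "- a \<in> C" if "a \<in> C" for a using d[OF 0 that] by simp
  show "a + b \<in> C" if "a \<in> C" "b \<in> C" using d[OF that(1) m[OF that(2)]] by simp
  show t: "a * b \<in> C" if "a \<in> C" "b \<in> C" for a b using assms that by (simp add: is_subring_def)
  show "a ^ n \<in> C" if "a \<in> C" using that by (induction n) (auto intro: t 1)
qed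

text \<open>Divisibility with the quotient in the subring; in the ambient field \<open>X\<close> is a unit.\<close>

definition dvd_in :: "'a::comm_ring_1 set \<Rightarrow> 'a \<Rightarrow> 'a \<Rightarrow> bool" where
  "dvd_in C a b \<longleftrightarrow> (\<exists>w\<in>C. b = a * w)"

definition unit_mod :: "'a::comm_ring_1 set \<Rightarrow> 'a \<Rightarrow> 'a \<Rightarrow> bool" where
  "unit_mod C x a \<longleftrightarrow> (\<exists>b\<in>C. dvd_in C x (a * b - 1))"

context
  fixes C :: "'a::comm_ring_1 set"
  assumes C: "is_subring C"
begin

lemma dvd_in_0: "dvd_in C x 0"
  using subring_closed(2)[OF C] unfolding dvd_in_def by force

lemma dvd_in_add: "dvd_in C x a \<Longrightarrow> dvd_in C x b \<Longrightarrow> dvd_in C x (a + b)"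
  unfolding dvd_in_def using subring_closed(6)[OF C] by (metis distrib_left)

lemma dvd_in_diff: "dvd_in C x a \<Longrightarrow> dvd_in C x b \<Longrightarrow> dvd_in C x (a - b)"
  unfolding dvd_in_def using subring_closed(3)[OF C] by (metis right_diff_distrib)

lemma dvd_in_uminus: "dvd_in C x (- a) \<longleftrightarrow> dvd_in C x a"
  using dvd_in_diff[OF dvd_in_0, of x a] dvd_in_diff[OF dvd_in_0, of x "- a"] by auto

lemma dvd_in_mult: "dvd_in C x a \<Longrightarrow> b \<in> C \<Longrightarrow> dvd_in C x (a * b)"
  unfolding dvd_in_def using subring_closed(4)[OF C] by (metis mult.assoc)

lemma dvd_in_mult_left: "dvd_in C x a \<Longrightarrow> b \<in> C \<Longrightarrow> dvd_in C x (b * a)"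
  using dvd_in_mult by (simp add: mult.commute)

lemma dvd_in_self: "a \<in> C \<Longrightarrow> dvd_in C x (x * a)"
  unfolding dvd_in_def by blast

lemma dvd_in_power: "dvd_in C (x ^ n) a \<Longrightarrow> x \<in> C \<Longrightarrow> n \<ge> 1 \<Longrightarrow> dvd_in C x a"
  unfolding dvd_in_def using subring_closed(4,7)[OF C]
  by (metis Suc_le_D One_nat_def mult.assoc power_Suc)

lemma dvd_in_trans_diff: "dvd_in C x (a - b) \<Longrightarrow> dvd_in C x (b - c) \<Longrightarrow> dvd_in C x (a - c)"
  using dvd_in_add[of x "a - b" "b - c"] by simp

lemma dvd_in_swap: "dvd_in C x (a - b) \<Longrightarrow> dvd_in C x (b - a)"
  using dvd_in_uminus[of x "a - b"] by simp

lemma unit_mod_cong: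
  assumes "unit_mod C x a" "dvd_in C x (a' - a)"
  shows "unit_mod C x a'"
proof -
  obtain b where b: "b \<in> C" "dvd_in C x (a * b - 1)" using assms(1) unit_mod_def by blast
  have "a' * b - 1 = (a' - a) * b + (a * b - 1)" by (simp add: algebra_simps)
  then show ?thesis
    using b assms(2) by (metis dvd_in_add dvd_in_mult unit_mod_def)
qed

lemma unit_mod_mult:
  assumes "unit_mod C x a" "unit_mod C x b" "a \<in> C" "b \<in> C"
  shows "unit_mod C x (a * b)"
proof -
  obtain a' where a': "a' \<in> C" "dvd_in C x (a * a' - 1)" using assms(1) unit_mod_def by blast
  obtain b' where b': "b' \<in> C" "dvd_in C x (b * b' - 1)" using assms(2) unit_mod_def by blast
  have "(a * b) * (a' * b') - 1 = (a * a' - 1) * (b * b') + (b * b' - 1)"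
    by (simp add: algebra_simps)
  moreover have "b * b' \<in> C" "a' * b' \<in> C" using subring_closed(4)[OF C] assms a' b' by auto
  ultimately show ?thesis
    using a' b' unfolding unit_mod_def by (metis dvd_in_add dvd_in_mult)
qed

text \<open>From \<open>a b = 1 + x\<^sup>k u\<close> and \<open>a b\<^sub>0 = 1 + x v\<close> the product \<open>(1 - a b) (1 - a b\<^sub>0)\<close> is divisible by
  \<open>x\<^sup>k\<^sup>+\<^sup>1\<close>, and it is \<open>1\<close> minus a multiple of \<open>a\<close>.\<close>

lemma unit_mod_power:
  assumes a: "unit_mod C x a" "a \<in> C" and x: "x \<in> C"
  shows "unit_mod C (x ^ k) a"
proof (induction k)
  case 0
  then show ?case
    unfolding unit_mod_def dvd_in_def using a subring_closed[OF C] by (metis mult_1 power_0)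
next
  case (Suc k)
  obtain b where b: "b \<in> C" "dvd_in C x (a * b - 1)" using assms(1) unit_mod_def by blast
  obtain u where u: "u \<in> C" "a * b - 1 = x * u" using b(2) dvd_in_def by blast
  obtain b' where b': "b' \<in> C" "dvd_in C (x ^ k) (a * b' - 1)" using Suc unit_mod_def by blast
  obtain u' where u': "u' \<in> C" "a * b' - 1 = x ^ k * u'" using b'(2) dvd_in_def by blast
  have "a * (b + b' - a * b * b') - 1 = - ((a * b - 1) * (a * b' - 1))"
    by (simp add: algebra_simps)
  also have "\<dots> = x ^ Suc k * (- (u * u'))" by (simp add: u u')
  finally have "dvd_in C (x ^ Suc k) (a * (b + b' - a * b * b') - 1)"
    using u u' subring_closed[OF C] dvd_in_self by metis
  moreover have "b + b' - a * b * b' \<in> C" using a b b' subring_closed[OF C] by simp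
  ultimately show ?case unfolding unit_mod_def by blast
qed

lemma unit_mod_cancel:
  assumes "unit_mod C x a" "h \<in> C" "dvd_in C x (h * a)"
  shows "dvd_in C x h"
proof -
  obtain b where b: "b \<in> C" "dvd_in C x (a * b - 1)" using assms(1) unit_mod_def by blast
  have "h = h * a * b - h * (a * b - 1)" by (simp add: algebra_simps)
  then show ?thesis
    using b assms by (metis dvd_in_diff dvd_in_mult dvd_in_mult_left)
qed

lemma ev_in:
  assumes "is_hom f" "\<And>u. f u \<in> C" "a \<in> C"
  shows "ev f a p \<in> C"
  by (induction p) (use assms subring_closed[OF C] in \<open>auto simp: ev_0 ev_pCons\<close>)

lemma ev_cong_hom:
  assumes "is_hom f" "is_hom g" "\<And>u. dvd_in C x (f u - g u)" "a \<in> C"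
  shows "dvd_in C x (ev f a p - ev g a p)"
proof (induction p)
  case 0
  then show ?case using assms by (simp add: ev_0 dvd_in_0)
next
  case (pCons b p)
  have "ev f a (pCons b p) - ev g a (pCons b p) = (f b - g b) + a * (ev f a p - ev g a p)"
    using assms by (simp add: ev_pCons algebra_simps)
  then show ?case using assms pCons by (metis dvd_in_add dvd_in_mult_left)
qed

lemma ev_taylor:
  assumes "is_hom f" "\<And>u. f u \<in> C" "z \<in> C" "h \<in> C"
  shows "\<exists>w\<in>C. ev f (z + h) p = ev f z p + h * (ev f z (pderiv p) + h * w)"
proof (induction p)
  case 0
  then show ?case using assms subring_closed(2)[OF C] by (intro bexI[of _ 0]) (simp_all add: ev_0)
next
  case (pCons a p)
  then obtain w where w: "w \<in> C" "ev f (z + h) p = ev f z p + h * (ev f z (pderiv p) + h * w)"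
    by blast
  let ?w = "z * w + ev f z (pderiv p) + h * w"
  have "ev f (z + h) (pCons a p)
      = ev f z (pCons a p) + h * (ev f z (pderiv (pCons a p)) + h * ?w)"
    unfolding ev_pCons[OF assms(1)] w(2) using assms
    by (simp add: ev_pCons pderiv_pCons hom_add[OF is_hom_ev] hom_0 algebra_simps)
  moreover have "?w \<in> C"
    using w assms subring_closed[OF C] ev_in[of f z] by simp
  ultimately show ?case by blast
qed

lemma ev_cong_point:
  fixes p :: "'b::idom poly"
  assumes "is_hom f" "\<And>u. f u \<in> C" "z \<in> C" "z' \<in> C" "dvd_in C x (z' - z)"
  shows "dvd_in C x (ev f z' p - ev f z p)"
proof -
  obtain w where w: "w \<in> C"
    "ev f (z + (z' - z)) p = ev f z p + (z' - z) * (ev f z (pderiv p) + (z' - z) * w)"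
    using ev_taylor[of f z "z' - z" p] assms subring_closed(3)[OF C] by blast
  then have "ev f z' p - ev f z p = (z' - z) * (ev f z (pderiv p) + (z' - z) * w)" by simp
  moreover have "ev f z (pderiv p) + (z' - z) * w \<in> C"
    using w assms ev_in[of f z] subring_closed[OF C] by simp
  ultimately show ?thesis using dvd_in_mult assms by metis
qed

end

locale danielewski_subring = danielewski \<iota> P Q q
  for \<iota> :: "'r::idom \<Rightarrow> 'f::alg_closed_field" and P Q q +
  fixes C :: "'m::idom set" and c :: "'r \<Rightarrow> 'm" and x :: 'm
  assumes C: "is_subring C" and c: "is_hom c" "\<And>r. c r \<in> C" and x: "x \<in> C" "x \<noteq> 0"
begin

abbreviation p where "p z \<equiv> ev2 c x z P"
abbreviation p' where "p' z \<equiv> ev2 c x z (pderiv P)"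
abbreviation qq where "qq z y \<equiv> ev3 c x z y Q"
abbreviation q' where "q' z y \<equiv> ev3 c x z y (pderiv Q)"

lemmas sc = subring_closed[OF C]

lemma ev_in1: "ev c x a \<in> C" by (rule ev_in[OF C c x(1)])
lemma ev_in2: "z \<in> C \<Longrightarrow> ev2 c x z b \<in> C" by (rule ev_in[OF C is_hom_ev[OF c(1)] ev_in1])
lemma ev_in3: "z \<in> C \<Longrightarrow> y \<in> C \<Longrightarrow> ev3 c x z y g \<in> C"
  by (rule ev_in[OF C is_hom_ev[OF is_hom_ev[OF c(1)]] ev_in2])

lemma ev_map_poly: "is_hom f \<Longrightarrow> is_hom g \<Longrightarrow> ev g a (map_poly f b) = ev (\<lambda>u. g (f u)) a b"
  by (induction b) (simp_all add: map_poly_pCons ev_0 ev_pCons hom_0 is_hom_comp)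

lemma at0_cong1: "dvd_in C x (ev c x a - c (poly a 0))"
proof (induction a)
  case 0
  then show ?case using c by (simp add: ev_0 hom_0 dvd_in_0[OF C])
next
  case (pCons r a)
  then show ?case using c dvd_in_self[OF C ev_in1] by (simp add: ev_pCons)
qed

lemma at0_cong2: "z \<in> C \<Longrightarrow> dvd_in C x (ev2 c x z b - ev c z (P_at0 b))"
  unfolding P_at0_def ev_map_poly[OF is_hom_poly c(1)]
  by (intro ev_cong_hom[OF C] is_hom_ev is_hom_comp[OF c(1)] c is_hom_poly at0_cong1)

lemma at0_cong3: "z \<in> C \<Longrightarrow> y \<in> C \<Longrightarrow> dvd_in C x (ev3 c x z y g - ev2 c z y (Q_at0 g))"
  unfolding Q_at0_def ev_map_poly[OF is_hom_P_at0 is_hom_ev[OF c(1)]]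
  by (intro ev_cong_hom[OF C] is_hom_ev is_hom_comp[OF is_hom_ev[OF c(1)]] c is_hom_P_at0 at0_cong2)

text \<open>At a root of \<open>P\<close> modulo \<open>X\<close> only the second summand of \<open>u P(0,Z) + v P'(0,Z) = 1\<close> survives.\<close>

lemma unit_p':
  assumes z: "z \<in> C" and pz: "dvd_in C x (p z)"
  shows "unit_mod C x (p' z)"
proof -
  have hz: "is_hom (ev c z)" and ez: "ev c z a \<in> C" for a
    using is_hom_ev[OF c(1)] ev_in[OF C c z] by auto
  obtain u v where uv: "u * P_at0 P + v * P_at0 (pderiv P) = 1" using unit_P by blast
  have "ev c z (u * P_at0 P + v * P_at0 (pderiv P)) = 1" unfolding uv by (rule hom_1[OF hz])
  then have eq: "ev c z u * ev c z (P_at0 P) + ev c z v * ev c z (P_at0 (pderiv P)) = 1"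
    by (simp only: hom_add[OF hz] hom_mult[OF hz])
  have "dvd_in C x (ev c z (P_at0 P))"
    using dvd_in_diff[OF C pz at0_cong2[OF z, of P]] by simp
  then have "dvd_in C x (ev c z u * ev c z (P_at0 P))"
    using dvd_in_mult_left[OF C] ez by blast
  moreover have "ev c z (P_at0 (pderiv P)) * ev c z v - 1 = - (ev c z u * ev c z (P_at0 P))"
    using eq by (simp add: algebra_simps)
  ultimately have "unit_mod C x (ev c z (P_at0 (pderiv P)))"
    unfolding unit_mod_def using ez dvd_in_uminus[OF C] by metis
  then show ?thesis by (rule unit_mod_cong[OF C _ at0_cong2[OF z]])
qed

lemma unit_q':
  assumes z: "z \<in> C" and y: "y \<in> C" and pz: "dvd_in C x (p z)" and qz: "dvd_in C x (qq z y)"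
  shows "unit_mod C x (q' z y)"
proof -
  have ez: "ev c z a \<in> C" for a using ev_in[OF C c z] by auto
  have hz: "is_hom (ev2 c z y)" using is_hom_ev[OF is_hom_ev[OF c(1)]] by auto
  have ezy: "ev2 c z y a \<in> C" for a using ev_in[OF C is_hom_ev[OF c(1)] ez y] by auto
  obtain u v w where uvw: "u * [:P_at0 P:] + v * Q_at0 Q + w * Q_at0 (pderiv Q) = 1"
    using unit_Q by blast
  have "ev2 c z y (u * [:P_at0 P:] + v * Q_at0 Q + w * Q_at0 (pderiv Q)) = 1"
    unfolding uvw by (rule hom_1[OF hz])
  then have eq: "ev2 c z y u * ev c z (P_at0 P) + ev2 c z y v * ev2 c z y (Q_at0 Q)
      + ev2 c z y w * ev2 c z y (Q_at0 (pderiv Q)) = 1"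
    by (simp only: hom_add[OF hz] hom_mult[OF hz] ev_const[OF is_hom_ev[OF c(1)]])
  have "dvd_in C x (ev c z (P_at0 P))"
    using dvd_in_diff[OF C pz at0_cong2[OF z, of P]] by simp
  then have 1: "dvd_in C x (ev2 c z y u * ev c z (P_at0 P))"
    using dvd_in_mult_left[OF C] ezy by blast
  have "dvd_in C x (ev2 c z y (Q_at0 Q))"
    using dvd_in_diff[OF C qz at0_cong3[OF z y, of Q]] by simp
  then have 2: "dvd_in C x (ev2 c z y v * ev2 c z y (Q_at0 Q))"
    using dvd_in_mult_left[OF C] ezy by blast
  have "ev2 c z y (Q_at0 (pderiv Q)) * ev2 c z y w - 1
      = - (ev2 c z y u * ev c z (P_at0 P) + ev2 c z y v * ev2 c z y (Q_at0 Q))"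
    using eq by (simp add: algebra_simps)
  then have "unit_mod C x (ev2 c z y (Q_at0 (pderiv Q)))"
    unfolding unit_mod_def using ezy dvd_in_uminus[OF C] dvd_in_add[OF C 1 2] by metis
  then show ?thesis by (rule unit_mod_cong[OF C _ at0_cong3[OF z y]])
qed

lemma p_taylor:
  assumes "z \<in> C" "h \<in> C"
  shows "\<exists>w\<in>C. p (z + h) = p z + h * (p' z + h * w)"
  by (rule ev_taylor[OF C is_hom_ev[OF c(1)] ev_in1 assms])

lemma q_taylor:
  assumes "z \<in> C" "y \<in> C" "k \<in> C"
  shows "\<exists>w\<in>C. qq z (y + k) = qq z y + k * (q' z y + k * w)"
  by (rule ev_taylor[OF C is_hom_ev[OF is_hom_ev[OF c(1)]] ev_in2[OF assms(1)] assms(2,3)])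

lemma q_cong_z: "z \<in> C \<Longrightarrow> z' \<in> C \<Longrightarrow> y \<in> C \<Longrightarrow> dvd_in C u (z' - z) \<Longrightarrow> dvd_in C u (qq z' y - qq z y)"
  by (rule ev_cong_hom[OF C])
    (simp_all add: c is_hom_ev ev_cong_point[OF C is_hom_ev[OF c(1)] ev_in1])

lemma q_cong_y: "z \<in> C \<Longrightarrow> y' \<in> C \<Longrightarrow> y \<in> C \<Longrightarrow> dvd_in C u (y' - y) \<Longrightarrow> dvd_in C u (qq z y' - qq z y)"
  by (rule ev_cong_point[OF C is_hom_ev[OF is_hom_ev[OF c(1)]] ev_in2])

lemma q_cong:
  assumes "z \<in> C" "z' \<in> C" "y \<in> C" "y' \<in> C" "dvd_in C u (z' - z)" "dvd_in C u (y' - y)"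
  shows "dvd_in C u (qq z' y' - qq z y)"
  using dvd_in_trans_diff[OF C q_cong_y[of z' y' y u] q_cong_z[of z z' y u]] assms by simp

text \<open>A root of \<open>P\<close> modulo \<open>X\<close> lifts to a root modulo \<open>X\<^sup>k\<close> by Newton's method, as \<open>P'\<close> is
  invertible modulo \<open>X\<close> at every such root.\<close>

lemma lift_P:
  assumes z0: "z0 \<in> C" "dvd_in C x (p z0)"
  shows "\<exists>z\<in>C. dvd_in C (x ^ Suc k) (p z) \<and> dvd_in C x (z - z0)"
proof (induction k)
  case 0
  then show ?case using z0 dvd_in_0[OF C] by (intro bexI[of _ z0]) simp_all
next
  case (Suc k)
  then obtain z where z: "z \<in> C" "dvd_in C (x ^ Suc k) (p z)" "dvd_in C x (z - z0)" by blast
  obtain a where a: "a \<in> C" "p z = x ^ Suc k * a" using z(2) dvd_in_def by blast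
  have "dvd_in C x (p z)" by (rule dvd_in_power[OF C z(2) x(1)]) simp
  then obtain b u where b: "b \<in> C" "u \<in> C" "p' z * b - 1 = x * u"
    using unit_p'[OF z(1)] unfolding unit_mod_def dvd_in_def by blast
  \<comment> \<open>The Newton correction: \<open>b\<close> inverts \<open>P'(z)\<close> modulo \<open>X\<close>, and \<open>a\<close> is the error.\<close>
  define h where "h = x ^ Suc k * (- (a * b))"
  have h: "h \<in> C" using a b x sc by (simp add: h_def)
  obtain w where w: "w \<in> C" "p (z + h) = p z + h * (p' z + h * w)"
    using p_taylor[OF z(1) h] by blast
  have "p (z + h) = x ^ Suc k * (- (a * (p' z * b - 1))) + (x ^ Suc k * x ^ Suc k) * (a * b * (a *
      b) * w)"
    unfolding w(2) a(2) by (simp add: h_def algebra_simps)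
  also have "\<dots> = x ^ Suc (Suc k) * (- (a * u) + x ^ k * (a * b * (a * b) * w))"
    unfolding b(3) by (simp add: algebra_simps)
  finally have "dvd_in C (x ^ Suc (Suc k)) (p (z + h))"
    using a b w x sc dvd_in_self[OF C] by simp
  moreover have "dvd_in C x (z + h - z0)"
  proof -
    have "dvd_in C x h" unfolding h_def power_Suc mult.assoc
      by (rule dvd_in_self[OF C]) (use a b x sc in simp)
    then show ?thesis using dvd_in_add[OF C z(3), of h] by (simp add: algebra_simps)
  qed
  moreover have "z + h \<in> C" using z h sc by simp
  ultimately show ?case by blast
qed

lemma lift_P_Y:
  assumes z0: "z0 \<in> C" "dvd_in C x (p z0)" and y0: "y0 \<in> C" and d: "d \<ge> 1"
  shows "\<exists>z\<in>C. \<exists>y\<in>C. x ^ d * y = p z \<and> dvd_in C x (z - z0) \<and> dvd_in C x (y - y0)"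
proof -
  obtain k where k: "d = Suc k" using d by (cases d) auto
  obtain z where z: "z \<in> C" "dvd_in C (x ^ d) (p z)" "dvd_in C x (z - z0)"
    using lift_P[OF z0, of k] k by blast
  obtain a where a: "a \<in> C" "p z = x ^ d * a" using z(2) dvd_in_def by blast
  have "dvd_in C x (p z)" by (rule dvd_in_power[OF C z(2) x(1) d])
  then obtain b u where b: "b \<in> C" "u \<in> C" "p' z * b - 1 = x * u"
    using unit_p'[OF z(1)] unfolding unit_mod_def dvd_in_def by blast
  \<comment> \<open>Adding \<open>X\<^sup>d h\<close> to \<open>z\<close> changes the quotient \<open>a\<close> by \<open>P'(z) h\<close> modulo \<open>X\<close>.\<close>
  define h where "h = b * (y0 - a)"
  have h: "h \<in> C" using a b x sc y0 by (simp add: h_def)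
  have xh: "x ^ d * h \<in> C" using h x sc by simp
  obtain w where w: "w \<in> C" "p (z + x ^ d * h) = p z + (x ^ d * h) * (p' z + (x ^ d * h) * w)"
    using p_taylor[OF z(1) xh] by blast
  define y where "y = a + h * (p' z + (x ^ d * h) * w)"
  have "x ^ d * y = p (z + x ^ d * h)" unfolding w(2) a(2) y_def by (simp add: algebra_simps)
  moreover have "y \<in> C" unfolding y_def using a h xh w sc ev_in2[OF z(1)] by simp
  moreover have "dvd_in C x (z + x ^ d * h - z0)"
  proof -
    have "dvd_in C x (x ^ d * h)" unfolding k power_Suc mult.assoc
      by (rule dvd_in_self[OF C]) (use h x sc in simp)
    then show ?thesis using dvd_in_add[OF C z(3), of "x ^ d * h"] by (simp add: algebra_simps)
  qed
  moreover have "dvd_in C x (y - y0)"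
  proof -
    have "y - y0 = (y0 - a) * (p' z * b - 1) + x * (x ^ k * h * h * w)"
      unfolding y_def k by (simp add: h_def algebra_simps)
    also have "\<dots> = x * ((y0 - a) * u + x ^ k * h * h * w)"
      unfolding b(3) by (simp add: algebra_simps)
    finally show ?thesis using a b h w x y0 sc dvd_in_self[OF C] by simp
  qed
  moreover have "z + x ^ d * h \<in> C" using z xh sc by simp
  ultimately show ?thesis by blast
qed

text \<open>The second equation is solved in the same way: a correction of \<open>z\<close> by a multiple of
  \<open>X\<^sup>d\<^sup>+\<^sup>k\<close> changes \<open>y\<close> by \<open>P'\<close> times the corresponding multiple of \<open>X\<^sup>k\<close>, and \<open>P' Q'\<close> is
  invertible modulo \<open>X\<close>.\<close>

lemma lift_solution_approx:
  assumes z0: "z0 \<in> C" "dvd_in C x (p z0)" and y0: "y0 \<in> C" "dvd_in C x (qq z0 y0)" and d: "d \<ge> 1"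
  shows "\<exists>z\<in>C. \<exists>y\<in>C. x ^ d * y = p z \<and> dvd_in C (x ^ Suc k) (qq z y) \<and>
           dvd_in C x (z - z0) \<and> dvd_in C x (y - y0)"
proof (induction k)
  case 0
  obtain z y where zy: "z \<in> C" "y \<in> C" "x ^ d * y = p z" "dvd_in C x (z - z0)" "dvd_in C x (y - y0)"
    using lift_P_Y[OF z0 y0(1) d] by blast
  have "dvd_in C x (qq z y)"
    using dvd_in_add[OF C q_cong[OF z0(1) zy(1) y0(1) zy(2,4,5)] y0(2)] by simp
  then show ?case using zy by auto
next
  case (Suc k)
  then obtain z y where zy: "z \<in> C" "y \<in> C" "x ^ d * y = p z" "dvd_in C (x ^ Suc k) (qq z y)"
    "dvd_in C x (z - z0)" "dvd_in C x (y - y0)" by blast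
  obtain a where a: "a \<in> C" "qq z y = x ^ Suc k * a" using zy(4) dvd_in_def by blast
  have pz: "dvd_in C x (p z)"
    by (rule dvd_in_power[OF C _ x(1) d]) (use zy dvd_in_self[OF C] in metis)
  have qz: "dvd_in C x (qq z y)" by (rule dvd_in_power[OF C zy(4) x(1)]) simp
  have "unit_mod C x (p' z * q' z y)"
    by (intro unit_mod_mult[OF C] unit_p' unit_q' ev_in2 ev_in3 zy pz qz)
  then obtain b u where b: "b \<in> C" "u \<in> C" "p' z * q' z y * b - 1 = x * u"
    unfolding unit_mod_def dvd_in_def by blast
  have pC: "p' z \<in> C" "q' z y \<in> C" using ev_in2 ev_in3 zy by auto
  define h where "h = - (a * b)"
  define hz where "hz = x ^ (d + Suc k) * h"
  have hC: "h \<in> C" "hz \<in> C" using a b x sc by (simp_all add: h_def hz_def)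
  obtain w where w: "w \<in> C" "p (z + hz) = p z + hz * (p' z + hz * w)"
    using p_taylor[OF zy(1) hC(2)] by blast
  define hy where "hy = x ^ Suc k * (h * (p' z + hz * w))"
  have hyC: "hy \<in> C" using w hC x pC sc by (simp add: hy_def)
  have eq: "x ^ d * (y + hy) = p (z + hz)"
    unfolding w(2) zy(3)[symmetric] by (simp add: hy_def hz_def algebra_simps power_add)
  obtain w1 where w1: "w1 \<in> C" "qq z (y + hy) = qq z y + hy * (q' z y + hy * w1)"
    using q_taylor[OF zy(1,2) hyC] by blast
  have zC: "z + hz \<in> C" "y + hy \<in> C" using zy hC hyC sc by auto
  have dhz: "dvd_in C (x ^ Suc (Suc k)) hz"
  proof -
    obtain d' where "d = Suc d'" using d by (cases d) auto
    then have "hz = x ^ Suc (Suc k) * (x ^ d' * h)" by (simp add: hz_def power_add)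
    then show ?thesis using dvd_in_self[OF C] x hC sc by simp
  qed
  have "dvd_in C (x ^ Suc (Suc k)) (qq (z + hz) (y + hy) - qq z (y + hy))"
    by (rule q_cong_z) (use zy zC dhz in auto)
  moreover have "dvd_in C (x ^ Suc (Suc k)) (qq z (y + hy))"
  proof -
    obtain v where v: "v \<in> C" "hz = x * v"
      using dvd_in_power[OF C dhz x(1)] unfolding dvd_in_def by auto
    have "qq z (y + hy) = x ^ Suc k * (a + h * (p' z * q' z y)) + x ^ Suc k * (h * hz * w * q' z y)
        + hy * hy * w1"
      unfolding w1(2) a(2) by (simp add: hy_def algebra_simps)
    also have "a + h * (p' z * q' z y) = - (a * (p' z * q' z y * b - 1))"
      by (simp add: h_def algebra_simps)
    also have "x ^ Suc k * (- (a * (p' z * q' z y * b - 1))) + x ^ Suc k * (h * hz * w * q' z y)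
        + hy * hy * w1
      = x ^ Suc (Suc k) * (- (a * u) + h * v * w * q' z y
          + x ^ k * (h * (p' z + hz * w)) * (h * (p' z + hz * w)) * w1)"
      unfolding b(3) by (simp add: hy_def v(2) algebra_simps)
    finally show ?thesis
      using a b v w w1 hC pC x sc dvd_in_self[OF C] by simp
  qed
  ultimately have "dvd_in C (x ^ Suc (Suc k)) (qq (z + hz) (y + hy))"
    using dvd_in_add[OF C] by fastforce
  moreover have "dvd_in C x (z + hz - z0)"
    using dvd_in_add[OF C zy(5) dvd_in_power[OF C dhz x(1)]] by (simp add: algebra_simps)
  moreover have "dvd_in C x (y + hy - y0)"
  proof -
    have "dvd_in C (x ^ Suc k) hy"
      unfolding hy_def using dvd_in_self[OF C] hC w pC sc by simp
    then have "dvd_in C x hy" by (rule dvd_in_power[OF C _ x(1)]) simp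
    then show ?thesis using dvd_in_add[OF C zy(6)] by (metis add_diff_eq diff_add_eq)
  qed
  ultimately show ?case using eq zC by blast
qed

lemma lift_solution:
  assumes "z0 \<in> C" "dvd_in C x (p z0)" "y0 \<in> C" "dvd_in C x (qq z0 y0)" "d \<ge> 1" "e \<ge> 1"
  shows "\<exists>z\<in>C. \<exists>y\<in>C. \<exists>t\<in>C. solution d e c x z y t \<and> dvd_in C x (z - z0) \<and> dvd_in C x (y - y0)"
proof -
  obtain k where "e = Suc k" using assms(6) by (cases e) auto
  then show ?thesis
    using lift_solution_approx[OF assms(1-5), of k] unfolding solution_def dvd_in_def[of C "x ^ Suc k"]
    by metis
qed

text \<open>Moving \<open>z\<close> by a multiple of \<open>X\<^sup>d\<^sup>+\<^sup>e\<close> moves \<open>y\<close> by a multiple of \<open>X\<^sup>e\<close>, and both equations stay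
  solvable. These are the translations along the fibres of the torsor.\<close>

lemma perturb_solution:
  assumes sol: "solution d e c x z y t" and zC: "z \<in> C" "y \<in> C" "t \<in> C" and h: "h \<in> C" and e: "e \<ge> 1"
  shows "\<exists>y'\<in>C. \<exists>t'\<in>C. solution d e c x (z + x ^ (d + e) * h) y' t' \<and> dvd_in C x (y' - y)"
proof -
  define hz where "hz = x ^ (d + e) * h"
  have hz: "hz \<in> C" using h x sc by (simp add: hz_def)
  obtain w where w: "w \<in> C" "p (z + hz) = p z + hz * (p' z + hz * w)"
    using p_taylor[OF zC(1) hz] by blast
  define hy where "hy = x ^ e * (h * (p' z + hz * w))"
  have dy: "dvd_in C (x ^ e) hy"
    unfolding hy_def using dvd_in_self[OF C] h hz w ev_in2[OF zC(1)] sc by simp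
  have hy: "hy \<in> C" using h hz x w ev_in2[OF zC(1)] sc by (simp add: hy_def)
  have dz: "dvd_in C (x ^ e) hz"
  proof -
    have "hz = x ^ e * (x ^ d * h)" by (simp add: hz_def power_add)
    then show ?thesis using dvd_in_self[OF C] x h sc by simp
  qed
  have "x ^ d * (y + hy) = p (z + hz)"
    using sol unfolding w(2) solution_def by (simp add: hy_def hz_def algebra_simps power_add)
  moreover have "dvd_in C (x ^ e) (qq (z + hz) (y + hy) - qq z y)"
    by (rule q_cong) (use zC hz hy dz dy sc in auto)
  then obtain t0 where t0: "t0 \<in> C" "qq (z + hz) (y + hy) - qq z y = x ^ e * t0"
    unfolding dvd_in_def by blast
  have "x ^ e * (t + t0) = qq (z + hz) (y + hy)"
    using sol t0(2) unfolding solution_def by (simp add: algebra_simps)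
  ultimately have "solution d e c x (z + hz) (y + hy) (t + t0)"
    by (simp add: solution_def)
  moreover have "dvd_in C x (y + hy - y)" using dvd_in_power[OF C dy x(1) e] by simp
  moreover have "y + hy \<in> C" "t + t0 \<in> C" using zC hy t0 sc by simp_all
  ultimately show ?thesis unfolding hz_def[symmetric] by blast
qed

text \<open>Two solutions on the same branch over \<open>X = 0\<close> have the same \<open>z\<close> modulo \<open>X\<^sup>d\<^sup>+\<^sup>e\<close>: the
  first equation gives \<open>X\<^sup>d\<close>, and the quotient of the difference by \<open>X\<^sup>d\<close> is, up to a unit, the
  difference of the values of \<open>y\<close>, to which the second equation applies.\<close>

lemma solution_unique:
  assumes s1: "solution d e c x z1 y1 t1" and s2: "solution d e c x z2 y2 t2"
    and in1: "z1 \<in> C" "y1 \<in> C" "t1 \<in> C" and in2: "z2 \<in> C" "y2 \<in> C" "t2 \<in> C"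
    and dz: "dvd_in C x (z1 - z2)" and dy: "dvd_in C x (y1 - y2)" and d: "d \<ge> 1" and e: "e \<ge> 1"
  shows "dvd_in C (x ^ (d + e)) (z1 - z2)"
proof -
  define h where "h = z1 - z2"
  define k where "k = y1 - y2"
  have hk: "h \<in> C" "k \<in> C" using in1 in2 sc by (simp_all add: h_def k_def)
  have pC: "p' z2 \<in> C" "q' z2 y2 \<in> C" using ev_in2 ev_in3 in2 by auto
  have pz: "dvd_in C x (p z2)"
    by (rule dvd_in_power[OF C _ x(1) d]) (use s2 in2 dvd_in_self[OF C] solution_def in metis)
  have qz: "dvd_in C x (qq z2 y2)"
    by (rule dvd_in_power[OF C _ x(1) e]) (use s2 in2 dvd_in_self[OF C] solution_def in metis)
  obtain w where w: "w \<in> C" "p (z2 + h) = p z2 + h * (p' z2 + h * w)"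
    using p_taylor[OF in2(1) hk(1)] by blast
  define a where "a = p' z2 + h * w"
  have a: "a \<in> C" using w hk pC sc by (simp add: a_def)
  have ua: "unit_mod C x a"
    by (rule unit_mod_cong[OF C unit_p'[OF in2(1) pz]])
      (use dvd_in_mult[OF C dz, of w] w in \<open>simp add: a_def h_def\<close>)
  have xk: "x ^ d * k = h * a"
    using w(2) s1 s2 unfolding solution_def by (simp add: h_def k_def a_def algebra_simps)
  have "dvd_in C (x ^ d) h"
    by (rule unit_mod_cancel[OF C unit_mod_power[OF C ua a x(1)] hk(1)])
      (use xk hk dvd_in_self[OF C] in metis)
  then obtain v where v: "v \<in> C" "h = x ^ d * v" unfolding dvd_in_def by blast
  have kv: "k = v * a" using xk x(2) unfolding v(2) by (simp add: mult.assoc)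
  obtain w1 where w1: "w1 \<in> C" "qq z2 (y2 + k) = qq z2 y2 + k * (q' z2 y2 + k * w1)"
    using q_taylor[OF in2(1,2) hk(2)] by blast
  have "dvd_in C h (qq z1 y1 - qq z2 y1)"
    by (rule q_cong_z[OF in2(1) in1(1,2)])
      (use dvd_in_self[OF C sc(1), of h] in \<open>simp add: h_def\<close>)
  then obtain w2 where w2: "w2 \<in> C" "qq z1 y1 - qq z2 y1 = h * w2" unfolding dvd_in_def by blast
  define b where "b = a * (q' z2 y2 + k * w1) + x ^ d * w2"
  have "x ^ e * (t1 - t2) = qq z1 y1 - qq z2 y2"
    using s1 s2 unfolding solution_def by (simp add: algebra_simps)
  also have "\<dots> = h * w2 + (qq z2 (y2 + k) - qq z2 y2)"
    using w2(2) by (simp add: k_def algebra_simps)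
  also have "\<dots> = v * b" unfolding w1(2) b_def by (simp add: v(2) kv algebra_simps)
  finally have xt: "x ^ e * (t1 - t2) = v * b" .
  have bC: "b \<in> C" using a pC hk w1 w2 x sc by (simp add: b_def)
  have "unit_mod C x (a * q' z2 y2)"
    by (intro unit_mod_mult[OF C] ua unit_q' in2 pz qz a pC)
  moreover have "dvd_in C x (b - a * q' z2 y2)"
  proof -
    have "b - a * q' z2 y2 = k * (a * w1) + x ^ d * w2" by (simp add: b_def algebra_simps)
    moreover have "dvd_in C x (k * (a * w1))"
      using dvd_in_mult[OF C dy, of "a * w1"] a w1 sc by (simp add: k_def)
    moreover have "dvd_in C x (x ^ d * w2)"
      by (rule dvd_in_power[OF C dvd_in_self[OF C w2(1)] x(1) d])
    ultimately show ?thesis using dvd_in_add[OF C] by metis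
  qed
  ultimately have ub: "unit_mod C x b" by (rule unit_mod_cong[OF C])
  have "dvd_in C (x ^ e) v"
    by (rule unit_mod_cancel[OF C unit_mod_power[OF C ub bC x(1)] v(1)])
      (use xt in1 in2 sc dvd_in_self[OF C] in metis)
  then show ?thesis
    unfolding h_def[symmetric] v(2) dvd_in_def by (auto simp: power_add)
qed

end

section \<open>Stable isomorphism\<close>

lemma is_subring_range: "is_hom f \<Longrightarrow> is_subring (range f)"
  unfolding is_subring_def by (metis (no_types, lifting) hom_1 hom_diff hom_mult imageE rangeI)

context danielewski
begin

abbreviation polymodel where "polymodel d e \<equiv> map_poly (model d e)"

lemma is_hom_polymodel: "is_hom (polymodel d e)"
  by (rule is_hom_map_poly[OF is_hom_model])

lemma polymodel_simps:
  "polymodel d e [:a:] = [:model d e a:]" "polymodel d e [:0, 1:] = [:0, 1:]"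
  by (simp_all add: map_poly_pCons hom_simps[OF is_hom_model])

text \<open>The equations are polynomial identities between elements of the source of \<open>E\<close>, modulo its kernel.\<close>

lemma solution_transport:
  assumes F: "is_hom F" "\<And>a. E a = 0 \<Longrightarrow> F a = 0" and E: "is_hom E"
    and s: "solution d e (\<lambda>r. E (k r)) (E x) (E z) (E y) (E t)" and k: "is_hom k"
  shows "solution d e (\<lambda>r. F (k r)) (F x) (F z) (F y) (F t)"
proof -
  have "E (x ^ d * y - ev2 k x z P) = 0" "E (x ^ e * t - ev3 k x z y Q) = 0"
    using s unfolding solution_def
    by (simp_all add: hom_simps[OF E] hom_ev2[OF E k] hom_ev3[OF E k])
  then have "F (x ^ d * y - ev2 k x z P) = 0" "F (x ^ e * t - ev3 k x z y Q) = 0"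
    by (auto intro: F(2))
  then show ?thesis
    unfolding solution_def
    by (simp add: hom_simps[OF F(1)] hom_ev2[OF F(1) k] hom_ev3[OF F(1) k])
qed

lemma model_subring:
  shows "danielewski_subring \<iota> P Q q (range (model d e)) \<kappa> mX"
proof -
  have "\<kappa> r \<in> range (model d e)" for r using model_simps(1)[of d e r] by (metis rangeI)
  moreover have "mX \<in> range (model d e)" using model_simps(2)[of d e] by (metis rangeI)
  ultimately show ?thesis
    by (intro danielewski_subring.intro danielewski_axioms danielewski_subring_axioms.intro)
      (auto simp: is_subring_range is_hom_model is_hom_\<kappa>)
qed

lemma polymodel_subring:
  shows "danielewski_subring \<iota> P Q q (range (polymodel d e)) (\<lambda>r. [:\<kappa> r:]) [:mX:]"
proof -
  have "[:\<kappa> r:] \<in> range (polymodel d e)" for r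
    using polymodel_simps(1)[of d e "const4 r"] by (metis rangeI model_simps(1))
  moreover have "[:mX:] \<in> range (polymodel d e)"
    using polymodel_simps(1)[of d e vX] by (metis rangeI model_simps(2))
  ultimately show ?thesis
    by (intro danielewski_subring.intro danielewski_axioms danielewski_subring_axioms.intro)
      (auto simp: is_subring_range is_hom_polymodel is_hom_comp[OF is_hom_const_poly is_hom_\<kappa>])
qed

text \<open>Approximate coordinates of the second surface inside the ring of the first: a solution of the
  second pair of equations lying on the same branches over \<open>X = 0\<close>.\<close>

definition crossing where
  "crossing d e d' e' g \<longleftrightarrow> (\<exists>h t. solution d' e' \<kappa> mX (model d e g) (model d e h) (model d e t) \<and>
     dvd_in (range (model d e)) mX (model d e g - mZ) \<and>
     dvd_in (range (model d e)) mX (model d e h - mY d))"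

lemma crossing_exists:
  assumes "d \<ge> 1" "e \<ge> 1" "d' \<ge> 1" "e' \<ge> 1"
  shows "\<exists>g. crossing d e d' e' g"
proof -
  interpret danielewski_subring \<iota> P Q q "range (model d e)" \<kappa> mX by (rule model_subring)
  have in_A: "mZ \<in> range (model d e)" "mY d \<in> range (model d e)" "mT d e \<in> range (model d e)"
    using model_simps[of d e] by (metis rangeI)+
  have pz: "dvd_in (range (model d e)) mX (p mZ)"
    using dvd_in_power[OF C dvd_in_self[OF C in_A(2)] x(1) assms(1)] solution_model[of d e]
    by (simp only: solution_def)
  have qz: "dvd_in (range (model d e)) mX (qq mZ (mY d))"
    using dvd_in_power[OF C dvd_in_self[OF C in_A(3)] x(1) assms(2)] solution_model[of d e]
    by (simp only: solution_def)
  obtain G H T where "G \<in> range (model d e)" "H \<in> range (model d e)" "T \<in> range (model d e)"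
    and GHT: "solution d' e' \<kappa> mX G H T" "dvd_in (range (model d e)) mX (G - mZ)"
    "dvd_in (range (model d e)) mX (H - mY d)"
    using lift_solution[OF in_A(1) pz in_A(2) qz assms(3,4)] by blast
  then obtain g h t where "G = model d e g" "H = model d e h" "T = model d e t" by blast
  then show ?thesis using GHT unfolding crossing_def by blast
qed

text \<open>The homomorphism from \<open>A[W]\<close> to \<open>A'[W]\<close> in terms of the models: it sends \<open>z\<close> to the approximation
  \<open>g'\<close> plus \<open>X\<^sup>d\<^sup>+\<^sup>e W\<close>, and \<open>W\<close> to the quotient by \<open>X\<^sup>d\<^sup>'\<^sup>+\<^sup>e\<^sup>'\<close> of the error made by the image of \<open>g\<close>.\<close>

definition crossing_map where
  "crossing_map d e d' e' g g' F \<longleftrightarrow> is_hom F \<and> range F \<subseteq> range (polymodel d' e') \<and>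
     (\<forall>p. polymodel d e p = 0 \<longrightarrow> F p = 0) \<and>
     (\<forall>r. F [:const4 r:] = [:\<kappa> r:]) \<and> F [:vX:] = [:mX:] \<and>
     F [:vZ:] = [:model d' e' g':] + [:mX:] ^ (d + e) * [:0, 1:] \<and>
     [:mX:] ^ (d' + e') * F [:0, 1:] = [:mZ:] - F [:g:]"

text \<open>The new variable of the second ring moves \<open>z\<close> away from its approximation by a multiple of
  \<open>X\<^sup>d\<^sup>+\<^sup>e\<close>. Conversely the coordinate of the second surface and the image of its approximation
  are two solutions on the same branch, so their difference is divisible by \<open>X\<^sup>d\<^sup>'\<^sup>+\<^sup>e\<^sup>'\<close>, and the
  quotient is the image of the new variable.\<close>

lemma crossing_map_exists:
  assumes de: "d \<ge> 1" "e \<ge> 1" "d' \<ge> 1" "e' \<ge> 1"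
    and g: "crossing d e d' e' g" and g': "crossing d' e' d e g'"
  shows "\<exists>F. crossing_map d e d' e' g g' F"
proof -
  let ?C = "range (polymodel d' e')"
  let ?c = "\<lambda>r. [:\<kappa> r:]"
  let ?A = "range (model d e)"
  interpret danielewski_subring \<iota> P Q q ?C ?c "[:mX:]" by (rule polymodel_subring)
  obtain h t where ght: "solution d' e' \<kappa> mX (model d e g) (model d e h) (model d e t)"
    "dvd_in ?A mX (model d e g - mZ)" "dvd_in ?A mX (model d e h - mY d)"
    using g unfolding crossing_def by blast
  obtain h' t' where ght': "solution d e \<kappa> mX (model d' e' g') (model d' e' h') (model d' e' t')"
    "dvd_in (range (model d' e')) mX (model d' e' g' - mZ)"
    "dvd_in (range (model d' e')) mX (model d' e' h' - mY d')"
    using g' unfolding crossing_def by blast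
  have const_in: "[:model d' e' a:] \<in> ?C" for a using polymodel_simps(1) by (metis rangeI)
  have W_in: "[:0, 1:] \<in> ?C" using polymodel_simps(2) by (metis rangeI)
  have const_dvd: "dvd_in ?C [:mX:] [:a:]" if a: "dvd_in (range (model d' e')) mX a" for a
  proof -
    obtain b where "a = mX * model d' e' b" using a unfolding dvd_in_def by blast
    then have "[:a:] = [:mX:] * [:model d' e' b:]" by simp
    then show ?thesis using const_in dvd_in_self[OF C] by metis
  qed
  define Z where "Z = [:model d' e' g':] + [:mX:] ^ (d + e) * [:0, 1:]"
  have sol': "solution d e ?c [:mX:] [:model d' e' g':] [:model d' e' h':] [:model d' e' t':]"
    using solution_hom[OF is_hom_const_poly is_hom_\<kappa> ght'(1)] .
  obtain Y T where YT: "Y \<in> ?C" "T \<in> ?C" "solution d e ?c [:mX:] Z Y T"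
    "dvd_in ?C [:mX:] (Y - [:model d' e' h':])"
    using perturb_solution[OF sol' const_in const_in const_in W_in de(2)] unfolding Z_def by blast
  have Z: "Z \<in> ?C"
    unfolding Z_def by (rule sc(6)[OF const_in sc(4)[OF sc(7)[OF x(1)] W_in]])
  \<comment> \<open>The restriction of the map to the first ring, before the choice of the image of \<open>W\<close>.\<close>
  define F0 where "F0 = ev4 ?c [:mX:] Z Y T"
  have F0: "is_hom F0" unfolding F0_def by (simp add: is_hom_ev c(1))
  have F0g: "F0 (const4 r) = [:\<kappa> r:]" "F0 vX = [:mX:]" "F0 vZ = Z" "F0 vY = Y" "F0 vT = T" for r
    unfolding F0_def by (simp_all add: ev_const ev_var is_hom_ev c(1))
  have F0_in: "F0 a \<in> ?C" for a
    unfolding F0_def using ev_in[OF C is_hom_ev[OF is_hom_ev[OF is_hom_ev[OF c(1)]]] ev_in3[OF Z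
        YT(1)] YT(2)] .
  have F0_ker: "F0 a = 0" if "model d e a = 0" for a
    using that ev4_ideal[OF c(1) YT(3)] model_eq_0_iff[OF de(1,2)] by (simp add: F0_def)
  have "solution d' e' (\<lambda>r. F0 (const4 r)) (F0 vX) (F0 g) (F0 h) (F0 t)"
    by (rule solution_transport[OF F0 F0_ker is_hom_model])
      (use ght(1) is_hom_const4 in \<open>simp_all only: model_simps(1-5)\<close>)
  then have s2: "solution d' e' ?c [:mX:] (F0 g) (F0 h) (F0 t)" by (simp only: F0g)
  have s1: "solution d' e' ?c [:mX:] [:mZ:] [:mY d':] [:mT d' e':]"
    using solution_hom[OF is_hom_const_poly is_hom_\<kappa> solution_model] .
  have F0_dvd: "dvd_in ?C [:mX:] (F0 a - F0 b)" if ab: "dvd_in ?A mX (model d e a - model d e b)" for a b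
  proof -
    obtain u where "model d e a - model d e b = mX * model d e u" using ab unfolding dvd_in_def by blast
    then have "model d e (a - b - vX * u) = 0"
      by (simp only: hom_simps[OF is_hom_model] model_simps(1-5)) simp
    then have "F0 (a - b - vX * u) = 0" by (rule F0_ker)
    then have "F0 a - F0 b = [:mX:] * F0 u"
      by (simp only: hom_simps[OF F0] F0g) simp
    then show ?thesis using dvd_in_self[OF C F0_in] by metis
  qed
  have in_C: "[:mZ:] \<in> ?C" "[:mY d':] \<in> ?C" "[:mT d' e':] \<in> ?C"
    using const_in[of vZ] const_in[of vY] const_in[of vT] by (simp_all only: model_simps(1-5))
  have "dvd_in ?C ([:mX:] ^ (d' + e')) ([:mZ:] - F0 g)"
  proof (rule solution_unique[OF s1 s2 in_C F0_in F0_in F0_in _ _ de(3,4)])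
    have "dvd_in ?C [:mX:] ([:mZ:] - [:model d' e' g':])"
      by (rule dvd_in_swap[OF C]) (use const_dvd[OF ght'(2)] in simp)
    moreover have "dvd_in ?C [:mX:] ([:model d' e' g':] - Z)"
    proof -
      have "[:model d' e' g':] - Z = [:mX:] ^ (d + e) * (- [:0, 1:])"
        unfolding Z_def by (simp only: mult_minus_right) simp
      moreover have "dvd_in ?C [:mX:] ([:mX:] ^ (d + e) * (- [:0, 1:]))"
        by (rule dvd_in_power[OF C dvd_in_self[OF C sc(5)[OF W_in]] x(1)]) (use de in simp)
      ultimately show ?thesis by (simp only:)
    qed
    moreover have "dvd_in ?C [:mX:] (Z - F0 g)"
      using F0_dvd[of g vZ] ght(2) dvd_in_swap[OF C] by (simp only: model_simps(1-5) F0g)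
    ultimately show "dvd_in ?C [:mX:] ([:mZ:] - F0 g)" using dvd_in_trans_diff[OF C] by blast
    have "dvd_in ?C [:mX:] ([:mY d':] - [:model d' e' h':])"
      by (rule dvd_in_swap[OF C]) (use const_dvd[OF ght'(3)] in simp)
    moreover have "dvd_in ?C [:mX:] ([:model d' e' h':] - Y)"
      by (rule dvd_in_swap[OF C YT(4)])
    moreover have "dvd_in ?C [:mX:] (Y - F0 h)"
      using F0_dvd[of h vY] ght(3) dvd_in_swap[OF C] by (simp only: model_simps(1-5) F0g)
    ultimately show "dvd_in ?C [:mX:] ([:mY d':] - F0 h)" using dvd_in_trans_diff[OF C] by blast
  qed
  then obtain W where W: "W \<in> ?C" "[:mZ:] - F0 g = [:mX:] ^ (d' + e') * W" unfolding dvd_in_def by blast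
  define F where "F = ev F0 W"
  have "F p = 0" if "polymodel d e p = 0" for p
  proof -
    have "model d e (coeff p n) = 0" for n
      using that coeff_map_hom[OF is_hom_model, of d e p n] by simp
    then show ?thesis
      unfolding F_def by (subst ev_altdef[OF F0 order_refl]) (simp add: F0_ker)
  qed
  moreover have "F p \<in> ?C" for p unfolding F_def by (rule ev_in[OF C F0 F0_in W(1)])
  ultimately have "crossing_map d e d' e' g g' F"
    unfolding crossing_map_def F_def
    by (auto simp: is_hom_ev F0 ev_const ev_var F0g W(2) Z_def)
  then show ?thesis by blast
qed

text \<open>The formulas for \<open>z\<close> and \<open>W\<close> in one map are those of the other one solved for the new variables.
  For \<open>y\<close> and \<open>t\<close> the claim follows from the equations after cancelling powers of \<open>X\<close>.\<close>

lemma crossing_maps_inverse: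
  assumes de: "d \<ge> 1" "e \<ge> 1" "d' \<ge> 1" "e' \<ge> 1"
    and F: "crossing_map d e d' e' g g' F" and F': "crossing_map d' e' d e g' g F'"
    and ab: "F a = polymodel d' e' b"
  shows "F' b = polymodel d e a"
proof -
  let ?E = "polymodel d e" and ?E' = "polymodel d' e'"
  note hF = conjunct1[OF F[unfolded crossing_map_def]]
  note hF' = conjunct1[OF F'[unfolded crossing_map_def]]
  note hE = is_hom_polymodel[of d e] note hE' = is_hom_polymodel[of d' e']
  note sF = hom_simps[OF hF] note sF' = hom_simps[OF hF']
  note sE = hom_simps[OF hE] note sE' = hom_simps[OF hE']
  have F_ker: "F p = 0" if "?E p = 0" for p using F that unfolding crossing_map_def by blast
  have F'_ker: "F' p = 0" if "?E' p = 0" for p using F' that unfolding crossing_map_def by blast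
  have F'_eq: "F' p = F' p'" if "?E' p = ?E' p'" for p p'
  proof -
    have "F' (p - p') = 0" by (rule F'_ker) (use that in \<open>simp only: sE' diff_self\<close>)
    then show ?thesis by (simp only: sF') simp
  qed
  have F_r: "\<exists>p2. F p = ?E' p2" for p using F unfolding crossing_map_def by blast
  have FX: "F [:vX:] = [:mX:]" "F' [:vX:] = [:mX:]"
    and Fc: "F [:const4 r:] = [:\<kappa> r:]" "F' [:const4 r:] = [:\<kappa> r:]"
    and FZ: "F [:vZ:] = [:model d' e' g':] + [:mX:] ^ (d + e) * [:0, 1:]"
      "F' [:vZ:] = [:model d e g:] + [:mX:] ^ (d' + e') * [:0, 1:]"
    and FW: "[:mX:] ^ (d' + e') * F [:0, 1:] = [:mZ:] - F [:g:]"
      "[:mX:] ^ (d + e) * F' [:0, 1:] = [:mZ:] - F' [:g':]" for r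
    using F F' unfolding crossing_map_def by blast+
  have EX: "?E [:vX:] = [:mX:]" "?E' [:vX:] = [:mX:]"
    and Ec: "?E [:const4 r:] = [:\<kappa> r:]" "?E' [:const4 r:] = [:\<kappa> r:]"
    and EZ: "?E [:vZ:] = [:mZ:]" "?E' [:vZ:] = [:mZ:]" for r
    by (simp_all only: polymodel_simps model_simps(1-5))
  define S where "S = {p. \<exists>p2. F p = ?E' p2 \<and> F' p2 = ?E p}"
  have SI: "p \<in> S" if "F p = ?E' p2" "F' p2 = ?E p" for p p2 using that unfolding S_def by blast
  have add: "p + p' \<in> S" if p: "p \<in> S" "p' \<in> S" for p p'
  proof -
    obtain p2 p2' where "F p = ?E' p2" "F' p2 = ?E p" "F p' = ?E' p2'" "F' p2' = ?E p'"
      using p unfolding S_def by blast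
    then show ?thesis by (intro SI[of _ "p2 + p2'"]) (simp_all only: sF sF' sE sE')
  qed
  have mult: "p * p' \<in> S" if p: "p \<in> S" "p' \<in> S" for p p'
  proof -
    obtain p2 p2' where "F p = ?E' p2" "F' p2 = ?E p" "F p' = ?E' p2'" "F' p2' = ?E p'"
      using p unfolding S_def by blast
    then show ?thesis by (intro SI[of _ "p2 * p2'"]) (simp_all only: sF sF' sE sE')
  qed
  have X_S: "[:vX:] \<in> S" by (rule SI[of _ "[:vX:]"]) (simp_all only: FX EX)
  have c_S: "[:const4 r:] \<in> S" for r by (rule SI[of _ "[:const4 r:]"]) (simp_all only: Fc Ec)
  have Z_S: "[:vZ:] \<in> S"
    by (rule SI[of _ "[:g':] + [:vX:] ^ (d + e) * [:0, 1:]"])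
      (simp_all only: sF' sE' FX EX FZ EZ FW polymodel_simps model_simps(2,3)
          add_diff_cancel_left' diff_add_cancel
        add.commute[of "F' [:g':]"])
  have const: "is_hom (\<lambda>r. [:const4 r:])" by (rule is_hom_comp[OF is_hom_const_poly is_hom_const4])
  have cancel: "p \<in> S" if u: "u \<in> S" and eq: "?E ([:vX:] ^ n * p) = ?E u" for n p u
  proof -
    obtain u2 where u2: "F u = ?E' u2" "F' u2 = ?E u" using u unfolding S_def by blast
    obtain p2 where p2: "F p = ?E' p2" using F_r by blast
    have "F ([:vX:] ^ n * p - u) = 0" by (rule F_ker) (use eq in \<open>simp only: sE diff_self\<close>)
    then have "[:mX:] ^ n * F p = F u" by (simp only: sF FX) simp
    then have "?E' ([:vX:] ^ n * p2) = ?E' u2" by (simp only: sE' EX p2 u2)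
    then have "F' ([:vX:] ^ n * p2) = F' u2" by (rule F'_eq)
    then have "[:mX:] ^ n * F' p2 = [:mX:] ^ n * ?E p"
      using eq by (simp only: sF' sE FX EX u2)
    then have "F' p2 = ?E p" by (simp only: mult_cancel_left) simp
    with p2 show ?thesis by (rule SI)
  qed
  have ev_S: "ev f s p \<in> S" if "is_hom f" "\<And>u. f u \<in> S" "s \<in> S" for f :: "'b::comm_ring_1 \<Rightarrow> _" and s p
  proof (induction p)
    case 0
    have "0 \<in> S" by (rule SI[of _ 0]) (simp_all only: sF sF' sE sE')
    then show ?case using that by (simp add: ev_0)
  qed (use that add mult in \<open>simp add: ev_pCons\<close>)
  have Y_S: "[:vY:] \<in> S"
  proof (rule cancel)
    show "ev2 (\<lambda>r. [:const4 r:]) [:vX:] [:vZ:] P \<in> S"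
      by (intro ev_S is_hom_ev const c_S X_S Z_S)
    show "?E ([:vX:] ^ d * [:vY:]) = ?E (ev2 (\<lambda>r. [:const4 r:]) [:vX:] [:vZ:] P)"
      using solution_hom[OF is_hom_const_poly is_hom_\<kappa> solution_model[of d e]]
      unfolding solution_def
      by (simp only: sE hom_ev2[OF hE const] polymodel_simps model_simps(1-5))
  qed
  have T_S: "[:vT:] \<in> S"
  proof (rule cancel)
    show "ev3 (\<lambda>r. [:const4 r:]) [:vX:] [:vZ:] [:vY:] Q \<in> S"
      by (intro ev_S is_hom_ev const c_S X_S Z_S Y_S)
    show "?E ([:vX:] ^ e * [:vT:]) = ?E (ev3 (\<lambda>r. [:const4 r:]) [:vX:] [:vZ:] [:vY:] Q)"
      using solution_hom[OF is_hom_const_poly is_hom_\<kappa> solution_model[of d e]]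
      unfolding solution_def
      by (simp only: sE hom_ev3[OF hE const] polymodel_simps model_simps(1-5))
  qed
  have const_S: "[:u:] \<in> S" for u
  proof -
    have "[:u:] = ev4 (\<lambda>r. [:const4 r:]) [:vX:] [:vZ:] [:vY:] [:vT:] u"
      by (rule hom_eq_ev4[OF is_hom_const_poly])
    also have "\<dots> \<in> S" by (intro ev_S is_hom_ev const c_S X_S Z_S Y_S T_S)
    finally show ?thesis .
  qed
  have W_S: "[:0, 1:] \<in> S"
  proof -
    obtain p2 where p2: "F [:0, 1:] = ?E' p2" using F_r by blast
    obtain p3 where p3: "F [:g:] = ?E' p3" "F' p3 = ?E [:g:]" using const_S unfolding S_def by blast
    have "?E' ([:vX:] ^ (d' + e') * p2) = ?E' ([:vZ:] - p3)"
      using FW(1) by (simp only: sE' EX EZ p2 p3)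
    then have "F' ([:vX:] ^ (d' + e') * p2) = F' ([:vZ:] - p3)" by (rule F'_eq)
    then have "[:mX:] ^ (d' + e') * F' p2 = [:mX:] ^ (d' + e') * [:0, 1:]"
      by (simp only: sF' FX FZ p3 polymodel_simps add_diff_cancel_left')
    then have "F' p2 = ?E [:0, 1:]" by (simp only: mult_cancel_left polymodel_simps) simp
    with p2 show ?thesis by (rule SI)
  qed
  have "a \<in> S" by (rule poly_closed[OF const_S W_S add mult])
  then obtain p2 where "F a = ?E' p2" "F' p2 = ?E a" unfolding S_def by blast
  then show ?thesis using F'_eq[of b p2] ab by simp
qed

end

section \<open>Passage to quotient rings\<close>

text \<open>Both rings are quotients of one ring. With the kernels described by homomorphisms \<open>E\<close> and \<open>E'\<close> into
  a common ring, an isomorphism can be given and verified on representatives.\<close>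

lemma ring_iso_from_covers:
  fixes \<pi> :: "'p::comm_ring_1 \<Rightarrow> 's" and \<pi>' :: "'p \<Rightarrow> 't"
    and E E' F F' :: "'p \<Rightarrow> 'n::comm_ring_1"
  assumes \<pi>: "\<pi> \<in> ring_hom ring_of_type_algebra S" "range \<pi> = carrier S"
    and \<pi>': "\<pi>' \<in> ring_hom ring_of_type_algebra S'" "range \<pi>' = carrier S'"
    and ker: "\<And>a b. \<pi> a = \<pi> b \<longleftrightarrow> E a = E b" "\<And>a b. \<pi>' a = \<pi>' b \<longleftrightarrow> E' a = E' b"
    and homs: "is_hom E'" "is_hom F"
    and F: "\<And>a b. E a = E b \<Longrightarrow> F a = F b" "range F \<subseteq> range E'"
    and F': "\<And>a b. E' a = E' b \<Longrightarrow> F' a = F' b" "range F' \<subseteq> range E"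
    and inv: "\<And>a b. F a = E' b \<Longrightarrow> F' b = E a" "\<And>a b. F' b = E a \<Longrightarrow> F a = E' b"
  shows "\<exists>h \<in> ring_iso S S'. \<forall>a b. F a = E' b \<longrightarrow> h (\<pi> a) = \<pi>' b"
proof -
  define h where "h s = \<pi>' (SOME b. \<exists>a. \<pi> a = s \<and> F a = E' b)" for s
  have h: "h (\<pi> a) = \<pi>' b" if ab: "F a = E' b" for a b
  proof -
    have "\<exists>b a'. \<pi> a' = \<pi> a \<and> F a' = E' b" using ab by blast
    from someI_ex[OF this] obtain a' where
      "\<pi> a' = \<pi> a" "F a' = E' (SOME b. \<exists>a'. \<pi> a' = \<pi> a \<and> F a' = E' b)" by blast
    then have "E' (SOME b. \<exists>a'. \<pi> a' = \<pi> a \<and> F a' = E' b) = E' b"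
      using ab F(1) ker(1) by metis
    then show ?thesis unfolding h_def using ker(2) by blast
  qed
  have ex: "\<exists>b. F a = E' b" for a using F(2) by blast
  have pm: "\<pi> (a * b) = \<pi> a \<otimes>\<^bsub>S\<^esub> \<pi> b" "\<pi> (a + b) = \<pi> a \<oplus>\<^bsub>S\<^esub> \<pi> b" "\<pi> 1 = \<one>\<^bsub>S\<^esub>" for a b
    using ring_hom_mult[OF \<pi>(1), of a b] ring_hom_add[OF \<pi>(1), of a b] ring_hom_one[OF \<pi>(1)]
    by (simp_all add: rta_simps)
  have pm': "\<pi>' (a * b) = \<pi>' a \<otimes>\<^bsub>S'\<^esub> \<pi>' b" "\<pi>' (a + b) = \<pi>' a \<oplus>\<^bsub>S'\<^esub> \<pi>' b" "\<pi>' 1 = \<one>\<^bsub>S'\<^esub>" for a b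
    using ring_hom_mult[OF \<pi>'(1), of a b] ring_hom_add[OF \<pi>'(1), of a b] ring_hom_one[OF \<pi>'(1)]
    by (simp_all add: rta_simps)
  have "h \<in> ring_hom S S'"
  proof (rule ring_hom_memI)
    fix s assume "s \<in> carrier S"
    then obtain a where s: "s = \<pi> a" using \<pi>(2) by blast
    obtain b where b: "F a = E' b" using ex by blast
    show "h s \<in> carrier S'" unfolding s h[OF b] using \<pi>'(2) by blast
    fix s' assume "s' \<in> carrier S"
    then obtain a' where s': "s' = \<pi> a'" using \<pi>(2) by blast
    obtain b' where b': "F a' = E' b'" using ex by blast
    have F: "F (a * a') = E' (b * b')" "F (a + a') = E' (b + b')"
      by (simp_all only: hom_add[OF homs(1)] hom_add[OF homs(2)] hom_mult[OF homs(1)]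
          hom_mult[OF homs(2)] b b')
    show "h (s \<otimes>\<^bsub>S\<^esub> s') = h s \<otimes>\<^bsub>S'\<^esub> h s'" "h (s \<oplus>\<^bsub>S\<^esub> s') = h s \<oplus>\<^bsub>S'\<^esub> h s'"
      unfolding s s' h[OF b] h[OF b'] using h[OF F(1)] h[OF F(2)] by (simp_all only: pm pm')
  next
    have "F 1 = E' 1" by (simp add: hom_1 homs)
    then show "h \<one>\<^bsub>S\<^esub> = \<one>\<^bsub>S'\<^esub>" using h[of 1 1] by (simp add: pm pm')
  qed
  moreover have "bij_betw h (carrier S) (carrier S')"
  proof (rule bij_betw_imageI)
    show "inj_on h (carrier S)"
    proof (rule inj_onI)
      fix s s' assume "s \<in> carrier S" "s' \<in> carrier S" and eq: "h s = h s'"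
      then obtain a a' where s: "s = \<pi> a" "s' = \<pi> a'" using \<pi>(2) by blast
      obtain b where b: "F a = E' b" using ex by blast
      obtain b' where b': "F a' = E' b'" using ex by blast
      have "E' b = E' b'" using eq unfolding s h[OF b] h[OF b'] ker(2) .
      then have "F' b = F' b'" by (rule F'(1))
      then have "E a = E a'" using inv(1)[OF b] inv(1)[OF b'] by (rule box_equals)
      then show "s = s'" unfolding s ker(1) .
    qed
    show "h ` carrier S = carrier S'"
    proof
      show "h ` carrier S \<subseteq> carrier S'"
        using \<open>h \<in> ring_hom S S'\<close> ring_hom_closed by fastforce
      show "carrier S' \<subseteq> h ` carrier S"
      proof
        fix s assume "s \<in> carrier S'"
        then obtain b where s: "s = \<pi>' b" using \<pi>'(2) by blast
        obtain a where "F' b = E a" using F'(2) by blast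
        then have "h (\<pi> a) = s" using inv(2) h s by blast
        then show "s \<in> h ` carrier S" using \<pi>(2) by blast
      qed
    qed
  qed
  ultimately show ?thesis unfolding ring_iso_def using h by blast
qed

lemma coset_eq_iff:
  fixes I :: "'a::comm_ring_1 set"
  assumes "ideal I ring_of_type_algebra"
  shows "I +>\<^bsub>ring_of_type_algebra\<^esub> a = I +>\<^bsub>ring_of_type_algebra\<^esub> b \<longleftrightarrow> a - b \<in> I"
proof -
  interpret cring "ring_of_type_algebra :: 'a ring" by blast
  have inv: "\<ominus>\<^bsub>ring_of_type_algebra\<^esub> a = - a" for a :: 'a
    using minus_equality[of "- a" a] by (simp add: rta_simps)
  have "a \<ominus>\<^bsub>ring_of_type_algebra\<^esub> b = a - b"
    unfolding a_minus_def inv by (simp add: rta_simps)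
  then show ?thesis
    using quotient_eq_iff_same_a_r_cos[OF assms, of a b] by (simp add: rta_simps)
qed

context
  fixes I :: "'a::comm_ring_1 set"
  assumes I: "ideal I ring_of_type_algebra"
begin

abbreviation quot_map :: "'a \<Rightarrow> 'a set" where
  "quot_map a \<equiv> I +>\<^bsub>ring_of_type_algebra\<^esub> a"

abbreviation "quot_ring \<equiv> ring_of_type_algebra Quot I"

lemma cring_quot: "cring quot_ring"
  using ideal.quotient_is_cring[OF I] by blast

lemma quot_map_hom: "quot_map \<in> ring_hom ring_of_type_algebra quot_ring"
  using ideal.rcos_ring_hom[OF I] by simp

lemma quot_map_range: "range quot_map = carrier quot_ring"
  by (auto simp: FactRing_def A_RCOSETS_def' rta_simps)

lemma quot_map_simps:
  "quot_map (a * b) = quot_map a \<otimes>\<^bsub>quot_ring\<^esub> quot_map b"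
  "quot_map (a + b) = quot_map a \<oplus>\<^bsub>quot_ring\<^esub> quot_map b"
  "quot_map 1 = \<one>\<^bsub>quot_ring\<^esub>" "quot_map a \<in> carrier quot_ring"
  using ring_hom_mult[OF quot_map_hom, of a b] ring_hom_add[OF quot_map_hom, of a b]
    ring_hom_one[OF quot_map_hom] quot_map_range
  by (auto simp: rta_simps)

lemma quot_map_0: "quot_map 0 = \<zero>\<^bsub>quot_ring\<^esub>"
proof -
  interpret S: cring quot_ring by (rule cring_quot)
  have "quot_map 0 \<oplus>\<^bsub>quot_ring\<^esub> quot_map 0 = quot_map 0" using quot_map_simps(2)[of 0 0] by simp
  then show ?thesis using S.add.l_cancel_one' quot_map_simps(4)[of 0] by (metis S.add.r_cancel_one')
qed

lemma quot_map_sum: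
  "quot_map (\<Sum>i\<le>n. g i) = (\<Oplus>\<^bsub>quot_ring\<^esub>i\<in>{..n::nat}. quot_map (g i))"
proof -
  interpret S: cring quot_ring by (rule cring_quot)
  show ?thesis
  proof (induction n)
    case 0
    then show ?case using quot_map_simps(4) by simp
  next
    case (Suc n)
    have "(\<Oplus>\<^bsub>quot_ring\<^esub>i\<in>{..Suc n}. quot_map (g i))
        = quot_map (g (Suc n)) \<oplus>\<^bsub>quot_ring\<^esub> (\<Oplus>\<^bsub>quot_ring\<^esub>i\<in>{..n}. quot_map (g i))"
      unfolding atMost_Suc using quot_map_simps(4) by (subst S.finsum_insert) auto
    then show ?case by (simp add: Suc[symmetric] quot_map_simps(2)[symmetric] add.commute)
  qed
qed

text \<open>The ring of polynomials over the quotient is covered by the polynomials over the ring.\<close>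

definition UP_map :: "'a poly \<Rightarrow> nat \<Rightarrow> 'a set" where
  "UP_map p = (\<lambda>n. quot_map (coeff p n))"

lemma UP_map_in: "UP_map p \<in> up quot_ring"
  unfolding UP_map_def
  by (rule mem_upI) (auto simp: quot_map_simps bound_def coeff_eq_0 quot_map_0 intro!: exI[of _
      "degree p"])

lemma UP_map_hom: "UP_map \<in> ring_hom ring_of_type_algebra (UP quot_ring)"
proof (rule ring_hom_memI)
  fix p r :: "'a poly"
  show "UP_map p \<in> carrier (UP quot_ring)" using UP_map_in by (simp add: UP_def)
  show "UP_map (p \<oplus>\<^bsub>ring_of_type_algebra\<^esub> r) = UP_map p \<oplus>\<^bsub>UP quot_ring\<^esub> UP_map r"
    using UP_map_in[of p] UP_map_in[of r]
    by (simp add: UP_def rta_simps) (simp add: UP_map_def quot_map_simps)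
  show "UP_map (p \<otimes>\<^bsub>ring_of_type_algebra\<^esub> r) = UP_map p \<otimes>\<^bsub>UP quot_ring\<^esub> UP_map r"
    using UP_map_in[of p] UP_map_in[of r]
    by (simp add: UP_def rta_simps) (simp add: UP_map_def coeff_mult quot_map_sum quot_map_simps)
next
  show "UP_map \<one>\<^bsub>ring_of_type_algebra\<^esub> = \<one>\<^bsub>UP quot_ring\<^esub>"
    by (auto simp: UP_def rta_simps UP_map_def quot_map_simps quot_map_0 fun_eq_iff coeff_1)
qed

lemma UP_map_range: "range UP_map = carrier (UP quot_ring)"
proof
  show "range UP_map \<subseteq> carrier (UP quot_ring)" using UP_map_in by (auto simp: UP_def)
  show "carrier (UP quot_ring) \<subseteq> range UP_map"
  proof
    fix f assume "f \<in> carrier (UP quot_ring)"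
    then have f: "f \<in> up quot_ring" by (simp add: UP_def)
    then obtain n where n: "bound \<zero>\<^bsub>quot_ring\<^esub> n f" by (auto simp: up_def)
    have "\<forall>i. \<exists>a. f i = quot_map a" using mem_upD[OF f] quot_map_range by blast
    then obtain g where g: "\<And>i. f i = quot_map (g i)" by metis
    have "f = UP_map (\<Sum>i\<le>n. monom (g i) i)"
    proof
      fix i show "f i = UP_map (\<Sum>i\<le>n. monom (g i) i) i"
        using g[of i] n[unfolded bound_def]
        by (cases "i \<le> n") (auto simp: UP_map_def coeff_sum quot_map_0)
    qed
    then show "f \<in> range UP_map" by blast
  qed
qed

lemma UP_map_eq_iff: "UP_map p = UP_map r \<longleftrightarrow> (\<forall>n. coeff p n - coeff r n \<in> I)"
  by (simp add: UP_map_def fun_eq_iff coset_eq_iff[OF I])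

lemma UP_map_const: "UP_map [:a:] = up_ring.monom (UP quot_ring) (quot_map a) 0"
  by (auto simp: UP_map_def UP_def fun_eq_iff quot_map_simps(4) quot_map_0 coeff_pCons split: nat.splits)

end

lemma R_isomorphic_refl: "R_isomorphic A A"
  unfolding R_isomorphic_def ring_iso_def
  by (intro bexI[of _ "\<lambda>x. x"]) (auto simp: ring_hom_def bij_betw_def)

context danielewski
begin

lemma ideal_B: "ideal (B_ideal d e P Q) ring_of_type_algebra"
  by (rule ideal_typeI) (use B_ideal_add B_ideal_mult B_ideal_mult[OF gens_in_B_ideal(1), of 0] in auto)

lemma quot_eq_iff:
  assumes "d \<ge> 1" "e \<ge> 1"
  shows "quot_map (B_ideal d e P Q) a = quot_map (B_ideal d e P Q) b \<longleftrightarrow> model d e a = model d e b"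
  unfolding coset_eq_iff[OF ideal_B] model_eq_0_iff[OF assms, symmetric]
  by (simp add: hom_simps[OF is_hom_model])

lemma R_domain_B:
  assumes de: "d \<ge> 1" "e \<ge> 1"
  shows "R_domain (B_alg d e P Q)"
proof -
  let ?I = "B_ideal d e P Q"
  let ?\<pi> = "quot_map ?I"
  let ?S = "quot_ring ?I"
  note qs = quot_map_simps[OF ideal_B[of d e]] and q0 = quot_map_0[OF ideal_B[of d e]]
  interpret S: cring ?S by (rule cring_quot[OF ideal_B])
  have zero: "?\<pi> a = \<zero>\<^bsub>?S\<^esub> \<longleftrightarrow> model d e a = 0" for a
    unfolding q0[symmetric] quot_eq_iff[OF de] by (simp add: hom_0 is_hom_model)
  have "domain ?S"
  proof (intro domain.intro domain_axioms.intro S.cring_axioms)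
    show "\<one>\<^bsub>?S\<^esub> \<noteq> \<zero>\<^bsub>?S\<^esub>" unfolding qs(3)[symmetric] zero by (simp add: hom_1 is_hom_model)
    fix s t assume st: "s \<otimes>\<^bsub>?S\<^esub> t = \<zero>\<^bsub>?S\<^esub>" "s \<in> carrier ?S" "t \<in> carrier ?S"
    then obtain a b where ab: "s = ?\<pi> a" "t = ?\<pi> b"
      unfolding quot_map_range[OF ideal_B, symmetric] by blast
    have "model d e a * model d e b = 0"
      using st(1) unfolding ab qs(1)[symmetric] zero by (simp add: hom_mult is_hom_model)
    then show "s = \<zero>\<^bsub>?S\<^esub> \<or> t = \<zero>\<^bsub>?S\<^esub>" unfolding ab zero by simp
  qed
  moreover have "(\<lambda>r. ?\<pi> (const4 r)) \<in> ring_hom ring_of_type_algebra ?S"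
    by (rule ring_hom_memI)
      (simp_all only: rta_simps qs hom_add[OF is_hom_const4] hom_mult[OF is_hom_const4] hom_1[OF
          is_hom_const4])
  ultimately show ?thesis by (simp add: R_domain_def B_alg_def)
qed

text \<open>The isomorphism of the polynomial rings comes from the two crossing maps.\<close>

lemma stably_isomorphic:
  assumes de: "d \<ge> 1" "e \<ge> 1" "d' \<ge> 1" "e' \<ge> 1"
  shows "R_isomorphic (poly_alg (B_alg d e P Q)) (poly_alg (B_alg d' e' P Q))"
proof -
  let ?\<pi> = "UP_map (B_ideal d e P Q)" and ?\<pi>' = "UP_map (B_ideal d' e' P Q)"
  obtain g where g: "crossing d e d' e' g" using crossing_exists[OF de] by blast
  obtain g' where g': "crossing d' e' d e g'" using crossing_exists[OF de(3,4,1,2)] by blast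
  obtain F where F: "crossing_map d e d' e' g g' F" using crossing_map_exists[OF de g g'] by blast
  obtain F' where F': "crossing_map d' e' d e g' g F'"
    using crossing_map_exists[OF de(3,4,1,2) g' g] by blast
  have hF: "is_hom F" "is_hom F'" using F F' unfolding crossing_map_def by blast+
  have ker: "UP_map (B_ideal d e P Q) a = UP_map (B_ideal d e P Q) b \<longleftrightarrow> polymodel d e a = polymodel d e b"
    if "d \<ge> 1" "e \<ge> 1" for d e a b
    unfolding UP_map_eq_iff[OF ideal_B] model_eq_0_iff[OF that, symmetric]
    by (simp add: hom_simps[OF is_hom_model] poly_eq_iff coeff_map_hom[OF is_hom_model])
  have Feq: "F a = F b" if "polymodel d e a = polymodel d e b" for a b
  proof -
    have "polymodel d e (a - b) = 0" by (simp only: hom_simps[OF is_hom_polymodel] that diff_self)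
    then have "F (a - b) = 0" using F unfolding crossing_map_def by blast
    then show ?thesis by (simp add: hom_simps[OF hF(1)])
  qed
  have F'eq: "F' a = F' b" if "polymodel d' e' a = polymodel d' e' b" for a b
  proof -
    have "polymodel d' e' (a - b) = 0" by (simp only: hom_simps[OF is_hom_polymodel] that diff_self)
    then have "F' (a - b) = 0" using F' unfolding crossing_map_def by blast
    then show ?thesis by (simp add: hom_simps[OF hF(2)])
  qed
  have "\<exists>h \<in> ring_iso (UP (quot_ring (B_ideal d e P Q))) (UP (quot_ring (B_ideal d' e' P Q))).
      \<forall>a b. F a = polymodel d' e' b \<longrightarrow> h (?\<pi> a) = ?\<pi>' b"
  proof (rule ring_iso_from_covers[where E = "polymodel d e" and F' = F'])
    show "range F \<subseteq> range (polymodel d' e')" "range F' \<subseteq> range (polymodel d e)"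
      using F F' unfolding crossing_map_def by blast+
    show "F a = polymodel d' e' b \<Longrightarrow> F' b = polymodel d e a" for a b
      by (rule crossing_maps_inverse[OF de F F'])
    show "F' b = polymodel d e a \<Longrightarrow> F a = polymodel d' e' b" for a b
      by (rule crossing_maps_inverse[OF de(3,4,1,2) F' F])
  qed (fact UP_map_hom[OF ideal_B] UP_map_range[OF ideal_B] ker[OF de(1,2)] ker[OF de(3,4)]
      is_hom_polymodel hF Feq F'eq)+
  then obtain h where h: "h \<in> ring_iso (UP (quot_ring (B_ideal d e P Q))) (UP (quot_ring (B_ideal
      d' e' P Q)))"
    "\<And>a b. F a = polymodel d' e' b \<Longrightarrow> h (?\<pi> a) = ?\<pi>' b" by blast
  have "h (?\<pi> [:const4 r:]) = ?\<pi>' [:const4 r:]" for r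
  proof (rule h(2))
    have "F [:const4 r:] = [:\<kappa> r:]" using F unfolding crossing_map_def by blast
    then show "F [:const4 r:] = polymodel d' e' [:const4 r:]"
      by (simp only: polymodel_simps model_simps(1))
  qed
  then show ?thesis
    unfolding R_isomorphic_def poly_alg_def B_alg_def fst_conv snd_conv
      UP_map_const[OF ideal_B, symmetric]
    using h(1) by blast
qed

text \<open>Lifting the values of the isomorphism from cosets to representatives turns it into a homomorphism
  between types.\<close>

lemma R_isomorphic_hom:
  assumes de: "d \<ge> 1" "e \<ge> 1" "d' \<ge> 1" "e' \<ge> 1"
    and iso: "R_isomorphic (B_alg d' e' P Q) (B_alg d e P Q)"
  shows "\<exists>H. is_hom H \<and> range H = range (model d e) \<and> (\<forall>a. H a = 0 \<longleftrightarrow> model d' e' a = 0) \<and>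
           (\<forall>r. H (const4 r) = \<kappa> r)"
proof -
  let ?\<pi> = "quot_map (B_ideal d e P Q)" and ?\<pi>' = "quot_map (B_ideal d' e' P Q)"
  let ?S = "quot_ring (B_ideal d e P Q)" and ?S' = "quot_ring (B_ideal d' e' P Q)"
  note qs = quot_map_simps[OF ideal_B[of d e]] and qs' = quot_map_simps[OF ideal_B[of d' e']]
  obtain h where h: "h \<in> ring_hom ?S' ?S" "bij_betw h (carrier ?S') (carrier ?S)"
    "\<And>r. h (?\<pi>' (const4 r)) = ?\<pi> (const4 r)"
    using iso unfolding R_isomorphic_def B_alg_def ring_iso_def by auto
  define H where "H a = model d e (SOME b. ?\<pi> b = h (?\<pi>' a))" for a
  have ex: "\<exists>b. ?\<pi> b = h (?\<pi>' a)" for a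
    using ring_hom_closed[OF h(1) qs'(4)] quot_map_range[OF ideal_B, of d e] by (metis imageE)
  have H: "H a = model d e b" if "?\<pi> b = h (?\<pi>' a)" for a b
    unfolding H_def quot_eq_iff[OF de(1,2), symmetric]
    using someI[of "\<lambda>b. ?\<pi> b = h (?\<pi>' a)", OF that] that by (rule trans[OF _ sym])
  have "is_hom H"
  proof (rule is_homI)
    have "?\<pi> 1 = h (?\<pi>' 1)" unfolding qs qs' using ring_hom_one[OF h(1)] by simp
    then show "H 1 = 1" using H hom_1[OF is_hom_model] by metis
    fix a b
    obtain a' b' where ab: "?\<pi> a' = h (?\<pi>' a)" "?\<pi> b' = h (?\<pi>' b)" using ex by metis
    have "?\<pi> (a' + b') = h (?\<pi>' (a + b))" "?\<pi> (a' * b') = h (?\<pi>' (a * b))"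
      unfolding qs(1,2) qs'(1,2) ab
      using ring_hom_add[OF h(1) qs'(4) qs'(4)] ring_hom_mult[OF h(1) qs'(4) qs'(4)] by simp_all
    then show "H (a + b) = H a + H b" "H (a * b) = H a * H b"
      using ab by (simp_all add: H hom_simps[OF is_hom_model])
  qed
  moreover have "H a = 0 \<longleftrightarrow> model d' e' a = 0" for a
  proof -
    obtain b where b: "?\<pi> b = h (?\<pi>' a)" using ex by blast
    have h0: "?\<pi> 0 = h (?\<pi>' 0)"
    proof -
      interpret S': cring ?S' by (rule cring_quot[OF ideal_B])
      interpret S: cring ?S by (rule cring_quot[OF ideal_B])
      show ?thesis
        unfolding quot_map_0[OF ideal_B] using ring_hom_zero[OF h(1) S'.ring_axioms S.ring_axioms]
            by simp
    qed
    have "H a = 0 \<longleftrightarrow> ?\<pi> b = ?\<pi> 0"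
      unfolding H[OF b] quot_eq_iff[OF de(1,2)] by (simp add: hom_0 is_hom_model)
    also have "\<dots> \<longleftrightarrow> ?\<pi>' a = ?\<pi>' 0"
      unfolding b h0 by (rule inj_on_eq_iff[OF bij_betw_imp_inj_on[OF h(2)] qs'(4) qs'(4)])
    also have "\<dots> \<longleftrightarrow> model d' e' a = 0"
      unfolding quot_eq_iff[OF de(3,4)] by (simp add: hom_0 is_hom_model)
    finally show ?thesis .
  qed
  moreover have "range H = range (model d e)"
  proof
    show "range H \<subseteq> range (model d e)" unfolding H_def by blast
    show "range (model d e) \<subseteq> range H"
    proof
      fix u assume "u \<in> range (model d e)"
      then obtain b where u: "u = model d e b" by blast
      have "?\<pi> b \<in> h ` carrier ?S'" using h(2) qs(4) by (simp add: bij_betw_def)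
      then obtain a where a: "?\<pi> b = h (?\<pi>' a)"
        unfolding quot_map_range[OF ideal_B, symmetric] by blast
      have "H a = u" unfolding u by (rule H[OF a])
      then show "u \<in> range H" by blast
    qed
  qed
  moreover have "H (const4 r) = \<kappa> r" for r
    using H[OF h(3)[symmetric]] by (simp only: model_simps(1))
  ultimately show ?thesis by blast
qed

end

section \<open>Pole orders of regular functions\<close>

text \<open>The polynomial \<open>X\<^sup>m\<^sup>n g(X, V/X\<^sup>m, Z)\<close> for \<open>n = deg g\<close>. It clears the denominators when a fraction
  with denominator \<open>X\<^sup>m\<close> is inserted for \<open>Y\<close>, and at \<open>X = 0\<close> only its leading term is left.\<close>

definition homogenized :: "'r::idom poly poly poly \<Rightarrow> nat \<Rightarrow> 'r poly poly poly" where
  "homogenized g m = (\<Sum>k\<le>degree g. monom (coeff g k * [:[:0, 1:]:] ^ (m * (degree g - k))) k)"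

lemma coeff_homogenized:
  "coeff (homogenized g m) k = coeff g k * [:[:0, 1:]:] ^ (m * (degree g - k))"
proof (cases "k \<le> degree g")
  case True
  have "(\<Sum>i\<le>degree g. coeff (monom (coeff g i * [:[:0, 1:]:] ^ (m * (degree g - i))) i) k)
      = (\<Sum>i\<in>{k}. coeff g i * [:[:0, 1:]:] ^ (m * (degree g - i)))"
    by (rule sum.mono_neutral_cong_right) (use True in auto)
  then show ?thesis by (simp add: homogenized_def coeff_sum)
next
  case False
  then show ?thesis by (simp add: homogenized_def coeff_sum coeff_eq_0)
qed

lemma ev3_homogenized:
  fixes x z y v :: "'b::comm_ring_1"
  assumes c: "is_hom c" and v: "x ^ m * y = v"
  shows "x ^ (m * degree g) * ev3 c x z y g = ev3 c x z v (homogenized g m)"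
proof -
  have h: "is_hom (ev2 c x z)" by (simp add: c is_hom_ev)
  have X: "ev2 c x z [:[:0, 1:]:] = x" by (simp add: c is_hom_ev ev_const ev_var)
  have "degree (homogenized g m) \<le> degree g"
    by (rule degree_le) (simp add: coeff_homogenized coeff_eq_0)
  then have "ev3 c x z v (homogenized g m)
      = (\<Sum>k\<le>degree g. ev2 c x z (coeff g k) * x ^ (m * (degree g - k)) * v ^ k)"
    by (simp add: ev_altdef[OF h] coeff_homogenized hom_mult[OF h] hom_power[OF h] X del:
        mult_pCons_left)
  also have "\<dots> = (\<Sum>k\<le>degree g. x ^ (m * degree g) * (ev2 c x z (coeff g k) * y ^ k))"
  proof (rule sum.cong)
    fix k assume "k \<in> {..degree g}"
    then have "m * (degree g - k) + m * k = m * degree g" by (simp add: diff_mult_distrib2)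
    moreover have "x ^ (m * (degree g - k)) * v ^ k = x ^ (m * (degree g - k) + m * k) * y ^ k"
      unfolding v[symmetric] by (simp add: power_mult_distrib power_add power_mult mult.assoc)
    ultimately have eq: "x ^ (m * (degree g - k)) * v ^ k = x ^ (m * degree g) * y ^ k" by (simp only:)
    show "ev2 c x z (coeff g k) * x ^ (m * (degree g - k)) * v ^ k
        = x ^ (m * degree g) * (ev2 c x z (coeff g k) * y ^ k)"
      unfolding mult.assoc eq by (rule mult.left_commute)
  qed simp
  also have "\<dots> = x ^ (m * degree g) * ev3 c x z y g"
    by (simp add: ev_altdef[OF h order_refl] sum_distrib_left)
  finally show ?thesis by simp
qed

lemma Q_at0_homogenized:
  assumes "m \<ge> 1"
  shows "Q_at0 (homogenized g m) = monom (P_at0 (lead_coeff g)) (degree g)"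
proof (rule poly_eqI)
  fix k
  have X: "P_at0 [:[:0, 1:]:] = (0 :: 'a poly)" by (simp add: P_at0_def map_poly_pCons)
  show "coeff (Q_at0 (homogenized g m)) k = coeff (monom (P_at0 (lead_coeff g)) (degree g)) k"
  proof (cases "k < degree g")
    case True
    then show ?thesis using assms
      by (simp add: Q_at0_def coeff_map_hom is_hom_P_at0 coeff_homogenized hom_mult hom_power
          zero_power X del: mult_pCons_left)
  next
    case False
    then show ?thesis
      by (cases "k = degree g") (simp_all add: Q_at0_def coeff_map_hom is_hom_P_at0 coeff_homogenized
          coeff_eq_0 hom_0)
  qed
qed

text \<open>Order and leading coefficient, for non-zero series only.\<close>

definition fls_lead :: "'a::field fls \<Rightarrow> int \<Rightarrow> 'a \<Rightarrow> bool" where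
  "fls_lead f n g \<longleftrightarrow> g \<noteq> 0 \<and> fls_subdegree f = n \<and> fls_nth f n = g"

lemma fls_lead_nonzero: "fls_lead f n g \<Longrightarrow> f \<noteq> 0"
  by (auto simp: fls_lead_def)

lemma fls_leadI:
  assumes "g \<noteq> 0" "fls_nth f n = g" "\<And>m. m < n \<Longrightarrow> fls_nth f m = 0"
  shows "fls_lead f n g"
  unfolding fls_lead_def using assms by (auto intro: fls_subdegree_eqI)

lemma fls_lead_mult:
  assumes "fls_lead f n g" "fls_lead f' n' g'"
  shows "fls_lead (f * f') (n + n') (g * g')"
proof -
  have "f \<noteq> 0" "f' \<noteq> 0" using assms fls_lead_nonzero by auto
  then show ?thesis
    using assms fls_times_base[of f f'] by (auto simp: fls_lead_def)
qed

lemma fls_lead_power: "fls_lead f n g \<Longrightarrow> fls_lead (f ^ k) (int k * n) (g ^ k)"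
proof (induction k)
  case 0
  then show ?case by (simp add: fls_lead_def)
next
  case (Suc k)
  then show ?case using fls_lead_mult[of f n g "f ^ k" "int k * n" "g ^ k"] by (simp add: algebra_simps)
qed

lemma fls_lead_X_power: "fls_lead (fls_X ^ k) (int k) 1"
  using fls_lead_power[of fls_X 1 1 k] by (simp add: fls_lead_def)

lemma fls_lead_cancel:
  assumes "fls_lead (a * b) m g" "fls_lead a n 1"
  shows "fls_lead b (m - n) g"
proof -
  have "a * b \<noteq> 0" using assms fls_lead_nonzero by blast
  then have "a \<noteq> 0" "b \<noteq> 0" by auto
  then show ?thesis
    using assms fls_times_base[of a b] by (auto simp: fls_lead_def)
qed

context danielewski
begin

abbreviation rP where "rP \<equiv> degree P"
abbreviation sQ where "sQ \<equiv> degree Q"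
abbreviation weight_T where "weight_T d e \<equiv> sQ * d + e"
abbreviation emb :: "'r poly \<Rightarrow> 'f poly" where "emb \<equiv> map_poly \<iota>"

lemma is_hom_emb: "is_hom emb" by (rule is_hom_map_poly[OF hom_\<iota>])

lemma deg_emb: "degree (emb p) = degree p"
  by (rule degree_map_poly) (use inj_\<iota> in auto)

lemma lead_mbed:
  assumes "P_at0 b \<noteq> 0"
  shows "fls_lead (mbed b) 0 (to_fract (emb (P_at0 b)))"
  by (rule fls_leadI) (use assms mbed_nth[of b 0] mbed_nth_neg in \<open>simp_all add: coeffX_0 map_\<iota>_eq_0\<close>)

lemma lead_Z: "fls_lead mZ 0 (to_fract [:0, 1:])"
  by (auto simp: fls_lead_def mZ_def)

lemma P0_nonzero: "P0 \<noteq> 0" using monic_P0 by auto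

lemma lead_Y: "fls_lead (mY d) (- int d) (to_fract (emb P0))"
proof -
  have "mX ^ d * mY d = mbed P" using solution_model[of d 0] by (simp add: solution_def mbed_def)
  then have "fls_lead (mX ^ d * mY d) 0 (to_fract (emb P0))"
    using lead_mbed[of P] P0_nonzero by (simp add: P0_def)
  then show ?thesis using fls_lead_cancel[OF _ fls_lead_X_power] by fastforce
qed

text \<open>The polynomial in \<open>X\<close> and \<open>Z\<close> by which \<open>t\<close> is expressed with denominator \<open>X\<^sup>s\<^sup>d\<^sup>+\<^sup>e\<close>.\<close>

definition hQ where "hQ d = poly (homogenized Q d) P"

lemma hQ_ev:
  assumes c: "is_hom c" and s: "solution d e c x z y t"
  shows "x ^ weight_T d e * t = ev2 c x z (hQ d)"
proof -
  have h: "is_hom (ev2 c x z)" by (simp add: c is_hom_ev)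
  have "x ^ (d * sQ) * ev3 c x z y Q = ev3 c x z (ev2 c x z P) (homogenized Q d)"
    by (rule ev3_homogenized[OF c]) (use s in \<open>simp add: solution_def\<close>)
  also have "\<dots> = ev2 c x z (hQ d)"
    unfolding hQ_def using hom_ev[OF h is_hom_id, of P "homogenized Q d"]
    by (simp add: ev_def[of "\<lambda>u. u"])
  finally show ?thesis
    using s unfolding solution_def by (metis mult.assoc mult.commute power_add)
qed

lemma hQ_at0: "d \<ge> 1 \<Longrightarrow> P_at0 (hQ d) = smult q (P0 ^ sQ)"
proof -
  assume d: "d \<ge> 1"
  have "P_at0 (hQ d) = ev (\<lambda>u. P_at0 u) (P_at0 P) (homogenized Q d)"
    unfolding hQ_def using hom_ev[OF is_hom_P_at0 is_hom_id, of P "homogenized Q d"]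
    by (simp add: ev_def[of "\<lambda>u. u"])
  also have "\<dots> = poly (Q_at0 (homogenized Q d)) P0"
    by (simp add: ev_def Q_at0_def P0_def)
  also have "\<dots> = smult q (P0 ^ sQ)"
    using lead_Q by (simp add: Q_at0_homogenized[OF d] poly_monom) (simp add: P_at0_def map_poly_pCons)
  finally show ?thesis .
qed

lemma lead_T:
  assumes d: "d \<ge> 1"
  shows "fls_lead (mT d e) (- int (weight_T d e)) (to_fract (emb (smult q (P0 ^ sQ))))"
proof -
  have "mX ^ weight_T d e * mT d e = mbed (hQ d)"
    using hQ_ev[OF is_hom_\<kappa> solution_model] by (simp add: mbed_def)
  then have "fls_lead (mX ^ weight_T d e * mT d e) 0 (to_fract (emb (smult q (P0 ^ sQ))))"
    using lead_mbed[of "hQ d"] P0_nonzero q_nonzero by (simp add: hQ_at0[OF d])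
  then show ?thesis using fls_lead_cancel[OF _ fls_lead_X_power] by fastforce
qed

subsection \<open>Monomials\<close>

definition mono where "mono d e i j k l = mX ^ i * mZ ^ j * mY d ^ k * mT d e ^ l"
abbreviation wt where "wt d e i k l \<equiv> int i - int (k * d + l * weight_T d e)"
abbreviation dg where "dg j k l \<equiv> j + rP * k + rP * sQ * l"

lemma lead_mono:
  assumes "d \<ge> 1"
  obtains g where "g \<noteq> 0" "degree g = dg j k l" "fls_lead (mono d e i j k l) (wt d e i k l) (to_fract g)"
proof -
  let ?g = "[:0, 1:] ^ j * emb P0 ^ k * emb (smult q (P0 ^ sQ)) ^ l"
  have nz: "emb P0 \<noteq> 0" "emb (smult q (P0 ^ sQ)) \<noteq> 0" "([:0, 1:] :: 'f poly) \<noteq> 0"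
    using P0_nonzero q_nonzero by (simp_all add: map_\<iota>_eq_0)
  have "fls_lead (mono d e i j k l)
      (int i + int j * 0 + int k * (- int d) + int l * (- int (weight_T d e)))
      (1 * to_fract [:0, 1:] ^ j * to_fract (emb P0) ^ k * to_fract (emb (smult q (P0 ^ sQ))) ^ l)"
    unfolding mono_def
    by (intro fls_lead_mult fls_lead_power lead_Z lead_Y lead_T assms fls_lead_X_power)
  also have "int i + int j * 0 + int k * (- int d) + int l * (- int (weight_T d e)) = wt d e i k l"
    by (simp add: algebra_simps)
  also have "1 * to_fract [:0, 1:] ^ j * to_fract (emb P0) ^ k * to_fract (emb (smult q (P0 ^ sQ))) ^ l
      = to_fract ?g"
    by (simp only: hom_mult[OF is_hom_to_fract] hom_power[OF is_hom_to_fract] mult_1)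
  finally have "fls_lead (mono d e i j k l) (wt d e i k l) (to_fract ?g)" .
  moreover have "degree ?g = dg j k l"
    using nz q_nonzero P0_nonzero
    by (simp add: degree_mult_eq degree_power_eq deg_emb deg_P0 del: power_mult_distrib)
  moreover have "?g \<noteq> 0" using nz by (simp del: power_mult_distrib)
  ultimately show thesis using that by blast
qed

lemma mono_mult: "mono d e i j k l * mono d e i' j' k' l' = mono d e (i + i') (j + j') (k + k') (l + l')"
  by (simp add: mono_def power_add algebra_simps)

text \<open>The filtration by the order in \<open>X\<close>, refined by the degree in \<open>Z\<close> of the coefficient of \<open>X\<^sup>w\<close>. It is
  defined by the monomials of a representation and not by the value, since a combination of monomials
  of low weight may cancel to a function of higher order.\<close>

inductive_set flt :: "nat \<Rightarrow> nat \<Rightarrow> int \<Rightarrow> nat \<Rightarrow> 'f poly fract fls set" for d e w D where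
  zero: "0 \<in> flt d e w D"
| step: "v \<in> flt d e w D \<Longrightarrow> w < wt d e i k l \<or> w = wt d e i k l \<and> dg j k l < D \<Longrightarrow>
    \<kappa> a * mono d e i j k l + v \<in> flt d e w D"

lemma flt_add: "u \<in> flt d e w D \<Longrightarrow> v \<in> flt d e w D \<Longrightarrow> u + v \<in> flt d e w D"
  by (induction rule: flt.induct) (auto simp: add.assoc intro: flt.step)

lemma flt_scale: "u \<in> flt d e w D \<Longrightarrow> \<kappa> b * u \<in> flt d e w D"
proof (induction rule: flt.induct)
  case (step v i k l j a)
  have "\<kappa> b * (\<kappa> a * mono d e i j k l + v) = \<kappa> (b * a) * mono d e i j k l + \<kappa> b * v"
    by (simp add: hom_mult[OF is_hom_\<kappa>] algebra_simps)
  then show ?case using step by (metis flt.step)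
qed (simp add: flt.zero)

lemma flt_diff: "u \<in> flt d e w D \<Longrightarrow> v \<in> flt d e w D \<Longrightarrow> u - v \<in> flt d e w D"
  using flt_add[of u d e w D "\<kappa> (- 1) * v"] flt_scale[of v d e w D "- 1"]
  by (simp add: hom_simps[OF is_hom_\<kappa>])

lemma flt_sum: "(\<And>i. i \<in> S \<Longrightarrow> f i \<in> flt d e w D) \<Longrightarrow> sum f S \<in> flt d e w D"
  by (induction S rule: infinite_finite_induct) (auto intro: flt.zero flt_add)

lemma flt_mono:
  "w < wt d e i k l \<or> w = wt d e i k l \<and> dg j k l < D \<Longrightarrow> \<kappa> a * mono d e i j k l \<in> flt d e w D"
  using flt.step[OF flt.zero, where w = w and d = d and e = e and i = i and k = k and l = l and j = j
      and D = D and a = a] by simp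

lemma flt_weaken: "u \<in> flt d e w D \<Longrightarrow> w' < w \<or> w' = w \<and> D \<le> D' \<Longrightarrow> u \<in> flt d e w' D'"
  by (induction rule: flt.induct) (auto intro!: flt.zero flt.step)

lemma flt_next: "u \<in> flt d e w 0 \<Longrightarrow> \<exists>D. u \<in> flt d e (w + 1) D"
proof (induction rule: flt.induct)
  case (step v i k l j a)
  then obtain D where D: "v \<in> flt d e (w + 1) D" by blast
  have "\<kappa> a * mono d e i j k l + v \<in> flt d e (w + 1) (D + dg j k l + 1)"
    by (rule flt.step) (use step D in \<open>auto intro: flt_weaken\<close>)
  then show ?case by blast
qed (auto intro: flt.zero)

lemma flt_mono_mult:
  "u \<in> flt d e w D \<Longrightarrow> mono d e i j k l * u \<in> flt d e (w + wt d e i k l) (D + dg j k l)"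
proof (induction rule: flt.induct)
  case (step v i' k' l' j' a)
  have "mono d e i j k l * (\<kappa> a * mono d e i' j' k' l' + v)
      = \<kappa> a * mono d e (i' + i) (j' + j) (k' + k) (l' + l) + mono d e i j k l * v"
    by (simp add: mono_mult[symmetric] algebra_simps)
  also have "\<dots> \<in> flt d e (w + wt d e i k l) (D + dg j k l)"
    by (rule flt.step[OF step.IH]) (use step.hyps(2) in \<open>auto simp: algebra_simps\<close>)
  finally show ?case .
qed (simp add: flt.zero)

lemma flt_mult:
  "u \<in> flt d e w D \<Longrightarrow> v \<in> flt d e w' D' \<Longrightarrow> u * v \<in> flt d e (w + w') (D + D')"
proof (induction rule: flt.induct)
  case (step u i k l j a)
  have "mono d e i j k l * v \<in> flt d e (w' + wt d e i k l) (D' + dg j k l)"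
    by (rule flt_mono_mult[OF step.prems])
  then have "mono d e i j k l * v \<in> flt d e (w + w') (D + D')"
    by (rule flt_weaken) (use step.hyps(2) in auto)
  then show ?case
    using flt_add[OF flt_scale step.IH[OF step.prems], of "mono d e i j k l * v" a]
    by (simp add: algebra_simps)
qed (simp add: flt.zero)

lemma ev_\<kappa>_flt: "ev \<kappa> mX a * mono d e i j k l \<in> flt d e (wt d e i k l) (Suc (dg j k l))"
proof (induction a arbitrary: i)
  case 0
  then show ?case by (simp add: ev_0 is_hom_\<kappa> flt.zero)
next
  case (pCons r a)
  have "ev \<kappa> mX (pCons r a) * mono d e i j k l
      = \<kappa> r * mono d e i j k l + ev \<kappa> mX a * mono d e (Suc i) j k l"
    by (simp add: ev_pCons is_hom_\<kappa> mono_def algebra_simps)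
  also have "\<dots> \<in> flt d e (wt d e i k l) (Suc (dg j k l))"
    by (rule flt.step[OF flt_weaken[OF pCons.IH[of "Suc i"]]]) auto
  finally show ?case .
qed

lemma mbed_flt:
  assumes "b = 0 \<or> degree b < D"
  shows "mbed b \<in> flt d e 0 D"
proof -
  have "mbed b = (\<Sum>j\<le>degree b. ev \<kappa> mX (coeff b j) * mono d e 0 j 0 0)"
    by (simp add: mbed_def ev_altdef[OF is_hom_ev[OF is_hom_\<kappa>] order_refl] mono_def)
  also have "\<dots> \<in> flt d e 0 D"
  proof (cases "b = 0")
    case True
    then show ?thesis by (simp add: ev_0 is_hom_\<kappa> flt.zero)
  next
    case False
    show ?thesis
    proof (rule flt_sum)
      fix j assume "j \<in> {..degree b}"
      then show "ev \<kappa> mX (coeff b j) * mono d e 0 j 0 0 \<in> flt d e 0 D"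
        using ev_\<kappa>_flt[of "coeff b j" d e 0 j 0 0] assms False
        by (auto elim!: flt_weaken)
    qed
  qed
  finally show ?thesis .
qed

lemma Z_power_reduce: "mZ ^ rP - mX ^ d * mY d \<in> flt d e 0 rP"
proof -
  define b where "b = P - monom 1 rP"
  have "degree b \<le> rP" unfolding b_def by (rule degree_diff_le) (auto simp: degree_monom_le)
  moreover have "coeff b rP = 0" using monic_P by (simp add: b_def)
  ultimately have b: "b = 0 \<or> degree b < rP" by (metis leading_coeff_0_iff order_le_less)
  have "mbed (monom 1 rP) = mZ ^ rP"
    using hom_0[OF is_hom_ev[OF is_hom_\<kappa>], of mX] hom_1[OF is_hom_ev[OF is_hom_\<kappa>], of mX]
    by (simp add: mbed_def ev_def[of "ev \<kappa> mX" mZ] map_poly_monom poly_monom)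
  moreover have "mX ^ d * mY d = mbed P"
    using solution_model[of d 0] by (simp add: solution_def mbed_def)
  ultimately have "mbed b = mX ^ d * mY d - mZ ^ rP"
    by (simp add: b_def hom_diff[OF is_hom_mbed])
  then show ?thesis using flt_diff[OF flt.zero mbed_flt[OF b]] by simp
qed

lemma Y_power_reduce:
  assumes d: "d \<ge> 1"
  shows "\<kappa> q * mY d ^ sQ - mX ^ e * mT d e \<in> flt d e (- int (sQ * d)) 0"
proof -
  have h: "is_hom (ev2 \<kappa> mX mZ)" by (simp add: is_hom_ev is_hom_\<kappa>)
  have "mX ^ e * mT d e = (\<Sum>k\<le>sQ. mbed (coeff Q k) * mY d ^ k)"
    using solution_model[of d e] by (simp add: solution_def ev_altdef[OF h order_refl] mbed_def)
  also have "{..sQ} = insert sQ {..<sQ}" by auto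
  also have "(\<Sum>k\<in>\<dots>. mbed (coeff Q k) * mY d ^ k)
      = \<kappa> q * mY d ^ sQ + (\<Sum>k<sQ. mbed (coeff Q k) * mY d ^ k)"
    using lead_Q by (simp add: mbed_def ev_const is_hom_ev is_hom_\<kappa>)
  finally have eq: "\<kappa> q * mY d ^ sQ - mX ^ e * mT d e = 0 - (\<Sum>k<sQ. mbed (coeff Q k) * mY d ^ k)"
    by simp
  show ?thesis unfolding eq
  proof (intro flt_diff flt.zero flt_sum)
    fix k assume k: "k \<in> {..<sQ}"
    have "mbed (coeff Q k) \<in> flt d e 0 (Suc (degree (coeff Q k)))" by (rule mbed_flt) auto
    from flt_mono_mult[OF this, of 0 0 k 0]
    have "mbed (coeff Q k) * mY d ^ k \<in> flt d e (- int (k * d)) (Suc (degree (coeff Q k)) + rP * k)"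
      by (simp add: mono_def mult.commute)
    moreover have "k * d < sQ * d" using k d by simp
    then have "- int (sQ * d) < - int (k * d)" by (simp only: neg_less_iff_less of_nat_less_iff)
    ultimately show "mbed (coeff Q k) * mY d ^ k \<in> flt d e (- int (sQ * d)) 0"
      by (blast intro: flt_weaken)
  qed
qed

lemma model_flt: "\<exists>w D. model d e p \<in> flt d e w D"
proof -
  define S where "S = {p. \<exists>w D. model d e p \<in> flt d e w D}"
  have "p \<in> S"
  proof (rule poly4_closed)
    have "\<kappa> a * mono d e i j k l \<in> flt d e (wt d e i k l) (Suc (dg j k l))" for a i j k l
      by (rule flt_mono) auto
    from this[of _ 0 0 0 0] this[of 1 1 0 0 0] this[of 1 0 1 0 0] this[of 1 0 0 1 0] this[of 1 0 0 0 1]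
    show "const4 a \<in> S" "vX \<in> S" "vZ \<in> S" "vY \<in> S" "vT \<in> S" for a
      unfolding S_def mem_Collect_eq model_simps(1-5)
      by (auto simp: mono_def hom_1[OF is_hom_\<kappa>] simp del: of_nat_add of_nat_mult)
  next
    fix p p' assume "p \<in> S" "p' \<in> S"
    then obtain w D w' D' where
      1: "model d e p \<in> flt d e w D" and 2: "model d e p' \<in> flt d e w' D'" unfolding S_def by blast
    have "model d e p * model d e p' \<in> flt d e (w + w') (D + D')" by (rule flt_mult[OF 1 2])
    then show "p * p' \<in> S" unfolding S_def mem_Collect_eq hom_mult[OF is_hom_model] by blast
    have "model d e p + model d e p' \<in> flt d e (min w w') (max D D')"
      by (intro flt_add flt_weaken[OF 1] flt_weaken[OF 2]) auto
    then show "p + p' \<in> S" unfolding S_def mem_Collect_eq hom_add[OF is_hom_model] by blast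
  qed
  then show ?thesis by (simp add: S_def)
qed

subsection \<open>Normal monomials\<close>

text \<open>The pole order of the monomial of degree \<open>D\<close> with exponents of \<open>z\<close> and \<open>y\<close> below \<open>deg P\<close> and
  \<open>deg Q\<close> and without a factor \<open>X\<close>: these exponents are the digits of \<open>D\<close> in a mixed radix.\<close>

definition pole where
  "pole d e D = ((D div rP) mod sQ) * d + (D div (rP * sQ)) * weight_T d e"

lemma pole_eq: "pole d e D = (D div rP) * d + (D div (rP * sQ)) * e"
proof -
  define k l where "k = (D div rP) mod sQ" and "l = D div (rP * sQ)"
  have A: "D div rP = k + l * sQ" by (simp add: k_def l_def div_mult2_eq)
  have "pole d e D = k * d + l * weight_T d e" by (simp add: pole_def k_def l_def)
  also have "\<dots> = (D div rP) * d + l * e" unfolding A by (simp add: algebra_simps)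
  finally show ?thesis by (simp add: l_def)
qed

definition nmono where
  "nmono d e w D = mono d e (nat (w + int (pole d e D))) (D mod rP) ((D div rP) mod sQ) (D div (rP
      * sQ))"

text \<open>For given weight and degree there is at most one monomial with exponents of \<open>z\<close> and \<open>y\<close> below
  \<open>deg P\<close> and \<open>deg Q\<close>; the defining equations rewrite every monomial to it, up to terms that come
  later in the filtration, and each rewriting step raises the exponent of \<open>X\<close>.\<close>

lemma mono_reduce:
  assumes d: "d \<ge> 1"
  shows "\<exists>b c. b \<noteq> 0 \<and> 0 \<le> wt d e i k l + int (pole d e (dg j k l)) \<and>
    \<kappa> b * mono d e i j k l - \<kappa> c * nmono d e (wt d e i k l) (dg j k l)
      \<in> flt d e (wt d e i k l) (dg j k l)"
proof (induction "j + k" arbitrary: i j k l rule: less_induct)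
  case less
  consider "rP \<le> j" | "j < rP" "sQ \<le> k" | "j < rP" "k < sQ" by linarith
  then show ?case
  proof cases
    case 1
    define j' where "j' = j - rP"
    have j: "j = j' + rP" using 1 by (simp add: j'_def)
    have w: "wt d e (i + d) (k + 1) l = wt d e i k l" "dg j' (k + 1) l = dg j k l"
      by (simp_all add: j algebra_simps)
    have "j' + (k + 1) < j + k" using deg_P by (simp add: j)
    from less.hyps[OF this, of "i + d" l] obtain b c where
      bc: "b \<noteq> 0" "0 \<le> wt d e i k l + int (pole d e (dg j k l))"
      "\<kappa> b * mono d e (i + d) j' (k + 1) l - \<kappa> c * nmono d e (wt d e i k l) (dg j k l)
        \<in> flt d e (wt d e i k l) (dg j k l)"
      unfolding w by blast
    \<comment> \<open>\<open>P\<close> replaces \<open>Z\<^sup>r\<close> by \<open>X\<^sup>d Y\<close>.\<close>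
    have "mono d e i j' k l * (mZ ^ rP - mX ^ d * mY d)
        \<in> flt d e (0 + wt d e i k l) (rP + dg j' k l)"
      by (rule flt_mono_mult[OF Z_power_reduce])
    also have "mono d e i j' k l * (mZ ^ rP - mX ^ d * mY d)
        = mono d e i j k l - mono d e (i + d) j' (k + 1) l"
      by (simp add: mono_def j power_add algebra_simps)
    also have "0 + wt d e i k l = wt d e i k l" by simp
    also have "rP + dg j' k l = dg j k l" by (simp add: j)
    finally have "\<kappa> b * (mono d e i j k l - mono d e (i + d) j' (k + 1) l)
        + (\<kappa> b * mono d e (i + d) j' (k + 1) l - \<kappa> c * nmono d e (wt d e i k l) (dg j k l))
        \<in> flt d e (wt d e i k l) (dg j k l)"
      by (rule flt_add[OF flt_scale bc(3)])
    then have "\<kappa> b * mono d e i j k l - \<kappa> c * nmono d e (wt d e i k l) (dg j k l)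
        \<in> flt d e (wt d e i k l) (dg j k l)"
      by (simp add: right_diff_distrib)
    then show ?thesis using bc by blast
  next
    case 2
    define k' where "k' = k - sQ"
    have k: "k = k' + sQ" using 2 by (simp add: k'_def)
    have w: "wt d e (i + e) k' (l + 1) = wt d e i k l" "dg j k' (l + 1) = dg j k l"
      by (simp_all add: k algebra_simps)
    have "j + k' < j + k" using deg_Q by (simp add: k)
    from less.hyps[OF this, of "i + e" "l + 1"] obtain b c where
      bc: "b \<noteq> 0" "0 \<le> wt d e i k l + int (pole d e (dg j k l))"
      "\<kappa> b * mono d e (i + e) j k' (l + 1) - \<kappa> c * nmono d e (wt d e i k l) (dg j k l)
        \<in> flt d e (wt d e i k l) (dg j k l)"
      unfolding w by blast
    \<comment> \<open>\<open>Q\<close> replaces \<open>q Y\<^sup>s\<close> by \<open>X\<^sup>e T\<close>.\<close>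
    have "mono d e i j k' l * (\<kappa> q * mY d ^ sQ - mX ^ e * mT d e)
        \<in> flt d e (- int (sQ * d) + wt d e i k' l) (0 + dg j k' l)"
      by (rule flt_mono_mult[OF Y_power_reduce[OF d]])
    also have "mono d e i j k' l * (\<kappa> q * mY d ^ sQ - mX ^ e * mT d e)
        = \<kappa> q * mono d e i j k l - mono d e (i + e) j k' (l + 1)"
      by (simp add: mono_def k power_add algebra_simps)
    also have "- int (sQ * d) + wt d e i k' l = wt d e i k l" by (simp add: k algebra_simps)
    finally have "\<kappa> q * mono d e i j k l - mono d e (i + e) j k' (l + 1)
        \<in> flt d e (wt d e i k l) (dg j k l)"
      by (rule flt_weaken) (simp add: k)
    then have "\<kappa> b * (\<kappa> q * mono d e i j k l - mono d e (i + e) j k' (l + 1))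
        + (\<kappa> b * mono d e (i + e) j k' (l + 1) - \<kappa> c * nmono d e (wt d e i k l) (dg j k l))
        \<in> flt d e (wt d e i k l) (dg j k l)"
      by (rule flt_add[OF flt_scale bc(3)])
    then have "\<kappa> (b * q) * mono d e i j k l - \<kappa> c * nmono d e (wt d e i k l) (dg j k l)
        \<in> flt d e (wt d e i k l) (dg j k l)"
      by (simp add: right_diff_distrib hom_mult[OF is_hom_\<kappa>] mult.assoc)
    then show ?thesis using bc q_nonzero by (metis mult_eq_0_iff)
  next
    case 3
    have D: "dg j k l = j + rP * (k + sQ * l)" by (simp add: algebra_simps)
    have dr: "dg j k l div rP = k + sQ * l" "dg j k l mod rP = j"
      using 3 deg_P unfolding D by simp_all
    have ds: "dg j k l div rP mod sQ = k" "dg j k l div (rP * sQ) = l"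
      using 3 deg_Q unfolding div_mult2_eq dr by simp_all
    have pl: "pole d e (dg j k l) = k * d + l * weight_T d e" unfolding pole_def ds by simp
    then have "nmono d e (wt d e i k l) (dg j k l) = mono d e i j k l"
      unfolding nmono_def dr(2) ds pl by simp
    then have "\<kappa> 1 * mono d e i j k l - \<kappa> 1 * nmono d e (wt d e i k l) (dg j k l)
        \<in> flt d e (wt d e i k l) (dg j k l)"
      by (simp add: flt.zero)
    moreover have "0 \<le> wt d e i k l + int (pole d e (dg j k l))" unfolding pl by simp
    ultimately show ?thesis by (meson one_neq_zero)
  qed
qed

lemma flt_reduce:
  assumes d: "d \<ge> 1"
  shows "u \<in> flt d e w (Suc D) \<Longrightarrow> \<exists>b c. b \<noteq> 0 \<and> (c = 0 \<or> 0 \<le> w + int (pole d e D)) \<and>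
    \<kappa> b * u - \<kappa> c * nmono d e w D \<in> flt d e w D"
proof (induction rule: flt.induct)
  case zero
  have "\<kappa> 1 * 0 - \<kappa> 0 * nmono d e w D \<in> flt d e w D" by (simp add: flt.zero hom_0[OF is_hom_\<kappa>])
  then show ?case using one_neq_zero by blast
next
  case (step v i k l j a)
  then obtain b c where bc: "b \<noteq> 0" "c = 0 \<or> 0 \<le> w + int (pole d e D)"
    "\<kappa> b * v - \<kappa> c * nmono d e w D \<in> flt d e w D" by blast
  show ?case
  proof (cases "w = wt d e i k l \<and> dg j k l = D")
    case False
    then have "w < wt d e i k l \<or> w = wt d e i k l \<and> dg j k l < D" using step.hyps(2) by linarith
    from flt.step[OF bc(3) this, of "b * a"]
    have "\<kappa> b * (\<kappa> a * mono d e i j k l + v) - \<kappa> c * nmono d e w D \<in> flt d e w D"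
      by (simp add: hom_mult[OF is_hom_\<kappa>] algebra_simps)
    then show ?thesis using bc by blast
  next
    case True
    then obtain b' c' where bc': "b' \<noteq> 0" "0 \<le> w + int (pole d e D)"
      "\<kappa> b' * mono d e i j k l - \<kappa> c' * nmono d e w D \<in> flt d e w D"
      using mono_reduce[OF d, where e = e and i = i and k = k and l = l and j = j] by blast
    have "\<kappa> (b * a) * (\<kappa> b' * mono d e i j k l - \<kappa> c' * nmono d e w D)
        + \<kappa> b' * (\<kappa> b * v - \<kappa> c * nmono d e w D) \<in> flt d e w D"
      by (intro flt_add flt_scale bc bc')
    also have "\<kappa> (b * a) * (\<kappa> b' * mono d e i j k l - \<kappa> c' * nmono d e w D)
        + \<kappa> b' * (\<kappa> b * v - \<kappa> c * nmono d e w D)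
      = \<kappa> (b * b') * (\<kappa> a * mono d e i j k l + v) - \<kappa> (b * a * c' + b' * c) * nmono d e w D"
      by (simp add: hom_simps[OF is_hom_\<kappa>] algebra_simps)
    finally show ?thesis using bc bc' by (metis mult_eq_0_iff)
  qed
qed

lemma flt_nth:
  assumes d: "d \<ge> 1"
  shows "u \<in> flt d e w D \<Longrightarrow>
    (\<forall>n<w. fls_nth u n = 0) \<and> (\<exists>g. fls_nth u w = to_fract g \<and> (g = 0 \<or> degree g < D))"
proof (induction rule: flt.induct)
  case zero
  show ?case by (auto intro!: exI[of _ 0])
next
  case (step v i k l j a)
  obtain h where h: "h \<noteq> 0" "degree h = dg j k l"
    "fls_lead (mono d e i j k l) (wt d e i k l) (to_fract h)" by (rule lead_mono[OF d])
  have m0: "fls_nth (mono d e i j k l) n = 0" if "n < wt d e i k l" for n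
    using that h(3) unfolding fls_lead_def by (intro fls_eq0_below_subdegree) linarith
  have mw: "fls_nth (mono d e i j k l) (wt d e i k l) = to_fract h"
    using h(3) unfolding fls_lead_def by blast
  obtain g where g: "fls_nth v w = to_fract g" "g = 0 \<or> degree g < D" using step.IH by blast
  have nth: "fls_nth (\<kappa> a * mono d e i j k l + v) n
      = to_fract [:\<iota> a:] * fls_nth (mono d e i j k l) n + fls_nth v n" for n
    by (simp add: \<kappa>_def)
  have low: "fls_nth (\<kappa> a * mono d e i j k l + v) n = 0" if "n < w" for n
    unfolding nth using that m0[of n] step.IH step.hyps(2) by (auto simp del: of_nat_add of_nat_mult)
  show ?case
  proof (cases "w < wt d e i k l")
    case True
    then have "fls_nth (\<kappa> a * mono d e i j k l + v) w = to_fract g" unfolding nth using m0 g by simp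
    then show ?thesis using low g by blast
  next
    case False
    then have w: "w = wt d e i k l" "dg j k l < D" using step.hyps(2) by auto
    have "fls_nth (\<kappa> a * mono d e i j k l + v) w = to_fract ([:\<iota> a:] * h + g)"
      unfolding nth using mw g(1) w(1) by (simp del: of_nat_add of_nat_mult mult_pCons_left)
    moreover have "degree ([:\<iota> a:] * h + g) < D \<or> [:\<iota> a:] * h + g = 0"
    proof -
      have "degree (smult (\<iota> a) h) < D" using degree_smult_le[of "\<iota> a" h] h(2) w(2) by linarith
      then show ?thesis using g(2) by (auto intro: degree_add_less)
    qed
    ultimately show ?thesis using low by blast
  qed
qed

lemma nmono_lead:
  assumes d: "d \<ge> 1" and p: "0 \<le> w + int (pole d e D)"
  shows "\<exists>h. h \<noteq> 0 \<and> degree h = D \<and> fls_nth (nmono d e w D) w = to_fract h"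
proof -
  let ?i = "nat (w + int (pole d e D))" and ?j = "D mod rP" and ?k = "(D div rP) mod sQ"
    and ?l = "D div (rP * sQ)"
  obtain h where h: "h \<noteq> 0" "degree h = dg ?j ?k ?l"
    "fls_lead (mono d e ?i ?j ?k ?l) (wt d e ?i ?k ?l) (to_fract h)" by (rule lead_mono[OF d])
  have "wt d e ?i ?k ?l = w" using p by (simp add: pole_def)
  moreover have "dg ?j ?k ?l = D"
  proof -
    have "dg ?j ?k ?l = D mod rP + rP * ((D div rP) mod sQ + sQ * ((D div rP) div sQ))"
      by (simp only: div_mult2_eq distrib_left mult.assoc add.assoc)
    also have "(D div rP) mod sQ + sQ * ((D div rP) div sQ) = D div rP" by (rule mod_mult_div_eq)
    also have "D mod rP + rP * (D div rP) = D" by (rule mod_mult_div_eq)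
    finally show ?thesis .
  qed
  ultimately show ?thesis using h unfolding nmono_def fls_lead_def by auto
qed

text \<open>The leading coefficient of the normal monomial of degree \<open>D\<close> has degree \<open>D\<close>, while everything
  else of the same weight has smaller degree. So normal monomials cannot cancel, and if the
  coefficient of weight \<open>w\<close> vanishes, all of them can be removed from the top degree downwards.\<close>

lemma flt_descend:
  assumes d: "d \<ge> 1"
  shows "u \<in> flt d e w D \<Longrightarrow> fls_nth u w = 0 \<Longrightarrow> \<exists>b. b \<noteq> 0 \<and> \<kappa> b * u \<in> flt d e w 0"
proof (induction D arbitrary: u)
  case 0
  then show ?case using hom_1[OF is_hom_\<kappa>] by (metis mult_1 one_neq_zero)
next
  case (Suc D)
  obtain b c where bc: "b \<noteq> 0" "c = 0 \<or> 0 \<le> w + int (pole d e D)"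
    "\<kappa> b * u - \<kappa> c * nmono d e w D \<in> flt d e w D" using flt_reduce[OF d Suc.prems(1)] by blast
  obtain g where g: "fls_nth (\<kappa> b * u - \<kappa> c * nmono d e w D) w = to_fract g" "g = 0 \<or> degree g < D"
    using flt_nth[OF d bc(3)] by blast
  have "c = 0"
  proof (rule ccontr)
    assume c: "c \<noteq> 0"
    then obtain h where h: "h \<noteq> 0" "degree h = D" "fls_nth (nmono d e w D) w = to_fract h"
      using bc(2) nmono_lead[OF d] by blast
    have "to_fract g = to_fract (- smult (\<iota> c) h)"
      using g(1) Suc.prems(2) h(3) by (simp add: \<kappa>_def flip: to_fract_mult to_fract_uminus)
    then have "g = - smult (\<iota> c) h" by (simp only: to_fract_eq_iff)
    moreover have "\<iota> c \<noteq> 0" using c inj_\<iota> by blast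
    ultimately show False using g(2) h by auto
  qed
  then have "\<kappa> b * u \<in> flt d e w D" using bc(3) by (simp add: hom_0[OF is_hom_\<kappa>])
  moreover have "fls_nth (\<kappa> b * u) w = 0" using Suc.prems(2) by (simp add: \<kappa>_def)
  ultimately obtain b' where "b' \<noteq> 0" "\<kappa> b' * (\<kappa> b * u) \<in> flt d e w 0" using Suc.IH by blast
  then have "b' * b \<noteq> 0" "\<kappa> (b' * b) * u \<in> flt d e w 0"
    using bc(1) by (simp_all add: hom_mult[OF is_hom_\<kappa>] mult.assoc)
  then show ?case by blast
qed

lemma flt_bound:
  assumes d: "d \<ge> 1"
  shows "u \<in> flt d e w D \<Longrightarrow> fls_nth u w = to_fract g \<Longrightarrow> g \<noteq> 0 \<Longrightarrow> 0 \<le> w + int (pole d e (degree g))"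
proof (induction D arbitrary: u g)
  case 0
  then show ?case using flt_nth[OF d 0(1)] by auto
next
  case (Suc D)
  obtain b c where bc: "b \<noteq> 0" "c = 0 \<or> 0 \<le> w + int (pole d e D)"
    "\<kappa> b * u - \<kappa> c * nmono d e w D \<in> flt d e w D" using flt_reduce[OF d Suc.prems(1)] by blast
  obtain g' where g': "fls_nth (\<kappa> b * u - \<kappa> c * nmono d e w D) w = to_fract g'" "g' = 0 \<or> degree g' < D"
    using flt_nth[OF d bc(3)] by blast
  have b: "\<iota> b \<noteq> 0" using bc(1) inj_\<iota> by blast
  show ?case
  proof (cases "c = 0")
    case True
    then have "\<kappa> b * u \<in> flt d e w D" using bc(3) by (simp add: hom_0[OF is_hom_\<kappa>])
    moreover have "fls_nth (\<kappa> b * u) w = to_fract (smult (\<iota> b) g)"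
      using Suc.prems(2) by (simp add: \<kappa>_def flip: to_fract_mult)
    ultimately have "0 \<le> w + int (pole d e (degree (smult (\<iota> b) g)))"
      using Suc.IH[of "\<kappa> b * u" "smult (\<iota> b) g"] b Suc.prems(3) by simp
    then show ?thesis using b by simp
  next
    case False
    then have p: "0 \<le> w + int (pole d e D)" using bc(2) by blast
    then obtain h where h: "h \<noteq> 0" "degree h = D" "fls_nth (nmono d e w D) w = to_fract h"
      using nmono_lead[OF d] by blast
    have "to_fract g' = to_fract (smult (\<iota> b) g - smult (\<iota> c) h)"
      using g'(1) Suc.prems(2) h(3) by (simp add: \<kappa>_def flip: to_fract_mult to_fract_diff)
    then have "g' = smult (\<iota> b) g - smult (\<iota> c) h" by (simp only: to_fract_eq_iff)
    then have eq: "smult (\<iota> b) g = smult (\<iota> c) h + g'" by simp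
    have "\<iota> c \<noteq> 0" using False inj_\<iota> by blast
    then have "degree (smult (\<iota> c) h) = D" using h by simp
    then have "degree (smult (\<iota> b) g) = D"
      unfolding eq using g'(2) degree_add_eq_left[of g' "smult (\<iota> c) h"] by auto
    then show ?thesis using b p by simp
  qed
qed

lemma flt_lead:
  assumes d: "d \<ge> 1" and u: "u \<in> flt d e w D" and l: "fls_lead u n (to_fract g)"
  shows "0 \<le> n + int (pole d e (degree g))"
proof -
  have "w \<le> n" using flt_nth[OF d u] l unfolding fls_lead_def by (metis not_le)
  then show ?thesis using u l
  proof (induction "nat (n - w)" arbitrary: u w D g)
    case 0
    then have "n = w" by simp
    then show ?case using flt_bound[OF d 0(3)] 0(4) unfolding fls_lead_def by auto
  next
    case (Suc k)
    then have w: "w < n" by linarith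
    have "fls_nth u w = 0"
      using w Suc.prems(3) unfolding fls_lead_def by (intro fls_eq0_below_subdegree) auto
    then obtain b where b: "b \<noteq> 0" "\<kappa> b * u \<in> flt d e w 0" using flt_descend[OF d Suc.prems(2)] by blast
    obtain D' where D': "\<kappa> b * u \<in> flt d e (w + 1) D'" using flt_next[OF b(2)] by blast
    have b0: "\<iota> b \<noteq> 0" using b(1) inj_\<iota> by blast
    have "fls_lead (\<kappa> b) 0 (to_fract [:\<iota> b:])" using b0 by (simp add: fls_lead_def \<kappa>_def)
    from fls_lead_mult[OF this Suc.prems(3)]
    have "fls_lead (\<kappa> b * u) n (to_fract (smult (\<iota> b) g))" by (simp flip: to_fract_mult)
    from Suc.hyps(1)[OF _ _ D' this] have "0 \<le> n + int (pole d e (degree (smult (\<iota> b) g)))"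
      using Suc.hyps(2) w by linarith
    then show ?case using b0 by simp
  qed
qed

text \<open>A representation as a combination of monomials may have terms of lower weight than the order of the
  function. Their sum vanishes in that weight and can be rewritten in higher weight, until the
  lowest weight is the order. Then the leading coefficient is that of a normal monomial up to lower
  degree, and a normal monomial has a non-negative exponent of \<open>X\<close>.\<close>

theorem pole_bound:
  assumes d: "d \<ge> 1" and f: "mX ^ m * model d e p = mbed b" and b: "P_at0 b \<noteq> 0"
  shows "m \<le> (degree (P_at0 b) div rP) * d + (degree (P_at0 b) div (rP * sQ)) * e"
proof -
  have "fls_lead (mX ^ m * model d e p) 0 (to_fract (emb (P_at0 b)))"
    unfolding f by (rule lead_mbed[OF b])
  then have "fls_lead (model d e p) (0 - int m) (to_fract (emb (P_at0 b)))"
    by (rule fls_lead_cancel[OF _ fls_lead_X_power])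
  moreover obtain w D where "model d e p \<in> flt d e w D" using model_flt by blast
  ultimately have "0 \<le> (0 - int m) + int (pole d e (degree (emb (P_at0 b))))" by (rule flt_lead[OF
      d, rotated])
  then have "int m \<le> int (pole d e (degree (emb (P_at0 b))))" by simp
  then show ?thesis by (simp only: of_nat_le_iff deg_emb pole_eq)
qed

end

section \<open>Powers in a rational function field\<close>

text \<open>Every field is trivially Euclidean. The instances are needed for unique factorization of
  polynomials over a field of fractions.\<close>

instantiation fract :: (idom)
  "{unique_euclidean_ring, normalization_euclidean_semiring, normalization_semidom_multiplicative}"
begin

definition [simp]: "normalize_fract = (normalize_field :: 'a fract \<Rightarrow> _)"
definition [simp]: "unit_factor_fract = (unit_factor_field :: 'a fract \<Rightarrow> _)"
definition [simp]: "modulo_fract = (mod_field :: 'a fract \<Rightarrow> _)"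
definition [simp]: "euclidean_size_fract = (euclidean_size_field :: 'a fract \<Rightarrow> _)"
definition [simp]: "division_segment (x :: 'a fract) = 1"

instance
  by standard (simp_all add: dvd_field_iff field_split_simps split: if_splits)

end

instantiation fract :: (idom) euclidean_ring_gcd
begin

definition gcd_fract :: "'a fract \<Rightarrow> 'a fract \<Rightarrow> 'a fract" where
  "gcd_fract = Euclidean_Algorithm.gcd"
definition lcm_fract :: "'a fract \<Rightarrow> 'a fract \<Rightarrow> 'a fract" where
  "lcm_fract = Euclidean_Algorithm.lcm"
definition Gcd_fract :: "'a fract set \<Rightarrow> 'a fract" where
  "Gcd_fract = Euclidean_Algorithm.Gcd"
definition Lcm_fract :: "'a fract set \<Rightarrow> 'a fract" where
  "Lcm_fract = Euclidean_Algorithm.Lcm"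

instance by standard (simp_all add: gcd_fract_def lcm_fract_def Gcd_fract_def Lcm_fract_def)

end

instance fract :: (idom) field_gcd ..

text \<open>For a prime factor of \<open>v\<close>, which does not divide \<open>S\<close>, its multiplicities in \<open>v\<close> and \<open>a\<close> are in
  the ratio \<open>N : s\<close>. So the multiplicity in \<open>v\<close> is divisible by \<open>N\<close> divided by \<open>gcd N s\<close>.\<close>

lemma coprime_factor_is_power:
  fixes v S a :: "'k::field_gcd poly"
  assumes eq: "(v * S) ^ s = smult f (a ^ N)" and cop: "u * v + u' * S = 1"
    and nz: "f \<noteq> 0" "a \<noteq> 0" and s: "s > 0" "N > 0"
  shows "\<exists>\<alpha>. v = smult (lead_coeff v) (\<alpha> ^ (N div gcd N s))"
proof -
  define n where "n = N div gcd N s"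
  have n: "n > 0" using s by (simp add: n_def div_greater_zero_iff gcd_le1_nat)
  have vS: "v \<noteq> 0" "S \<noteq> 0" using eq nz s by (auto simp: power_0_left)
  have "n dvd multiplicity \<pi> v" if \<pi>: "prime \<pi>" for \<pi>
  proof (cases "\<pi> dvd v")
    case False
    then show ?thesis by (simp add: not_dvd_imp_multiplicity_0)
  next
    case True
    have pe: "prime_elem \<pi>" using \<pi> by simp
    have "\<not> \<pi> dvd S"
    proof
      assume "\<pi> dvd S"
      then have "\<pi> dvd u * v + u' * S" using True by (intro dvd_add dvd_mult)
      then show False using cop pe by (simp add: prime_elem_def)
    qed
    then have "multiplicity \<pi> S = 0" by (rule not_dvd_imp_multiplicity_0)
    then have "multiplicity \<pi> ((v * S) ^ s) = s * multiplicity \<pi> v"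
      using vS by (simp add: prime_elem_multiplicity_power_distrib[OF pe]
          prime_elem_multiplicity_mult_distrib[OF pe])
    moreover have "multiplicity \<pi> (smult f (a ^ N)) = N * multiplicity \<pi> a"
    proof -
      have "is_unit [:f:]" using nz by (simp add: is_unit_const_poly_iff dvd_field_iff)
      then have "multiplicity \<pi> ([:f:] * a ^ N) = multiplicity \<pi> (a ^ N)"
        by (rule multiplicity_times_unit_right)
      then show ?thesis using nz by (simp add: prime_elem_multiplicity_power_distrib[OF pe])
    qed
    ultimately have m: "s * multiplicity \<pi> v = N * multiplicity \<pi> a" using eq by simp
    have N: "N = n * gcd N s" and s': "s = (s div gcd N s) * gcd N s" by (simp_all add: n_def)
    have g: "gcd N s > 0" using s by simp
    have "(s div gcd N s) * multiplicity \<pi> v * gcd N s = n * multiplicity \<pi> a * gcd N s"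
      using m N s' by (metis mult.assoc mult.commute)
    then have "(s div gcd N s) * multiplicity \<pi> v = n * multiplicity \<pi> a" using g s by simp
    then have "n dvd (s div gcd N s) * multiplicity \<pi> v" by simp
    moreover have "coprime n (s div gcd N s)" unfolding n_def using s by (intro div_gcd_coprime) simp
    ultimately show ?thesis by (simp add: coprime_dvd_mult_right_iff)
  qed
  then have "is_nth_power n (normalize v)" using is_nth_power_conv_multiplicity[OF n, of v] by simp
  then obtain \<alpha> where \<alpha>: "normalize v = \<alpha> ^ n" by (elim is_nth_powerE)
  have "v = unit_factor v * normalize v" by simp
  also have "unit_factor v = [:lead_coeff v:]" 
    using vS(1) by (simp add: unit_factor_poly_def monom_0 is_unit_unit_factor dvd_field_iff)
  finally have "v = smult (lead_coeff v) (\<alpha> ^ n)" by (simp add: \<alpha>)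
  then show ?thesis unfolding n_def by blast
qed

abbreviation fconst :: "'f::field \<Rightarrow> 'f poly fract" where "fconst u \<equiv> to_fract [:u:]"

lemma is_hom_fconst: "is_hom fconst"
  by (rule is_hom_comp[OF is_hom_to_fract is_hom_const_poly])

text \<open>The order at \<open>l1\<close> of the quotient of the left-hand sides is 1, which \<open>n\<close> does not divide.\<close>

lemma ratio_not_power:
  fixes l1 l2 :: "'f::field"
  assumes l: "l1 \<noteq> l2" and n: "n \<ge> 2"
    and 1: "to_fract [:- l1, 1:] = c * A ^ n" and 2: "to_fract [:- l2, 1:] = c * B ^ n"
  shows False
proof -
  obtain A1 A2 where A: "A = Fract A1 A2" "A2 \<noteq> 0" by (rule Fract_cases)
  obtain B1 B2 where B: "B = Fract B1 B2" "B2 \<noteq> 0" by (rule Fract_cases)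
  have conv: "Fract x y = to_fract x / to_fract y" if "y \<noteq> 0" for x y :: "'f poly"
    using that by (simp add: to_fract_def)
  have nz: "A1 \<noteq> 0" "B1 \<noteq> 0"
    using 1 2 A B n by (auto simp: conv power_0_left)
  have "to_fract [:- l1, 1:] * B ^ n = to_fract [:- l2, 1:] * A ^ n"
    unfolding 1 2 by (simp add: algebra_simps)
  then have "to_fract [:- l1, 1:] * (to_fract B1 * to_fract A2) ^ n
      = to_fract [:- l2, 1:] * (to_fract A1 * to_fract B2) ^ n"
    using A B by (simp add: conv power_divide power_mult_distrib field_simps)
  then have "to_fract ([:- l1, 1:] * (B1 * A2) ^ n) = to_fract ([:- l2, 1:] * (A1 * B2) ^ n)"
    by (simp only: hom_mult[OF is_hom_to_fract] hom_power[OF is_hom_to_fract])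
  then have eq: "[:- l1, 1:] * (B1 * A2) ^ n = [:- l2, 1:] * (A1 * B2) ^ n"
    by (simp only: to_fract_eq_iff)
  have pow: "order l1 (p ^ n) = n * order l1 p" if "p \<noteq> 0" for p :: "'f poly"
    using that by (induction n) (simp_all add: order_mult)
  have o1: "order l1 [:- l1, 1:] = 1" using order_power_n_n[of l1 1] by simp
  have o2: "order l1 [:- l2, 1:] = 0" using l by (simp add: order_0I)
  have "order l1 ([:- l1, 1:] * (B1 * A2) ^ n) = 1 + n * order l1 (B1 * A2)"
    using nz A B by (subst order_mult) (simp_all add: o1 pow del: mult_pCons_left)
  moreover have "order l1 ([:- l2, 1:] * (A1 * B2) ^ n) = n * order l1 (A1 * B2)"
    using nz A B by (subst order_mult) (simp_all add: o2 pow del: mult_pCons_left)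
  ultimately have "1 + n * order l1 (B1 * A2) = n * order l1 (A1 * B2)" using eq by simp
  then have "n dvd 1" by (metis dvd_add_left_iff dvd_triv_left)
  then show False using n by simp
qed

text \<open>For a simple root \<open>l\<close> of \<open>p\<close>, the factor \<open>b - l\<close> of \<open>p(b)\<close> is coprime to the others. As \<open>N\<close> is
  greater than \<open>s\<close>, it is an \<open>n\<close>-th power up to a constant, where \<open>n\<close> is at least 2. The constant is
  the leading coefficient of \<open>b\<close>, the same for all roots, so the quotient of the values at 0 of two of
  these factors is an \<open>n\<close>-th power; but it is \<open>(Z - l1)/(Z - l2)\<close>.\<close>

lemma pcompose_not_power:
  fixes p :: "'f::field poly" and a b :: "'f poly fract poly"
  assumes roots: "l1 \<noteq> l2" "poly p l1 = 0" "poly p l2 = 0"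
    "poly (pderiv p) l1 \<noteq> 0" "poly (pderiv p) l2 \<noteq> 0"
    and b: "degree b > 0" "poly b 0 = to_fract [:0, 1:]"
    and Ns: "N > s" "s > 0" and f: "f \<noteq> 0"
    and eq: "pcompose (map_poly fconst p) b ^ s = smult f (a ^ N)"
  shows False
proof -
  define n where "n = N div gcd N s"
  have n: "n \<ge> 2"
  proof -
    have "gcd N s \<le> s" using Ns by (simp add: gcd_le2_nat)
    then have "gcd N s < N" using Ns by linarith
    moreover have "N = n * gcd N s" by (simp add: n_def)
    ultimately show ?thesis using Ns by (cases n; cases "n - 1") auto
  qed
  have p0: "p \<noteq> 0" using roots(4) by auto
  have inj: "g = 0" if "map_poly fconst g = 0" for g :: "'f poly"
  proof (rule poly_eqI)
    fix n
    have "fconst (coeff g n) = 0" using that coeff_map_hom[OF is_hom_fconst, of g n] by simp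
    then have "[:coeff g n:] = 0" by (simp only: to_fract_eq_0_iff)
    then show "coeff g n = coeff 0 n" by simp
  qed
  have a: "a \<noteq> 0"
  proof
    assume "a = 0"
    then have "pcompose (map_poly fconst p) b = 0" using eq Ns by (simp add: power_0_left)
    then have "map_poly fconst p = 0" using pcompose_eq_0 b(1) by blast
    then show False using inj p0 by blast
  qed
  have branch: "\<exists>A. to_fract [:- l, 1:] = lead_coeff b * A ^ n"
    if l: "poly p l = 0" "poly (pderiv p) l \<noteq> 0" for l
  proof -
    obtain S where S: "p = [:- l, 1:] * S" using l(1) by (metis poly_eq_0_iff_dvd dvdE)
    have "poly S l \<noteq> 0" using l(2) unfolding S pderiv_mult by (simp add: pderiv_pCons)
    define k where "k = poly S l"
    have "[:- l, 1:] dvd S - [:k:]" by (simp add: k_def flip: poly_eq_0_iff_dvd)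
    then obtain S1 where "S - [:k:] = [:- l, 1:] * S1" by (elim dvdE)
    then have S1: "S = [:- l, 1:] * S1 + [:k:]" by (simp add: algebra_simps)
    have k: "k \<noteq> 0" using \<open>poly S l \<noteq> 0\<close> by (simp add: k_def)
    define T where "T g = pcompose (map_poly fconst g) b" for g :: "'f poly"
    have hT: "is_hom T"
    proof -
      have "T = (\<lambda>g. ev (\<lambda>u. [:fconst u:]) b g)"
        by (simp add: T_def pcompose_altdef ev_def map_poly_map_poly hom_0 is_hom_fconst
            fun_eq_iff o_def)
      then show ?thesis
        using is_hom_ev[OF is_hom_comp[OF is_hom_const_poly is_hom_fconst]] by simp
    qed
    have Tl: "T [:- l, 1:] = b - [:fconst l:]" and Tc: "T [:k:] = [:fconst k:]"
      by (simp_all add: T_def map_poly_pCons hom_simps[OF is_hom_fconst] pcompose_pCons)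
    have T1: "T S = T [:- l, 1:] * T S1 + [:fconst k:]"
      unfolding Tc[symmetric] hom_mult[OF hT, symmetric] hom_add[OF hT, symmetric] S1[symmetric] ..
    have kk: "fconst k \<noteq> 0" using k by simp
    have "\<exists>\<alpha>. T [:- l, 1:] = smult (lead_coeff (T [:- l, 1:])) (\<alpha> ^ n)"
      unfolding n_def
    proof (rule coprime_factor_is_power)
      show "(T [:- l, 1:] * T S) ^ s = smult f (a ^ N)"
        unfolding hom_mult[OF hT, symmetric] S[symmetric] using eq by (simp only: T_def)
      show "(- smult (inverse (fconst k)) (T S1)) * T [:- l, 1:] + [:inverse (fconst k):] * T S = 1"
        unfolding T1 using kk by (simp add: algebra_simps one_pCons smult_add_right)
    qed (use f a Ns in auto)
    then obtain \<alpha> where \<alpha>: "b - [:fconst l:] = smult (lead_coeff (b - [:fconst l:])) (\<alpha> ^ n)"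
      unfolding Tl by blast
    have dg: "degree (b - [:fconst l:]) = degree b"
      unfolding diff_conv_add_uminus by (rule degree_add_eq_left) (use b(1) in simp)
    have "lead_coeff (b - [:fconst l:]) = lead_coeff b"
      unfolding dg using b(1) coeff_eq_0[of "[:fconst l:]" "degree b"] by simp
    then have "poly (b - [:fconst l:]) 0 = lead_coeff b * poly \<alpha> 0 ^ n"
      using \<alpha> by (metis poly_smult poly_power)
    moreover have "to_fract [:- l, 1:] = to_fract [:0, 1:] - fconst l"
      by (simp flip: to_fract_diff)
    ultimately show ?thesis using b(2) by auto
  qed
  obtain A B where "to_fract [:- l1, 1:] = lead_coeff b * A ^ n" "to_fract [:- l2, 1:] =
      lead_coeff b * B ^ n"
    using branch roots by blast
  then show False by (rule ratio_not_power[OF roots(1) n])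
qed

section \<open>Uniqueness of the ruling\<close>

text \<open>The substitution of \<open>X\<^sup>B\<close> for \<open>X\<close> and of \<open>X\<^sup>A U\<close> for the variable \<open>U\<close> of the polynomial
    ring. In the
  original coordinate this is the rescaling of \<open>U\<close> by the fractional power \<open>X\<^sup>A\<^sup>/\<^sup>B\<close>.\<close>

definition rescale :: "nat \<Rightarrow> int \<Rightarrow> 'a::field fls poly \<Rightarrow> 'a fls poly" where
  "rescale B A = ev (\<lambda>c. [:fls_compose_power c B:]) [:0, fls_X_intpow A:]"

lemma is_hom_compose_power: "B > 0 \<Longrightarrow> is_hom (\<lambda>c :: 'a::field fls. fls_compose_power c B)"
  by (intro is_homI) simp_all

lemma is_hom_rescale: "B > 0 \<Longrightarrow> is_hom (rescale B A)"
  unfolding rescale_def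
  by (intro is_hom_ev is_hom_comp[OF is_hom_const_poly] is_hom_compose_power)

lemma coeff_rescale:
  assumes B: "B > 0"
  shows "coeff (rescale B A F) j = fls_X_intpow (int j * A) * fls_compose_power (coeff F j) B"
proof (induction F arbitrary: j)
  case 0
  then show ?case by (simp add: hom_0[OF is_hom_rescale[OF B]])
next
  case (pCons c F)
  have eq: "rescale B A (pCons c F) = [:fls_compose_power c B:] + [:0, fls_X_intpow A:] * rescale B A F"
    unfolding rescale_def
    by (rule ev_pCons) (intro is_hom_comp[OF is_hom_const_poly] is_hom_compose_power B)
  show ?case
  proof (cases j)
    case 0
    then show ?thesis by (simp add: eq)
  next
    case (Suc i)
    have "coeff (rescale B A (pCons c F)) j
        = fls_X_intpow A * (fls_X_intpow (int i * A) * fls_compose_power (coeff F i) B)"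
      by (simp add: eq Suc pCons)
    also have "\<dots> = fls_X_intpow (int j * A) * fls_compose_power (coeff F i) B"
    proof -
      have "A + int i * A = int j * A" by (simp add: Suc distrib_right)
      then show ?thesis by (simp only: mult.assoc[symmetric] fls_X_intpow_times_fls_X_intpow)
    qed
    finally show ?thesis by (simp add: Suc)
  qed
qed

lemma coeff_rescale_nth:
  assumes B: "B > 0"
  shows "fls_nth (coeff (rescale B A F) j) n
    = (if int B dvd n - int j * A then fls_nth (coeff F j) ((n - int j * A) div int B) else 0)"
  unfolding coeff_rescale[OF B] using B
  by (simp add: fls_X_intpow_times_conv_shift fls_nth_compose_power)

lemma coeff_rescale_low:
  assumes B: "B > 0" and ord: "coeff F j \<noteq> 0 \<Longrightarrow> m \<le> int B * fls_subdegree (coeff F j) + int j * A"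
    and n: "n < m"
  shows "fls_nth (coeff (rescale B A F) j) n = 0"
proof (cases "int B dvd n - int j * A \<and> coeff F j \<noteq> 0")
  case True
  then obtain k where k: "n - int j * A = int B * k" by blast
  have "int B * k < int B * fls_subdegree (coeff F j)" using k n ord True by linarith
  then have "k < fls_subdegree (coeff F j)" using B by simp
  then show ?thesis unfolding coeff_rescale_nth[OF B] using k B by simp
next
  case False
  then show ?thesis unfolding coeff_rescale_nth[OF B] by auto
qed

lemma coeff_rescale_exact:
  assumes B: "B > 0" and "coeff F j \<noteq> 0"
  shows "fls_nth (coeff (rescale B A F) j) (int B * fls_subdegree (coeff F j) + int j * A) \<noteq> 0"
  unfolding coeff_rescale_nth[OF B] using assms by simp

text \<open>The smallest exponent \<open>A/B\<close> for which the rescaled \<open>F\<close> is still divisible by the rescaled \<open>X\<close>,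
  apart from the constant coefficient, and the rescaled \<open>G\<close> is integral. Being the smallest, it
  is attained, so that the reductions modulo \<open>X\<close> are not both constant.\<close>

lemma critical_slope:
  fixes F G :: "'a::field fls poly"
  assumes F: "degree F > 0"
  obtains A :: int and B :: nat where "B > 0"
    "\<And>j. j \<ge> 1 \<Longrightarrow> coeff F j \<noteq> 0 \<Longrightarrow> int B \<le> int B * fls_subdegree (coeff F j) + int j * A"
    "\<And>j. j \<ge> 1 \<Longrightarrow> coeff G j \<noteq> 0 \<Longrightarrow> 0 \<le> int B * fls_subdegree (coeff G j) + int j * A"
    "(coeff F B \<noteq> 0 \<and> int B = int B * fls_subdegree (coeff F B) + int B * A) \<or>
     (coeff G B \<noteq> 0 \<and> 0 = int B * fls_subdegree (coeff G B) + int B * A)"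
proof -
  define T where "T = (\<lambda>j. (1 - fls_subdegree (coeff F j), j)) ` {j. 1 \<le> j \<and> j \<le> degree F \<and> coeff
      F j \<noteq> 0}
    \<union> (\<lambda>j. (- fls_subdegree (coeff G j), j)) ` {j. 1 \<le> j \<and> j \<le> degree G \<and> coeff G j \<noteq> 0}"
  define slope where "slope t = (of_int (fst t) :: rat) / of_nat (snd t)" for t :: "int \<times> nat"
  have fin: "finite T" unfolding T_def by auto
  have "degree F \<in> {j. 1 \<le> j \<and> j \<le> degree F \<and> coeff F j \<noteq> 0}" using F by auto
  then have ne: "T \<noteq> {}" unfolding T_def by blast
  have "Max (slope ` T) \<in> slope ` T" using fin ne by simp
  then obtain t where t: "t \<in> T" "slope t = Max (slope ` T)" by auto
  define A B where "A = fst t" and "B = snd t"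
  have B: "B > 0" using t(1) unfolding T_def B_def by auto
  have le: "fst u * int B \<le> int (snd u) * A" if u: "u \<in> T" for u
  proof -
    have su: "snd u > 0" using u unfolding T_def by auto
    have "slope u \<le> slope t" using t(2) fin u by simp
    then have "(of_int (fst u) :: rat) * of_nat B \<le> of_int A * of_nat (snd u)"
      using B su by (simp add: slope_def A_def[symmetric] B_def[symmetric] field_simps)
    then have "(of_int (fst u * int B) :: rat) \<le> of_int (int (snd u) * A)"
      by (simp add: mult.commute)
    then show ?thesis by (simp only: of_int_le_iff)
  qed
  have "(A, B) \<in> T" using t by (simp add: A_def B_def)
  then have attained: "(coeff F B \<noteq> 0 \<and> A = 1 - fls_subdegree (coeff F B)) \<or>
     (coeff G B \<noteq> 0 \<and> A = - fls_subdegree (coeff G B))" unfolding T_def by auto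
  show thesis
  proof (rule that[OF B])
    fix j :: nat assume j: "j \<ge> 1" "coeff F j \<noteq> 0"
    then have "(1 - fls_subdegree (coeff F j), j) \<in> T" unfolding T_def by (auto intro: le_degree)
    from le[OF this] show "int B \<le> int B * fls_subdegree (coeff F j) + int j * A"
      by (simp add: algebra_simps)
  next
    fix j :: nat assume j: "j \<ge> 1" "coeff G j \<noteq> 0"
    then have "(- fls_subdegree (coeff G j), j) \<in> T" unfolding T_def by (auto intro: le_degree)
    from le[OF this] show "0 \<le> int B * fls_subdegree (coeff G j) + int j * A"
      by (simp add: algebra_simps)
  next
    show "(coeff F B \<noteq> 0 \<and> int B = int B * fls_subdegree (coeff F B) + int B * A) \<or>
     (coeff G B \<noteq> 0 \<and> 0 = int B * fls_subdegree (coeff G B) + int B * A)"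
      using attained by (auto simp flip: distrib_left)
  qed
qed

abbreviation fls_poly :: "'a::comm_ring_1 fps poly \<Rightarrow> 'a fls poly" where
  "fls_poly \<equiv> map_poly fps_to_fls"

abbreviation residue_poly :: "'a::comm_ring_1 fps poly \<Rightarrow> 'a poly" where
  "residue_poly \<equiv> map_poly (\<lambda>f. fps_nth f 0)"

lemma is_hom_fls_poly: "is_hom (fls_poly :: 'a::comm_ring_1 fps poly \<Rightarrow> _)"
  by (rule is_hom_map_poly[OF is_hom_fps_to_fls])

lemma is_hom_residue_poly: "is_hom (residue_poly :: 'a::comm_ring_1 fps poly \<Rightarrow> _)"
  by (rule is_hom_map_poly[OF is_hom_fps_nth_0])

lemma fls_poly_inj: "fls_poly a = fls_poly b \<Longrightarrow> a = b"
  by (simp add: poly_eq_iff coeff_map_hom is_hom_fps_to_fls)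

lemma integral_poly:
  fixes F :: "'a::field fls poly"
  assumes "\<And>j n. n < int m \<Longrightarrow> fls_nth (coeff F j) n = 0"
  shows "\<exists>F'. F = smult (fls_X ^ m) (fls_poly F') \<and>
    (\<forall>j. fps_nth (coeff F' j) 0 = fls_nth (coeff F j) (int m))"
proof (intro exI conjI allI)
  let ?F = "map_poly (\<lambda>f. fls_regpart (fls_shift (int m) f)) F"
  have c: "coeff ?F j = fls_regpart (fls_shift (int m) (coeff F j))" for j
    by (simp add: coeff_map_poly)
  show "F = smult (fls_X ^ m) (fls_poly ?F)"
  proof (rule poly_eqI)
    fix j
    have "0 \<le> fls_subdegree (fls_shift (int m) (coeff F j))"
      by (rule fls_subdegree_ge0I) (use assms in simp)
    then have "coeff (smult (fls_X ^ m) (fls_poly ?F)) j = fls_X ^ m * fls_shift (int m) (coeff F j)"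
      by (simp add: coeff_map_hom is_hom_fps_to_fls c)
    also have "\<dots> = coeff F j"
      by (simp add: fls_X_power_times_conv_shift)
    finally show "coeff F j = coeff (smult (fls_X ^ m) (fls_poly ?F)) j" by simp
  qed
  show "fps_nth (coeff ?F j) 0 = fls_nth (coeff F j) (int m)" for j by (simp add: c)
qed

text \<open>Gauss's lemma for the valuation ring of formal power series.\<close>

lemma gauss_integral:
  fixes c :: "'a::field fls poly"
  assumes ac: "fls_poly a * c = fls_poly w" and a: "residue_poly a \<noteq> 0"
  shows "\<exists>c'. c = fls_poly c'"
proof -
  have "\<exists>k c'. smult (fls_X ^ k) c = fls_poly c'"
  proof -
    define S where "S = (\<lambda>j. nat (- fls_subdegree (coeff c j))) ` {..degree c}"
    define k where "k = Max S"
    have k: "- fls_subdegree (coeff c j) \<le> int k" if "coeff c j \<noteq> 0" for j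
    proof -
      have "nat (- fls_subdegree (coeff c j)) \<in> S" unfolding S_def using that le_degree by blast
      then have "nat (- fls_subdegree (coeff c j)) \<le> k" unfolding k_def S_def by (intro Max_ge) auto
      then show ?thesis by linarith
    qed
    have "\<exists>F'. smult (fls_X ^ k) c = smult (fls_X ^ 0) (fls_poly F') \<and>
      (\<forall>j. fps_nth (coeff F' j) 0 = fls_nth (coeff (smult (fls_X ^ k) c) j) (int 0))"
    proof (rule integral_poly)
      fix j n assume n: "n < int 0"
      show "fls_nth (coeff (smult (fls_X ^ k) c) j) n = 0"
        using n k[of j] by (cases "coeff c j = 0") (auto simp: fls_X_power_times_conv_shift)
    qed
    then show ?thesis by auto
  qed
  then obtain k c' where "smult (fls_X ^ k) c = fls_poly c'" by blast
  then show ?thesis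
  proof (induction k arbitrary: c')
    case 0
    then show ?case by auto
  next
    case (Suc k)
    have "fls_poly (a * c') = fls_poly (smult (fps_X ^ Suc k) w)"
      by (simp add: hom_mult[OF is_hom_fls_poly] Suc.prems[symmetric] ac[symmetric] map_poly_smult
          fls_times_fps_to_fls fps_to_fls_power)
    then have "a * c' = smult (fps_X ^ Suc k) w" by (rule fls_poly_inj)
    then have "residue_poly a * residue_poly c' = residue_poly (smult (fps_X ^ Suc k) w)"
      by (simp flip: hom_mult[OF is_hom_residue_poly])
    also have "\<dots> = 0" by (simp add: map_poly_smult)
    finally have "residue_poly c' = 0" using a by simp
    then have c0: "fps_nth (coeff c' j) 0 = 0" for j
      using coeff_map_hom[OF is_hom_fps_nth_0, of c' j] by simp
    have "c' = smult fps_X (map_poly (fps_shift 1) c')"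
    proof (rule poly_eqI)
      fix j
      have "coeff c' j = fps_X * fps_shift 1 (coeff c' j)"
        by (rule fps_ext) (use c0 in \<open>auto simp: fps_X_mult_nth\<close>)
      then show "coeff c' j = coeff (smult fps_X (map_poly (fps_shift 1) c')) j"
        by (simp add: coeff_map_poly)
    qed
    then obtain c'' where c'': "c' = smult fps_X c''" by blast
    have "smult fls_X (smult (fls_X ^ k) c) = smult fls_X (fls_poly c'')"
      using Suc.prems unfolding c'' by (simp add: map_poly_smult fls_times_fps_to_fls)
    then have "smult (fls_X ^ k) c = fls_poly c''"
      by (metis fls_X_nonzero smult_eq_iff inverse_eq_divide smult_smult left_inverse smult_1_left)
    then show ?case by (rule Suc.IH)
  qed
qed

lemma ev2_zero:
  assumes "is_hom c"
  shows "ev2 c 0 z b = ev c z (P_at0 b)"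
proof -
  have "ev c 0 = (\<lambda>a. c (poly a 0))"
  proof
    fix a show "ev c 0 a = c (poly a 0)"
      by (induction a) (simp_all add: ev_0 ev_pCons assms hom_0)
  qed
  moreover have "ev c z (map_poly f b) = ev (\<lambda>u. c (f u)) z b" if "is_hom f" for f :: "'a poly \<Rightarrow> 'a"
    by (induction b) (simp_all add: map_poly_pCons ev_0 ev_pCons hom_0 is_hom_comp assms that)
  ultimately show ?thesis by (simp add: P_at0_def is_hom_poly)
qed

context danielewski
begin

lemma pderiv_P_at0: "P_at0 (pderiv b) = pderiv (P_at0 b)"
  by (rule poly_eqI) (simp add: coeff_P_at0 coeff_pderiv coeff_mult_0 of_nat_poly)

lemma hom_of_nat: "is_hom h \<Longrightarrow> h (of_nat n) = of_nat n"
  by (induction n) (simp_all add: hom_0 hom_1 hom_add)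

lemma pderiv_emb: "emb (pderiv b) = pderiv (emb b)"
  by (rule poly_eqI)
    (simp add: coeff_map_hom hom_\<iota> coeff_pderiv hom_mult hom_add hom_1 hom_of_nat)

text \<open>Since \<open>P(0,Z)\<close> and its derivative generate the unit ideal, all roots are simple, and there are at
  least two of them as the degree is at least two.\<close>

lemma P0_two_simple_roots:
  obtains l1 l2 where "l1 \<noteq> l2" "poly (emb P0) l1 = 0" "poly (emb P0) l2 = 0"
    "poly (pderiv (emb P0)) l1 \<noteq> 0" "poly (pderiv (emb P0)) l2 \<noteq> 0"
proof -
  obtain u v where "u * P0 + v * pderiv P0 = 1" using unit_P by (auto simp: P0_def pderiv_P_at0)
  then have "emb (u * P0 + v * pderiv P0) = 1" using hom_1[OF is_hom_emb] by simp
  then have uv: "emb u * emb P0 + emb v * pderiv (emb P0) = 1"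
    by (simp only: hom_add[OF is_hom_emb] hom_mult[OF is_hom_emb] pderiv_emb)
  have simple: "poly (pderiv (emb P0)) l \<noteq> 0" if "poly (emb P0) l = 0" for l
  proof
    assume "poly (pderiv (emb P0)) l = 0"
    then have "poly (emb u * emb P0 + emb v * pderiv (emb P0)) l = 0" using that by simp
    then show False unfolding uv by simp
  qed
  have deg: "degree (emb P0) > 1" using deg_P by (simp add: deg_emb deg_P0)
  then obtain l1 where l1: "poly (emb P0) l1 = 0" using alg_closed_imp_poly_has_root[of "emb P0"] by auto
  then obtain S where S: "emb P0 = [:- l1, 1:] * S" by (metis poly_eq_0_iff_dvd dvdE)
  have "degree S > 0"
  proof -
    have "S \<noteq> 0" using S deg by auto
    then have "degree (emb P0) = 1 + degree S" unfolding S by (subst degree_mult_eq) auto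
    then show ?thesis using deg by simp
  qed
  then obtain l2 where l2: "poly S l2 = 0" using alg_closed_imp_poly_has_root by blast
  have "l1 \<noteq> l2"
  proof
    assume "l1 = l2"
    then have "poly (pderiv (emb P0)) l1 = 0" unfolding S pderiv_mult using l2 by (simp add:
        pderiv_pCons)
    then show False using simple l1 by blast
  qed
  moreover have "poly (emb P0) l2 = 0" unfolding S using l2 by simp
  ultimately show thesis using that l1 simple by blast
qed

text \<open>Common factors \<open>X\<close> of numerator and denominator are cancelled.\<close>

lemma reduced_form:
  "\<exists>m b. mX ^ m * model d e p = mbed b \<and> (m = 0 \<or> P_at0 b \<noteq> 0)"
proof -
  obtain n a where "vX ^ n * p - [:[:a:]:] \<in> B_ideal d e P Q" using clear_denominators by blast
  then have "model d e (vX ^ n * p - [:[:a:]:]) = 0" by (rule model_ideal)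
  then have "mX ^ n * model d e p = mbed a"
    by (simp only: hom_simps[OF is_hom_model] model_simps(2) model_simps(6)[of d e a]) simp
  then show ?thesis
  proof (induction n arbitrary: a)
    case 0
    then show ?case by blast
  next
    case (Suc n)
    show ?case
    proof (cases "P_at0 a = 0")
      case True
      have "[:[:0, 1:]:] dvd a"
        by (rule map_poly_kernel_multiples[OF is_hom_poly[of 0]])
          (use True in \<open>auto simp: P_at0_def poly_eq_0_iff_dvd\<close>)
      then obtain a' where a': "a = [:[:0, 1:]:] * a'" by (elim dvdE)
      have "mbed [:[:0, 1:]:] = mX" by (simp add: mbed_def ev_const ev_var is_hom_ev is_hom_\<kappa>)
      then have "mX * (mX ^ n * model d e p) = mX * mbed a'"
        using Suc.prems unfolding a' hom_mult[OF is_hom_mbed] by (simp add: mult.assoc)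
      then have "mX ^ n * model d e p = mbed a'" by simp
      then show ?thesis by (rule Suc.IH)
    next
      case False
      then show ?thesis using Suc.prems by blast
    qed
  qed
qed

text \<open>The structure map of \<open>F(Z)[U]\<close>, the ring in which the reductions modulo \<open>X\<close> live.\<close>

definition residue_const :: "'r \<Rightarrow> 'f poly fract poly" where
  "residue_const r = [:fconst (\<iota> r):]"

lemma is_hom_residue_const: "is_hom residue_const"
  unfolding residue_const_def
  by (intro is_hom_comp[OF is_hom_const_poly] is_hom_comp[OF is_hom_fconst] hom_\<iota>)

lemma ev_residue_const: "ev residue_const b g = pcompose (map_poly fconst (emb g)) b"
  unfolding pcompose_altdef ev_def residue_const_def
  by (simp add: map_poly_map_poly hom_0 is_hom_fconst hom_\<iota> o_def)

lemma degree_ev_residue_const: "degree (ev residue_const b g) = degree g * degree b"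
proof -
  have "degree (map_poly fconst (emb g)) = degree (emb g)"
    by (rule degree_map_poly) auto
  then show ?thesis by (simp add: ev_residue_const degree_pcompose deg_emb)
qed

text \<open>The situation after the reduction modulo \<open>X\<close> of a critical deformation: \<open>a\<close>, \<open>b\<close>, \<open>f\<close> come from
  \<open>X\<close>, \<open>z\<close>, \<open>t\<close>, and an invariant function with pole order \<open>m\<close> and leading coefficient \<open>g\<close> gives the
  second relation. Comparing degrees in \<open>U\<close> in the two relations, the bound on \<open>m\<close> makes \<open>f\<close>
  constant; then \<open>P(0,b)\<^sup>s\<close> is a constant multiple of the \<open>N\<close>-th power of \<open>a\<close>.\<close>

lemma residue_contradiction:
  assumes ab: "degree a > 0 \<or> degree b > 0" "poly a 0 \<noteq> 0" "poly b 0 = to_fract [:0, 1:]"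
    and t: "a ^ weight_T d e * f = ev residue_const b (smult q (P0 ^ sQ))"
    and g: "smult k (a ^ m) = ev residue_const b g" "k \<noteq> 0" "degree g > 0"
    and m: "m * (rP * sQ) \<le> degree g * weight_T d e" and de: "d \<ge> 1" "e \<ge> 1"
  shows False
proof -
  let ?N = "weight_T d e"
  have a: "a \<noteq> 0" using ab(2) by auto
  have rhs: "degree (ev residue_const b (smult q (P0 ^ sQ))) = sQ * rP * degree b"
    using q_nonzero P0_nonzero by (simp add: degree_ev_residue_const degree_power_eq deg_P0)
  have nz: "ev residue_const b (smult q (P0 ^ sQ)) \<noteq> 0"
  proof (cases "degree b = 0")
    case True
    then have b: "b = [:to_fract [:0, 1:]:]" using ab(3) by (metis degree_eq_zeroE poly_pCons
        mult_zero_left add.right_neutral)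
    have "ev residue_const b u = [:to_fract (emb u):]" for u
      unfolding b
    proof (induction u)
      case (pCons c u)
      have "ev residue_const [:to_fract [:0, 1:]:] (pCons c u)
          = residue_const c + [:to_fract [:0, 1:]:] * [:to_fract (emb u):]"
        by (simp only: ev_pCons[OF is_hom_residue_const] pCons.IH)
      also have "\<dots> = [:fconst (\<iota> c) + to_fract [:0, 1:] * to_fract (emb u):]"
        by (simp add: residue_const_def)
      also have "fconst (\<iota> c) + to_fract [:0, 1:] * to_fract (emb u) = to_fract ([:\<iota> c:] + [:0,
          1:] * emb u)"
        by (simp only: hom_add[OF is_hom_to_fract] hom_mult[OF is_hom_to_fract])
      also have "[:\<iota> c:] + [:0, 1:] * emb u = emb (pCons c u)"
        by (simp add: map_poly_pCons hom_0 hom_\<iota>)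
      finally show ?case .
    qed (simp add: ev_0[OF is_hom_residue_const])
    then show ?thesis using q_nonzero P0_nonzero by (simp add: map_\<iota>_eq_0)
  next
    case False
    then have "degree (ev residue_const b (smult q (P0 ^ sQ))) > 0"
      unfolding rhs using deg_P deg_Q by simp
    then show ?thesis by force
  qed
  then have f: "f \<noteq> 0" using t by auto
  have dt: "?N * degree a + degree f = sQ * rP * degree b"
    using arg_cong[OF t, of degree] a f by (simp add: rhs degree_mult_eq degree_power_eq)
  have dm: "m * degree a = degree g * degree b"
    using arg_cong[OF g(1), of degree] g(2) a by (simp add: degree_ev_residue_const degree_power_eq)
  have db: "degree b > 0"
  proof (rule ccontr)
    assume "\<not> degree b > 0"
    then show False using dt ab(1) de by simp
  qed
  have m0: "m > 0" using dm db g(3) by (cases m) auto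
  have "m * degree f + degree g * degree b * ?N = m * (rP * sQ) * degree b"
  proof -
    have "m * degree f + degree g * degree b * ?N = m * (?N * degree a + degree f)"
      unfolding dm[symmetric] by (simp add: algebra_simps)
    then show ?thesis unfolding dt by (simp add: algebra_simps)
  qed
  also have "\<dots> \<le> degree g * ?N * degree b" using m by (rule mult_right_mono) simp
  finally have "m * degree f \<le> 0" by (simp add: algebra_simps)
  then have "degree f = 0" using m0 by simp
  then obtain f0 where f0: "f = [:f0:]" by (rule degree_eq_zeroE)
  have f00: "f0 \<noteq> 0" using f f0 by auto
  have q0: "fconst (\<iota> q) \<noteq> 0" using q_nonzero inj_\<iota> by auto
  have "ev residue_const b (smult q (P0 ^ sQ)) = residue_const q * ev residue_const b P0 ^ sQ"
  proof -
    have "smult q (P0 ^ sQ) = [:q:] * P0 ^ sQ" by simp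
    then show ?thesis
      using hom_mult[OF is_hom_ev[OF is_hom_residue_const], of b "[:q:]" "P0 ^ sQ"]
        hom_power[OF is_hom_ev[OF is_hom_residue_const], of b P0 sQ]
      by (simp only: ev_const[OF is_hom_residue_const])
  qed
  then have "smult f0 (a ^ ?N) = smult (fconst (\<iota> q)) (ev residue_const b P0 ^ sQ)"
    using t unfolding f0 by (simp add: residue_const_def)
  then have "smult (inverse (fconst (\<iota> q))) (smult f0 (a ^ ?N))
      = smult (inverse (fconst (\<iota> q))) (smult (fconst (\<iota> q)) (ev residue_const b P0 ^ sQ))" by simp
  also have "\<dots> = ev residue_const b P0 ^ sQ" using q0 by simp
  finally have pw: "pcompose (map_poly fconst (emb P0)) b ^ sQ = smult (inverse (fconst (\<iota> q)) *
      f0) (a ^ ?N)"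
    by (simp add: ev_residue_const)
  \<comment> \<open>\<open>b\<close> is not constant, so the two roots give powers with the same leading coefficient.\<close>
  obtain l1 l2 where l: "l1 \<noteq> l2" "poly (emb P0) l1 = 0" "poly (emb P0) l2 = 0"
    "poly (pderiv (emb P0)) l1 \<noteq> 0" "poly (pderiv (emb P0)) l2 \<noteq> 0" by (rule P0_two_simple_roots)
  have N: "?N > sQ"
  proof -
    have "sQ * 1 \<le> sQ * d" using de by (intro mult_left_mono) (use de in auto)
    then have "sQ \<le> sQ * d" by (simp only: mult_1_right)
    then show ?thesis using de(2) by linarith
  qed
  show False
    by (rule pcompose_not_power[OF l db ab(3) N _ _ pw]) (use deg_Q q0 f00 in auto)
qed

end

context danielewski
begin

text \<open>If the deformation \<open>\<phi>\<close> of the inclusion moved \<open>X\<close>, rescaling its parameter with the critical slope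
  would make it integral, with a non-trivial reduction modulo \<open>X\<close>, and the preceding lemma applies once
  the leading coefficient of the invariant function \<open>gp\<close> is known not to be constant. If \<open>gp\<close> has a
  pole, this follows from the bound on pole orders. Otherwise \<open>gp\<close> minus a constant would be a
  multiple of \<open>X\<close>, and a divisor of a non-zero invariant function is invariant.\<close>

lemma deformation_fixes_X:
  assumes de: "d \<ge> 1" "e \<ge> 1" and \<phi>: "is_hom \<phi>" "\<And>p. model d e p = 0 \<Longrightarrow> \<phi> p = 0"
    "\<And>r. \<phi> (const4 r) = [:\<kappa> r:]" "\<And>p. coeff (\<phi> p) 0 = model d e p"
    and gp: "\<phi> gp = [:model d e gp:]" "\<And>r. model d e gp \<noteq> \<kappa> r"
  shows "\<phi> vX = [:mX:]"
proof (rule ccontr)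
  assume moved: "\<phi> vX \<noteq> [:mX:]"
  let ?N = "weight_T d e"
  have X0: "coeff (\<phi> vX) 0 = mX" and Z0: "coeff (\<phi> vZ) 0 = mZ"
    by (simp_all only: \<phi>(4) model_simps(2,3))
  have degX: "degree (\<phi> vX) > 0"
  proof (rule ccontr)
    assume "\<not> degree (\<phi> vX) > 0"
    then obtain c where "\<phi> vX = [:c:]" using degree_eq_zeroE by blast
    then show False using X0 moved by simp
  qed
  obtain m b where mb: "mX ^ m * model d e gp = mbed b" "m = 0 \<or> P_at0 b \<noteq> 0"
    using reduced_form by blast
  let ?D = "degree (P_at0 b)"
  have D: "?D > 0"
  proof (cases "m = 0")
    case True
    show ?thesis
    proof (rule ccontr)
      assume "\<not> ?D > 0"
      then obtain c where c: "P_at0 b = [:c:]" using degree_eq_zeroE by blast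
      have "[:[:0, 1:]:] dvd b - [:[:c:]:]"
        by (rule map_poly_kernel_multiples[OF is_hom_poly[of 0]])
          (use c in \<open>auto simp: poly_eq_0_iff_dvd hom_diff[OF is_hom_map_poly[OF is_hom_poly]]
              P_at0_def map_poly_pCons\<close>)
      then obtain b' where b': "b - [:[:c:]:] = [:[:0, 1:]:] * b'" by (elim dvdE)
      have "mbed (b - [:[:c:]:]) = mbed ([:[:0, 1:]:] * b')" by (simp only: b')
      then have eq: "model d e gp - \<kappa> c = mX * mbed b'"
        using mb(1) True unfolding hom_diff[OF is_hom_mbed] hom_mult[OF is_hom_mbed]
        by (simp add: mbed_def ev_const ev_var is_hom_ev is_hom_\<kappa>)
      have "model d e (gp - const4 c - vX * [:[:b':]:]) = 0"
        by (simp only: hom_diff[OF is_hom_model] hom_mult[OF is_hom_model] model_simps(1,2)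
            model_simps(6)[of d e b'] eq diff_self)
      then have "\<phi> (gp - const4 c - vX * [:[:b':]:]) = 0" by (rule \<phi>(2))
      then have prod: "[:model d e gp - \<kappa> c:] = \<phi> vX * \<phi> [:[:b':]:]"
        by (simp only: hom_diff[OF \<phi>(1)] hom_mult[OF \<phi>(1)] \<phi>(3) gp(1)) simp
      have "[:model d e gp - \<kappa> c:] \<noteq> 0" using gp(2) by simp
      then have "\<phi> vX \<noteq> 0" "\<phi> [:[:b':]:] \<noteq> 0" unfolding prod by auto
      then have "degree (\<phi> vX) + degree (\<phi> [:[:b':]:]) = degree [:model d e gp - \<kappa> c:]"
        unfolding prod by (rule degree_mult_eq[symmetric])
      then have "degree (\<phi> vX) = 0" by simp
      then show False using degX by simp
    qed
  next
    case False
    then have "m \<le> (?D div rP) * d + (?D div (rP * sQ)) * e"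
      using pole_bound[OF de(1) mb(1)] mb(2) by blast
    then show ?thesis using False by (cases "?D = 0") auto
  qed
  then have b0: "P_at0 b \<noteq> 0" by auto
  have mN: "m * (rP * sQ) \<le> ?D * ?N"
  proof -
    have "m \<le> (?D div rP) * d + (?D div (rP * sQ)) * e" by (rule pole_bound[OF de(1) mb(1) b0])
    then have "m * (rP * sQ) \<le> ((?D div rP) * d + (?D div (rP * sQ)) * e) * (rP * sQ)"
      by (rule mult_right_mono) simp
    also have "\<dots> = (?D div rP * rP) * (d * sQ) + (?D div (rP * sQ) * (rP * sQ)) * e"
      by (simp add: algebra_simps)
    also have "\<dots> \<le> ?D * (d * sQ) + ?D * e"
      by (intro add_mono mult_right_mono div_times_less_eq_dividend) auto
    finally show ?thesis by (simp add: algebra_simps)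
  qed
  obtain A :: int and B :: nat where B: "B > 0"
    and slX: "\<And>j. j \<ge> 1 \<Longrightarrow> coeff (\<phi> vX) j \<noteq> 0 \<Longrightarrow> int B \<le> int B * fls_subdegree (coeff (\<phi> vX) j) +
        int j * A"
    and slZ: "\<And>j. j \<ge> 1 \<Longrightarrow> coeff (\<phi> vZ) j \<noteq> 0 \<Longrightarrow> 0 \<le> int B * fls_subdegree (coeff (\<phi> vZ) j) + int j * A"
    and attained: "(coeff (\<phi> vX) B \<noteq> 0 \<and> int B = int B * fls_subdegree (coeff (\<phi> vX) B) + int B * A) \<or>
     (coeff (\<phi> vZ) B \<noteq> 0 \<and> 0 = int B * fls_subdegree (coeff (\<phi> vZ) B) + int B * A)"
    using critical_slope[OF degX, of "\<phi> vZ"] by metis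
  define \<psi> where "\<psi> u = rescale B A (\<phi> u)" for u
  have h\<psi>: "is_hom \<psi>" unfolding \<psi>_def by (rule is_hom_comp[OF is_hom_rescale[OF B] \<phi>(1)])
  note s\<psi> = hom_simps[OF h\<psi>]
  have \<psi>_const: "\<psi> u = [:fls_compose_power c B:]" if "\<phi> u = [:c:]" for u c
    unfolding \<psi>_def that rescale_def
    by (rule ev_const) (intro is_hom_comp[OF is_hom_const_poly] is_hom_compose_power B)
  have \<psi>_ker: "\<psi> u = 0" if "model d e u = 0" for u
    using \<psi>_const[of u 0] \<phi>(2)[OF that] by simp
  have slX': "int B \<le> int B * fls_subdegree (coeff (\<phi> vX) j) + int j * A" if "coeff (\<phi> vX) j \<noteq> 0" for j
    using slX[OF _ that] X0 by (cases "j = 0") auto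
  have slZ': "0 \<le> int B * fls_subdegree (coeff (\<phi> vZ) j) + int j * A" if "coeff (\<phi> vZ) j \<noteq> 0" for j
    using slZ[OF _ that] Z0 by (cases "j = 0") (auto simp: mZ_def)
  obtain a' where a': "\<psi> vX = smult (fls_X ^ B) (fls_poly a')"
    "\<And>j. fps_nth (coeff a' j) 0 = fls_nth (coeff (\<psi> vX) j) (int B)"
    using integral_poly[of B "\<psi> vX"] coeff_rescale_low[OF B slX'] unfolding \<psi>_def by metis
  obtain b' where "\<psi> vZ = smult (fls_X ^ 0) (fls_poly b')"
    and b'0: "\<And>j. fps_nth (coeff b' j) 0 = fls_nth (coeff (\<psi> vZ) j) (int 0)"
    using integral_poly[of 0 "\<psi> vZ"] coeff_rescale_low[OF B slZ'] unfolding \<psi>_def by (metis of_nat_0)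
  then have b': "\<psi> vZ = fls_poly b'" by simp
  define ra rb where "ra = residue_poly a'" and "rb = residue_poly b'"
  have cra: "coeff ra j = fls_nth (coeff (\<psi> vX) j) (int B)" for j
    unfolding ra_def coeff_map_hom[OF is_hom_fps_nth_0] a'(2) ..
  have crb: "coeff rb j = fls_nth (coeff (\<psi> vZ) j) 0" for j
    unfolding rb_def coeff_map_hom[OF is_hom_fps_nth_0] b'0 by simp
  have ra0: "poly ra 0 = 1"
    unfolding poly_0_coeff_0 cra unfolding \<psi>_def coeff_rescale_nth[OF B] X0 using B by simp
  have rb0: "poly rb 0 = to_fract [:0, 1:]"
    unfolding poly_0_coeff_0 crb unfolding \<psi>_def coeff_rescale_nth[OF B] Z0 using B by (simp add: mZ_def)
  have moved': "degree ra > 0 \<or> degree rb > 0"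
    using attained
  proof
    assume *: "coeff (\<phi> vX) B \<noteq> 0 \<and> int B = int B * fls_subdegree (coeff (\<phi> vX) B) + int B * A"
    then have "coeff ra B \<noteq> 0"
      unfolding cra \<psi>_def using coeff_rescale_exact[OF B, of "\<phi> vX" B A] by metis
    then show ?thesis using le_degree[of ra B] B by simp
  next
    assume *: "coeff (\<phi> vZ) B \<noteq> 0 \<and> 0 = int B * fls_subdegree (coeff (\<phi> vZ) B) + int B * A"
    then have "coeff rb B \<noteq> 0"
      unfolding crb \<psi>_def using coeff_rescale_exact[OF B, of "\<phi> vZ" B A] by metis
    then show ?thesis using le_degree[of rb B] B by simp
  qed
  define c' :: "'r \<Rightarrow> 'f poly fract fps poly" where "c' r = [:fps_const (fconst (\<iota> r)):]" for r
  have hc': "is_hom c'"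
    unfolding c'_def
    by (intro is_hom_comp[OF is_hom_const_poly] is_hom_comp[OF is_hom_fps_const]
        is_hom_comp[OF is_hom_fconst] hom_\<iota>)
  define W where "W u = ev2 c' (smult (fps_X ^ B) a') b' u" for u
  have \<psi>W: "\<psi> [:[:u:]:] = fls_poly (W u)" for u
  proof -
    have 1: "\<psi> (const4 r) = fls_poly (c' r)" for r
      using \<psi>_const[OF \<phi>(3)] B by (simp add: \<kappa>_def c'_def map_poly_pCons)
    have 2: "\<psi> vX = fls_poly (smult (fps_X ^ B) a')"
      unfolding a'(1)
      by (rule poly_eqI) (simp add: coeff_map_hom is_hom_fps_to_fls hom_mult[OF is_hom_fps_to_fls]
          fps_to_fls_power)
    have "\<psi> [:[:u:]:] = \<psi> (ev2 const4 vX vZ u)" by (simp only: ev2_self)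
    also have "\<dots> = ev2 (\<lambda>r. \<psi> (const4 r)) (\<psi> vX) (\<psi> vZ) u" by (rule hom_ev2[OF h\<psi> is_hom_const4])
    also have "\<dots> = fls_poly (W u)"
      unfolding 1 2 b' W_def by (rule hom_ev2[OF is_hom_fls_poly hc', symmetric])
    finally show ?thesis .
  qed
  have resW: "residue_poly (W u) = ev residue_const rb (P_at0 u)" for u
  proof -
    have 1: "residue_poly (c' r) = residue_const r" for r
      by (simp add: c'_def residue_const_def map_poly_pCons)
    have 2: "residue_poly (smult (fps_X ^ B) a') = 0"
      by (rule poly_eqI) (use B in \<open>simp add: coeff_map_hom is_hom_fps_nth_0 zero_power\<close>)
    have "residue_poly (W u) = ev2 (\<lambda>r. residue_poly (c' r)) (residue_poly (smult (fps_X ^ B) a')) rb u"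
      unfolding W_def rb_def by (rule hom_ev2[OF is_hom_residue_poly hc'])
    also have "\<dots> = ev2 residue_const 0 rb u" unfolding 1 2 ..
    also have "\<dots> = ev residue_const rb (P_at0 u)" by (rule ev2_zero[OF is_hom_residue_const])
    finally show ?thesis .
  qed
  \<comment> \<open>The factor \<open>X\<close> of the rescaled deformation is moved to the other factor, to be absorbed there.\<close>
  have powX: "(\<psi> vX) ^ k * v = fls_poly (a' ^ k) * smult (fls_X ^ (B * k)) v" for k v
    unfolding a'(1) hom_power[OF is_hom_fls_poly] smult_power power_mult by simp
  have T_rel: "\<exists>f. ra ^ ?N * f = ev residue_const rb (smult q (P0 ^ sQ))"
  proof -
    have "mX ^ ?N * mT d e = mbed (hQ d)"
      using hQ_ev[OF is_hom_\<kappa> solution_model] by (simp add: mbed_def)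
    then have "model d e (vX ^ ?N * vT - [:[:hQ d:]:]) = 0"
      by (simp only: hom_simps[OF is_hom_model] model_simps(2,5) model_simps(6)[of d e "hQ d"] diff_self)
    then have "\<psi> (vX ^ ?N * vT - [:[:hQ d:]:]) = 0" by (rule \<psi>_ker)
    then have "\<psi> vX ^ ?N * \<psi> vT = fls_poly (W (hQ d))"
      by (simp only: s\<psi> \<psi>W) simp
    then have eq: "fls_poly (a' ^ ?N) * smult (fls_X ^ (B * ?N)) (\<psi> vT) = fls_poly (W (hQ d))"
      unfolding powX .
    have "ra \<noteq> 0" using ra0 by auto
    then have "residue_poly (a' ^ ?N) \<noteq> 0" by (simp add: hom_power[OF is_hom_residue_poly] ra_def)
    then obtain f' where f': "smult (fls_X ^ (B * ?N)) (\<psi> vT) = fls_poly f'"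
      using gauss_integral[OF eq] by blast
    have "fls_poly (a' ^ ?N * f') = fls_poly (W (hQ d))"
      using eq unfolding f' hom_mult[OF is_hom_fls_poly] .
    then have "a' ^ ?N * f' = W (hQ d)" by (rule fls_poly_inj)
    then have "residue_poly (a' ^ ?N * f') = ev residue_const rb (P_at0 (hQ d))" using resW by simp
    then show ?thesis
      unfolding hQ_at0[OF de(1)] hom_mult[OF is_hom_residue_poly] hom_power[OF is_hom_residue_poly]
        ra_def[symmetric] by blast
  qed
  then obtain f where f: "ra ^ ?N * f = ev residue_const rb (smult q (P0 ^ sQ))" by blast
  define k where "k = to_fract (emb (P_at0 b))"
  have k: "k \<noteq> 0" using b0 by (simp add: k_def map_\<iota>_eq_0)
  have g_rel: "smult k (ra ^ m) = ev residue_const rb (P_at0 b)"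
  proof -
    have "model d e (vX ^ m * gp - [:[:b:]:]) = 0"
      by (simp only: hom_simps[OF is_hom_model] model_simps(2) model_simps(6)[of d e b] mb(1) diff_self)
    then have "\<psi> (vX ^ m * gp - [:[:b:]:]) = 0" by (rule \<psi>_ker)
    then have "\<psi> vX ^ m * \<psi> gp = fls_poly (W b)" by (simp only: s\<psi> \<psi>W) simp
    then have "fls_poly (a' ^ m) * smult (fls_X ^ (B * m)) [:fls_compose_power (model d e gp) B:]
        = fls_poly (W b)"
      unfolding powX \<psi>_const[OF gp(1)] .
    moreover define h where "h = fls_X ^ (B * m) * fls_compose_power (model d e gp) B"
    ultimately have eq: "fls_poly (a' ^ m) * [:h:] = fls_poly (W b)" by simp
    have cX: "fls_compose_power mX B = mX ^ B" using B by (simp add: fls_X_power_conv_shift_1)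
    have "fls_compose_power (mX ^ m * model d e gp) B = (mX ^ B) ^ m * fls_compose_power (model d
        e gp) B"
      unfolding fls_compose_power_mult by (simp only: fls_compose_power_power[OF disjI1[OF B]] cX)
    then have "h = fls_compose_power (mX ^ m * model d e gp) B" unfolding h_def power_mult by (rule sym)
    then have h: "h = fls_compose_power (mbed b) B" unfolding mb(1) .
    have "fls_nth h n = 0" if "n < 0" for n
      unfolding h fls_nth_compose_power[OF B] using that B
      by (auto intro!: mbed_nth_neg simp: pos_imp_zdiv_neg_iff)
    then have "fls_subdegree h \<ge> 0" by (rule fls_subdegree_ge0I)
    then have h': "fps_to_fls (fls_regpart h) = h" by simp
    have h0: "fps_nth (fls_regpart h) 0 = k"
      using mbed_nth[of b 0] B by (simp add: h fls_nth_compose_power k_def coeffX_0)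
    have "fls_poly (a' ^ m * [:fls_regpart h:]) = fls_poly (W b)"
      using eq unfolding hom_mult[OF is_hom_fls_poly] by (simp add: map_poly_pCons h')
    then have "a' ^ m * [:fls_regpart h:] = W b" by (rule fls_poly_inj)
    then have "residue_poly (a' ^ m * [:fls_regpart h:]) = ev residue_const rb (P_at0 b)" using
        resW by simp
    then show ?thesis
      unfolding hom_mult[OF is_hom_residue_poly] hom_power[OF is_hom_residue_poly] ra_def[symmetric]
      using h0 by (simp add: map_poly_pCons)
  qed
  show False
    by (rule residue_contradiction[OF moved' _ rb0 f g_rel k D mN de]) (simp add: ra0)
qed

end

section \<open>Isomorphisms determine the exponents\<close>

text \<open>\<open>H\<close> presents the same ring as the model of the first surface, but by the generators of the
  second one: this is an isomorphism between the two algebras.\<close>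

locale danielewski_iso = danielewski \<iota> P Q q
  for \<iota> :: "'r::idom \<Rightarrow> 'f::alg_closed_field" and P Q q +
  fixes d e d' e' :: nat and H :: "'r poly poly poly poly \<Rightarrow> 'f poly fract fls"
  assumes de: "d \<ge> 1" "e \<ge> 1" and de': "d' \<ge> 1" "e' \<ge> 1"
    and hom_H: "is_hom H" and range_H: "range H = range (model d e)"
    and ker_H: "\<And>a. H a = 0 \<longleftrightarrow> model d' e' a = 0" and H_const: "\<And>r. H (const4 r) = \<kappa> r"
begin

abbreviation "E \<equiv> model d e"
abbreviation "E' \<equiv> model d' e'"
definition "gX = H vX"
definition "gZ = H vZ"
definition "gY = H vY"
definition "gT = H vT"

lemmas H_gens = H_const gX_def[symmetric] gZ_def[symmetric] gY_def[symmetric] gT_def[symmetric]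
lemmas sH = hom_simps[OF hom_H]
lemmas sE = hom_simps[OF is_hom_model]

lemma H_poly: "H [:[:b:]:] = ev2 \<kappa> gX gZ b"
proof -
  have "H [:[:b:]:] = H (ev2 const4 vX vZ b)" by (simp only: ev2_self)
  also have "\<dots> = ev2 (\<lambda>r. H (const4 r)) (H vX) (H vZ) b" by (rule hom_ev2[OF hom_H is_hom_const4])
  finally show ?thesis by (simp only: H_gens)
qed

lemma H_polyX: "H [:[:[:a:]:]:] = ev \<kappa> gX a"
  unfolding H_poly by (simp add: ev_const is_hom_ev is_hom_\<kappa>)

lemma solution_H: "solution d' e' \<kappa> gX gZ gY gT"
proof -
  have "solution d' e' (\<lambda>r. H (const4 r)) (H vX) (H vZ) (H vY) (H vT)"
  proof (rule solution_transport[OF hom_H _ is_hom_model[of d' e'] _ is_hom_const4])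
    show "H a = 0" if "E' a = 0" for a using that ker_H by simp
    show "solution d' e' (\<lambda>r. E' (const4 r)) (E' vX) (E' vZ) (E' vY) (E' vT)"
      by (simp only: model_simps(1-5) solution_model)
  qed
  then show ?thesis by (simp only: H_gens)
qed

lemma gX_transcendental: "ev \<kappa> gX a = 0 \<Longrightarrow> a = 0"
proof -
  assume "ev \<kappa> gX a = 0"
  then have "E' [:[:[:a:]:]:] = 0" using ker_H H_polyX by metis
  then have "mbed [:a:] = 0" by (simp only: model_simps(6)[of d' e' "[:a:]"])
  then show "a = 0" by (simp add: mbed_eq_0)
qed

lemma gX_nonzero: "gX \<noteq> 0"
  using gX_transcendental[of "[:0, 1:]"] by (auto simp: ev_var is_hom_\<kappa>)

lemma gX_not_const: "gX \<noteq> \<kappa> r"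
proof
  assume "gX = \<kappa> r"
  then have "ev \<kappa> gX [:- r, 1:] = 0" by (simp add: ev_pCons ev_0 is_hom_\<kappa> hom_simps[OF is_hom_\<kappa>])
  then show False using gX_transcendental by fastforce
qed

lemma in_E: "\<exists>p. E p = H a" 
proof -
  have "H a \<in> range E" unfolding range_H[symmetric] by (rule rangeI)
  then show ?thesis by auto
qed

lemma in_H: "\<exists>p. H p = E a"
proof -
  have "E a \<in> range H" unfolding range_H by (rule rangeI)
  then show ?thesis by auto
qed

text \<open>The translations \<open>z \<mapsto> z + U\<close> on the second surface, with \<open>y\<close> and \<open>t\<close> solved for. Dividing by powers
  of \<open>gX\<close> is harmless because the deformation may take values in polynomials over the Laurent
  series field.\<close>

definition shift_Z where "shift_Z = [:gZ, 1:]"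
definition shift_Y where
  "shift_Y = smult (inverse (gX ^ d')) (ev2 (\<lambda>r. [:\<kappa> r:]) [:gX:] shift_Z P)"
definition shift_T where
  "shift_T = smult (inverse (gX ^ e')) (ev3 (\<lambda>r. [:\<kappa> r:]) [:gX:] shift_Z shift_Y Q)"
definition shift where
  "shift = ev4 (\<lambda>r. [:\<kappa> r:]) [:gX:] shift_Z shift_Y shift_T"

lemma const_hom: "is_hom (\<lambda>r. [:\<kappa> r:])" by (rule is_hom_comp[OF is_hom_const_poly is_hom_\<kappa>])

lemma is_hom_shift: "is_hom shift"
  unfolding shift_def by (intro is_hom_ev const_hom)

lemma solution_shift: "solution d' e' (\<lambda>r. [:\<kappa> r:]) [:gX:] shift_Z shift_Y shift_T"
proof -
  have "[:gX:] ^ n * smult (inverse (gX ^ n)) v = v" for n v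
    using gX_nonzero by (simp add: poly_const_pow)
  then show ?thesis unfolding solution_def shift_Y_def shift_T_def by blast
qed

lemma shift_ker: "E' a = 0 \<Longrightarrow> shift a = 0"
  unfolding shift_def using ev4_ideal[OF const_hom solution_shift] model_eq_0_iff[OF de'] by blast

lemma shift_gens: "shift (const4 r) = [:\<kappa> r:]" "shift vX = [:gX:]"
  "shift [:[:b:]:] = ev2 (\<lambda>r. [:\<kappa> r:]) [:gX:] shift_Z b"
  unfolding shift_def by (simp_all add: ev_const ev_var is_hom_ev const_hom)

lemma shift_at_0: "coeff (shift a) 0 = H a"
proof -
  have h: "is_hom (\<lambda>p :: 'f poly fract fls poly. poly p 0)" by (rule is_hom_poly)
  have s: "solution d' e' \<kappa> gX gZ (poly shift_Y 0) (poly shift_T 0)"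
    using solution_hom[OF h const_hom solution_shift] by (simp add: shift_Z_def)
  have Y: "poly shift_Y 0 = gY"
    using s solution_H gX_nonzero unfolding solution_def by (metis mult_cancel_left power_not_zero)
  have T: "poly shift_T 0 = gT"
    using s solution_H gX_nonzero unfolding solution_def Y by (metis mult_cancel_left power_not_zero)
  have "poly (shift a) 0 = ev4 \<kappa> gX gZ (poly shift_Y 0) (poly shift_T 0) a"
    unfolding shift_def using hom_ev4[OF h const_hom] by (simp add: shift_Z_def)
  also have "\<dots> = H a"
    unfolding Y T using hom_eq_ev4[OF hom_H, of a] by (simp only: H_gens)
  finally show ?thesis by (simp add: poly_0_coeff_0)
qed

text \<open>Each generator of the first surface is a polynomial in those of the second.\<close>

lemma pullback_exists:
  obtains L where "is_hom L" "\<And>r. L (const4 r) = const4 r" "\<And>a. H (L a) = E a"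
proof -
  obtain x1 z1 y1 t1 where g: "H x1 = E vX" "H z1 = E vZ" "H y1 = E vY" "H t1 = E vT"
    using in_H[of vX] in_H[of vZ] in_H[of vY] in_H[of vT] by blast
  define L where "L = ev4 const4 x1 z1 y1 t1"
  have "is_hom L" unfolding L_def by (intro is_hom_ev is_hom_const4)
  moreover have "L (const4 r) = const4 r" for r
    unfolding L_def by (simp add: ev_const is_hom_ev is_hom_const4)
  moreover have "H (L a) = E a" for a
  proof -
    have "H (L a) = ev4 (\<lambda>r. H (const4 r)) (H x1) (H z1) (H y1) (H t1) a"
      unfolding L_def by (rule hom_ev4[OF hom_H is_hom_const4])
    also have "\<dots> = E a" unfolding g H_const model_simps(2-5) by (simp add: model_def)
    finally show ?thesis .
  qed
  ultimately show thesis by (rule that)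
qed

text \<open>As \<open>deg P \<ge> 2\<close>, the bound on pole orders is 0 for leading coefficients of degree at most 1.\<close>

lemma low_degree_regular:
  assumes "d0 \<ge> 1" and f: "mX ^ m * model d0 e0 p = mbed b" and b: "P_at0 b \<noteq> 0" "degree b \<le> 1"
  shows "m = 0"
proof -
  have "degree (P_at0 b) \<le> 1" using b(2) map_poly_degree_leq[of "\<lambda>c. poly c 0" b] unfolding
      P_at0_def by linarith
  then have lt: "degree (P_at0 b) < rP" using deg_P by simp
  have "rP * 1 \<le> rP * sQ" by (rule mult_le_mono2) (use deg_Q in simp)
  then have "degree (P_at0 b) < rP * sQ" using lt by linarith
  then show ?thesis using pole_bound[OF assms(1) f b(1)] lt by simp
qed

text \<open>\<open>X\<close> is fixed by the translations, so as a function on the second surface it does not depend on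
  \<open>z\<close>. A function of the base coordinate alone has no pole by the bound on pole orders.\<close>

lemma X_poly_in_gX: "\<exists>a. mX = ev \<kappa> gX a"
proof -
  obtain L where L: "is_hom L" "\<And>r. L (const4 r) = const4 r" "\<And>a. H (L a) = E a"
    using pullback_exists by blast
  obtain gp where gp: "E gp = gX" using in_E[of vX] unfolding gX_def by blast
  define \<phi> where "\<phi> a = shift (L a)" for a
  have "\<phi> vX = [:mX:]"
  proof (rule deformation_fixes_X[OF de, of _ gp])
    show "is_hom \<phi>" unfolding \<phi>_def by (rule is_hom_comp[OF is_hom_shift L(1)])
    show "\<phi> a = 0" if "E a = 0" for a
      unfolding \<phi>_def by (rule shift_ker) (use that L(3) ker_H in metis)
    show "\<phi> (const4 r) = [:\<kappa> r:]" for r unfolding \<phi>_def L(2) shift_gens(1) ..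
    show "coeff (\<phi> a) 0 = E a" for a unfolding \<phi>_def shift_at_0 L(3) ..
    have "H (L gp - vX) = 0" by (simp only: sH L(3) gp gX_def diff_self)
    then have "shift (L gp - vX) = 0" using shift_ker ker_H by blast
    then show "\<phi> gp = [:E gp:]"
      unfolding \<phi>_def gp by (simp only: hom_diff[OF is_hom_shift] shift_gens(2) right_minus_eq)
    show "E gp \<noteq> \<kappa> r" for r unfolding gp by (rule gX_not_const)
  qed
  then have x1: "shift (L vX) = [:mX:]" unfolding \<phi>_def .
  obtain m b where mb: "mX ^ m * E' (L vX) = mbed b" "m = 0 \<or> P_at0 b \<noteq> 0"
    using reduced_form by blast
  have E'0: "E' (vX ^ m * L vX - [:[:b:]:]) = 0"
    by (simp only: sE model_simps(2) model_simps(6)[of d' e' b] mb(1) diff_self)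
  then have "shift (vX ^ m * L vX - [:[:b:]:]) = 0" by (rule shift_ker)
  then have sb: "[:gX:] ^ m * [:mX:] = ev2 (\<lambda>r. [:\<kappa> r:]) [:gX:] shift_Z b"
    by (simp only: hom_simps[OF is_hom_shift] shift_gens(2) shift_gens(3)[of b] x1) simp
  have "degree b = 0"
  proof -
    have "ev (\<lambda>r. [:\<kappa> r:]) [:gX:] a = [:ev \<kappa> gX a:]" for a
      using hom_ev[OF is_hom_const_poly is_hom_\<kappa>, of gX a] by simp
    then have fe: "ev (\<lambda>r. [:\<kappa> r:]) [:gX:] = (\<lambda>a. [:ev \<kappa> gX a:])" by blast
    have "ev2 (\<lambda>r. [:\<kappa> r:]) [:gX:] shift_Z b = pcompose (map_poly (ev \<kappa> gX) b) shift_Z"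
      unfolding fe ev_def[of "\<lambda>a. [:ev \<kappa> gX a:]"] pcompose_altdef
      by (simp add: map_poly_map_poly hom_0[OF is_hom_ev[OF is_hom_\<kappa>]] o_def)
    moreover have "degree (map_poly (ev \<kappa> gX) b) = degree b"
      by (rule degree_map_poly) (use gX_transcendental in auto)
    ultimately have "degree ([:gX:] ^ m * [:mX:]) = degree b"
      unfolding sb by (simp add: degree_pcompose shift_Z_def)
    then show ?thesis by (simp add: poly_const_pow)
  qed
  then obtain a where a: "b = [:a:]" by (rule degree_eq_zeroE)
  have "m = 0" using mb low_degree_regular[OF de'(1) mb(1)] a by auto
  then have "H (L vX - [:[:b:]:]) = 0" using E'0 ker_H by simp
  then have "mX = H [:[:[:a:]:]:]" by (simp only: sH L(3) model_simps(2) a right_minus_eq)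
  then show ?thesis unfolding H_polyX by blast
qed

subsection \<open>Degrees in \<open>Z\<close>\<close>

text \<open>A second model, in \<open>K(X)[Z]\<close>, in which the degree in \<open>z\<close> of a function is visible; for Laurent
  series with coefficients in \<open>F(Z)\<close> it is not.\<close>

definition fractX :: "'r poly fract" where "fractX = to_fract [:0, 1:]"
definition fractC :: "'r \<Rightarrow> 'r poly fract poly" where "fractC r = [:to_fract [:r:]:]"
definition poly_Y where
  "poly_Y = smult (inverse (fractX ^ d)) (ev2 fractC [:fractX:] [:0, 1:] P)"
definition poly_T where
  "poly_T = smult (inverse (fractX ^ e)) (ev3 fractC [:fractX:] [:0, 1:] poly_Y Q)"
definition poly_model where "poly_model = ev4 fractC [:fractX:] [:0, 1:] poly_Y poly_T"

lemma is_hom_fractC: "is_hom fractC"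
  unfolding fractC_def
  by (intro is_hom_comp[OF is_hom_const_poly] is_hom_comp[OF is_hom_to_fract] is_hom_const_poly)

lemma is_hom_poly_model: "is_hom poly_model"
  unfolding poly_model_def by (intro is_hom_ev is_hom_fractC)

lemma poly_model_ker: "E a = 0 \<Longrightarrow> poly_model a = 0"
proof -
  have "fractX \<noteq> 0" by (simp add: fractX_def)
  then have "[:fractX:] ^ n * smult (inverse (fractX ^ n)) v = v" for n v
    by (simp add: poly_const_pow)
  then have "solution d e fractC [:fractX:] [:0, 1:] poly_Y poly_T"
    unfolding solution_def poly_Y_def poly_T_def by blast
  then show "E a = 0 \<Longrightarrow> poly_model a = 0"
    unfolding poly_model_def using ev4_ideal[OF is_hom_fractC] model_eq_0_iff[OF de] by blast
qed

lemma poly_model_simps: "poly_model (const4 r) = fractC r" "poly_model vX = [:fractX:]"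
  "poly_model vZ = [:0, 1:]" "poly_model [:[:b:]:] = map_poly to_fract b"
proof -
  show "poly_model (const4 r) = fractC r" "poly_model vX = [:fractX:]" "poly_model vZ = [:0, 1:]"
    unfolding poly_model_def by (simp_all add: ev_const ev_var is_hom_ev is_hom_fractC)
  have "ev fractC [:fractX:] a = [:to_fract a:]" for a
  proof -
    have "[:to_fract a:] = ev (\<lambda>r. [:to_fract [:r:]:]) [:to_fract [:0, 1:]:] a"
      by (rule hom_eq_ev[OF is_hom_comp[OF is_hom_const_poly is_hom_to_fract]])
    then show ?thesis by (simp add: fractX_def fractC_def[abs_def])
  qed
  then have eq: "ev fractC [:fractX:] = (\<lambda>a. [:to_fract a:])" by blast
  have "poly_model [:[:b:]:] = ev2 fractC [:fractX:] [:0, 1:] b"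
    unfolding poly_model_def by (simp add: ev_const is_hom_ev is_hom_fractC)
  then have "poly_model [:[:b:]:] = ev (\<lambda>a. [:to_fract a:]) [:0, 1:] b" unfolding eq .
  then show "poly_model [:[:b:]:] = map_poly to_fract b"
    by (simp add: map_poly_eq_ev[OF is_hom_to_fract])
qed

lemma degree_poly_model: "degree (poly_model [:[:b:]:]) = degree b"
  unfolding poly_model_simps(4) by (rule degree_map_poly) auto

lemma poly_model_reduced:
  assumes "mX ^ m * E p = mbed b"
  shows "degree b = degree (poly_model p)"
proof -
  have "E (vX ^ m * p - [:[:b:]:]) = 0"
    by (simp only: sE model_simps(2) model_simps(6)[of d e b] assms diff_self)
  then have "poly_model (vX ^ m * p - [:[:b:]:]) = 0" by (rule poly_model_ker)
  then have "[:fractX:] ^ m * poly_model p = poly_model [:[:b:]:]"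
    by (simp only: hom_simps[OF is_hom_poly_model] poly_model_simps(2) right_minus_eq)
  moreover have "fractX \<noteq> 0" by (simp add: fractX_def)
  ultimately show ?thesis
    unfolding degree_poly_model[symmetric] by (simp add: poly_const_pow flip: \<open>_ = poly_model [:[:b:]:]\<close>)
qed

lemma regular_low_degree:
  assumes "degree (poly_model p) \<le> 1"
  shows "\<exists>b. E p = mbed b \<and> degree b = degree (poly_model p)"
proof -
  obtain m b where mb: "mX ^ m * E p = mbed b" "m = 0 \<or> P_at0 b \<noteq> 0" using reduced_form by blast
  have "degree b = degree (poly_model p)" by (rule poly_model_reduced[OF mb(1)])
  moreover from this have "m = 0" using mb low_degree_regular[OF de(1) mb(1)] assms by auto
  ultimately show ?thesis using mb(1) by auto
qed

text \<open>Write \<open>X = a(x')\<close>. Then \<open>x'\<close> has degree 0 in \<open>z\<close>, so it is a polynomial \<open>c\<close> in \<open>X\<close> without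
    poles, and
  \<open>a(c(X)) = X\<close> forces both polynomials to be linear.\<close>

lemma gX_linear:
  obtains u v p0 p1 where "gX = \<kappa> v + \<kappa> u * mX" "mX = \<kappa> p0 + \<kappa> p1 * gX" "p1 * u = 1" "p0 + p1 * v = 0"
proof -
  obtain a where a: "mX = ev \<kappa> gX a" using X_poly_in_gX by blast
  obtain gp where gp: "E gp = gX" using in_E[of vX] unfolding gX_def by blast
  have "E (vX - ev const4 gp a) = 0"
    unfolding sE hom_ev[OF is_hom_model is_hom_const4] gp model_simps(1,2) using a by simp
  then have "poly_model (vX - ev const4 gp a) = 0" by (rule poly_model_ker)
  then have eq: "[:fractX:] = ev fractC (poly_model gp) a"
    unfolding hom_diff[OF is_hom_poly_model] hom_ev[OF is_hom_poly_model is_hom_const4]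
      poly_model_simps(1,2) by simp
  have "ev fractC (poly_model gp) a = pcompose (map_poly (\<lambda>r. to_fract [:r:]) a) (poly_model gp)"
    unfolding fractC_def[abs_def] pcompose_altdef ev_def by (simp add: map_poly_map_poly o_def)
  moreover have "degree (map_poly (\<lambda>r. to_fract [:r:]) a) = degree a"
    by (rule degree_map_poly) auto
  ultimately have "degree a * degree (poly_model gp) = 0"
    using arg_cong[OF eq, of degree] by (simp add: degree_pcompose)
  moreover have "degree a \<noteq> 0"
  proof
    assume "degree a = 0"
    then obtain r where "a = [:r:]" by (rule degree_eq_zeroE)
    then have "mX = \<kappa> r" using a by (simp add: ev_const is_hom_\<kappa>)
    then have "fls_nth mX 1 = fls_nth (\<kappa> r) 1" by simp
    then show False by (simp add: \<kappa>_def)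
  qed
  ultimately have "degree (poly_model gp) = 0" by simp
  then obtain b where b: "gX = mbed b" "degree b = 0" using regular_low_degree[of gp] gp by auto
  then obtain c where c: "b = [:c:]" by (metis degree_eq_zeroE)
  then have gc: "gX = ev \<kappa> mX c" using b by (simp add: mbed_def ev_const is_hom_ev is_hom_\<kappa>)
  have pc: "pcompose a c = ev (\<lambda>r. [:r:]) c a" by (simp add: pcompose_altdef ev_def)
  have "ev \<kappa> mX (pcompose a c) = ev (\<lambda>r. ev \<kappa> mX [:r:]) (ev \<kappa> mX c) a"
    unfolding pc by (rule hom_ev[OF is_hom_ev[OF is_hom_\<kappa>] is_hom_const_poly])
  also have "\<dots> = mX" using a gc by (simp add: ev_const is_hom_\<kappa>)
  finally have "ev \<kappa> mX (pcompose a c) = ev \<kappa> mX [:0, 1:]" by (simp add: ev_var is_hom_\<kappa>)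
  then have "mbed [:pcompose a c - [:0, 1:]:] = 0"
    by (simp add: mbed_def ev_const is_hom_ev is_hom_\<kappa> hom_diff[OF is_hom_ev[OF is_hom_\<kappa>]])
  then have pc1: "pcompose a c = [:0, 1:]" by (simp only: mbed_eq_0) simp
  then have "degree a * degree c = 1" by (metis degree_pcompose degree_pCons_eq_if one_neq_zero
      pCons_eq_0_iff degree_0 One_nat_def)
  then have "degree a = 1" "degree c = 1" by simp_all
  then obtain p0 p1 v u where pv: "a = [:p0, p1:]" "c = [:v, u:]" by (metis degree1_coeffs)
  have "p1 * u = 1" "p0 + p1 * v = 0" using pc1 unfolding pv by (simp_all add: pcompose_pCons
      algebra_simps)
  moreover have "gX = \<kappa> v + \<kappa> u * mX" "mX = \<kappa> p0 + \<kappa> p1 * gX"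
    using gc a unfolding pv by (simp_all add: ev_pCons ev_0 is_hom_\<kappa> algebra_simps)
  ultimately show thesis using that by blast
qed


text \<open>Evaluation of the second surface in its fibre over \<open>v\<close>, a line with coordinate \<open>Z\<close>. The
    function \<open>X\<close> is
  sent to 0 and \<open>z\<close> to a polynomial that is a root of \<open>P(0,Z)\<close>, hence to a constant, which is
  \<open>\<rho> / v\<^sup>m\<close> for some \<open>\<rho>\<close> in \<open>R\<close>. So \<open>gX\<^sup>m z - \<rho>\<close> vanishes on the fibre and is divisible by its
  equation.\<close>

lemma special_fibre:
  assumes v: "v \<noteq> 0" and K0: "mX = \<kappa> p0 + \<kappa> p1 * gX" "p0 + p1 * v = 0"
  shows "\<exists>m \<rho> b. gX ^ m * mZ = \<kappa> \<rho> + (gX - \<kappa> v) * H [:[:b:]:]"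
proof -
  obtain L where L: "is_hom L" "\<And>r. L (const4 r) = const4 r" "\<And>a. H (L a) = E a"
    using pullback_exists by blast
  define cc :: "'r \<Rightarrow> 'f poly" where "cc r = [:\<iota> r:]" for r
  have hcc: "is_hom cc" unfolding cc_def by (rule is_hom_comp[OF is_hom_const_poly hom_\<iota>])
  define Y where "Y = smult (inverse (\<iota> v ^ d')) (ev2 cc (cc v) [:0, 1:] P)"
  define T where "T = smult (inverse (\<iota> v ^ e')) (ev3 cc (cc v) [:0, 1:] Y Q)"
  define K where "K = ev4 cc (cc v) [:0, 1:] Y T"
  have \<iota>v: "\<iota> v \<noteq> 0" using v inj_\<iota> by blast
  have "cc v ^ n * smult (inverse (\<iota> v ^ n)) w = w" for n w
    using \<iota>v by (simp add: cc_def poly_const_pow)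
  then have sol: "solution d' e' cc (cc v) [:0, 1:] Y T"
    unfolding solution_def Y_def T_def by blast
  have K: "is_hom K" unfolding K_def by (intro is_hom_ev hcc)
  note sK = hom_simps[OF K]
  have K_ker: "K a = 0" if "H a = 0" for a
    unfolding K_def using ev4_ideal[OF hcc sol] model_eq_0_iff[OF de'] ker_H that by blast
  have Kg: "K (const4 r) = cc r" "K vX = cc v" "K [:[:b:]:] = ev2 cc (cc v) [:0, 1:] b" for r b
    unfolding K_def by (simp_all add: ev_const ev_var is_hom_ev hcc)
  have "H (L vX - (const4 p0 + const4 p1 * vX)) = 0"
    by (simp only: sH L(3) model_simps(2) H_gens K0(1)[symmetric] diff_self)
  then have "K (L vX - (const4 p0 + const4 p1 * vX)) = 0" by (rule K_ker)
  then have "K (L vX) = cc p0 + cc p1 * cc v" by (simp only: sK Kg(1,2) right_minus_eq)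
  also have "\<dots> = cc (p0 + p1 * v)" by (simp only: hom_add[OF hcc] hom_mult[OF hcc])
  finally have KX: "K (L vX) = 0" by (simp only: K0(2) hom_0[OF hcc])
  have "E (vX ^ d * vY - [:[:P:]:]) = 0"
    using solution_model[of d e]
    by (simp only: sE model_simps(2,4) model_simps(6)[of d e P] solution_def mbed_def diff_self)
  then have "H (L (vX ^ d * vY - [:[:P:]:])) = 0" by (simp only: L(3))
  then have "K (L (vX ^ d * vY - [:[:P:]:])) = 0" by (rule K_ker)
  then have "K (L [:[:P:]:]) = 0"
    using de(1) by (simp only: hom_simps[OF L(1)] sK KX zero_power Suc_le_eq One_nat_def) simp
  moreover have "K (L [:[:P:]:]) = ev cc (K (L vZ)) P0"
  proof -
    have "K (L [:[:P:]:]) = K (L (ev2 const4 vX vZ P))" by (simp only: ev2_self)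
    also have "\<dots> = ev2 (\<lambda>r. K (L (const4 r))) (K (L vX)) (K (L vZ)) P"
      by (rule hom_ev2[OF is_hom_comp[OF K L(1)] is_hom_const4])
    also have "\<dots> = ev2 cc 0 (K (L vZ)) P" by (simp only: L(2) Kg(1) KX)
    finally show ?thesis by (simp only: ev2_zero[OF hcc] P0_def)
  qed
  ultimately have "pcompose (emb P0) (K (L vZ)) = 0"
    by (simp add: pcompose_altdef ev_def cc_def[abs_def] map_poly_map_poly hom_0 hom_\<iota> o_def)
  then have "degree (K (L vZ)) = 0"
    using pcompose_eq_0 P0_nonzero map_\<iota>_eq_0 by blast
  then obtain l where l: "K (L vZ) = [:l:]" by (rule degree_eq_zeroE)
  obtain m b where mb: "mX ^ m * E' (L vZ) = mbed b" using reduced_form by blast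
  have "E' (vX ^ m * L vZ - [:[:b:]:]) = 0"
    by (simp only: hom_simps[OF is_hom_model] model_simps(2) model_simps(6)[of d' e' b] mb diff_self)
  then have H0: "H (vX ^ m * L vZ - [:[:b:]:]) = 0" using ker_H by blast
  then have "K (vX ^ m * L vZ - [:[:b:]:]) = 0" by (rule K_ker)
  then have Kb: "cc v ^ m * [:l:] = ev2 cc (cc v) [:0, 1:] b"
    by (simp only: sK Kg(2) Kg(3)[of b] l right_minus_eq)
  let ?at = "map_poly (\<lambda>a. poly a v)"
  have "ev cc (cc v) a = [:\<iota> (poly a v):]" for a
  proof (induction a)
    case 0
    show ?case by (simp add: ev_0[OF hcc] hom_0 hom_\<iota>)
  next
    case (pCons r a)
    have "ev cc (cc v) (pCons r a) = cc r + cc v * [:\<iota> (poly a v):]"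
      by (simp only: ev_pCons[OF hcc] pCons.IH)
    also have "\<dots> = [:\<iota> r + \<iota> v * \<iota> (poly a v):]" by (simp add: cc_def)
    finally show ?case by (simp only: poly_pCons hom_add[OF hom_\<iota>] hom_mult[OF hom_\<iota>])
  qed
  then have "ev cc (cc v) = (\<lambda>a. [:\<iota> (poly a v):])" by blast
  then have "ev2 cc (cc v) [:0, 1:] b = emb (?at b)"
    using map_poly_eq_ev[OF is_hom_comp[OF hom_\<iota> is_hom_poly], of v b]
    by (simp add: map_poly_map_poly hom_0 hom_\<iota> o_def)
  then have "emb (?at b) = cc v ^ m * [:l:]" unfolding Kb by (rule sym)
  also have "\<dots> = [:\<iota> v ^ m * l:]" by (simp add: cc_def poly_const_pow)
  finally have "degree (emb (?at b)) = 0" by simp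
  then have "degree (?at b) = 0" by (simp only: deg_emb)
  then obtain \<rho> where \<rho>: "?at b = [:\<rho>:]" by (rule degree_eq_zeroE)
  have "[:[:- v, 1:]:] dvd b - [:[:\<rho>:]:]"
    by (rule map_poly_kernel_multiples[OF is_hom_poly[of v]])
      (use \<rho> in \<open>auto simp: poly_eq_0_iff_dvd hom_diff[OF is_hom_map_poly[OF is_hom_poly]]
          map_poly_pCons\<close>)
  then obtain b' where "b - [:[:\<rho>:]:] = [:[:- v, 1:]:] * b'" by (elim dvdE)
  then have b': "b = [:[:\<rho>:]:] + [:[:- v, 1:]:] * b'" by (simp add: algebra_simps)
  have hg: "is_hom (ev2 \<kappa> gX gZ)" by (intro is_hom_ev is_hom_\<kappa>)
  have "gX ^ m * mZ = H [:[:b:]:]"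
    using H0 by (simp only: sH L(3) model_simps(3) gX_def[symmetric] right_minus_eq)
  also have "\<dots> = ev2 \<kappa> gX gZ [:[:\<rho>:]:] + ev2 \<kappa> gX gZ [:[:- v, 1:]:] * H [:[:b':]:]"
    unfolding H_poly b' by (simp only: hom_add[OF hg] hom_mult[OF hg])
  also have "ev2 \<kappa> gX gZ [:[:\<rho>:]:] = \<kappa> \<rho>" by (simp add: ev_const is_hom_ev is_hom_\<kappa>)
  also have "ev2 \<kappa> gX gZ [:[:- v, 1:]:] = gX - \<kappa> v"
    by (simp add: ev_const ev_pCons ev_0 is_hom_ev is_hom_\<kappa> hom_simps[OF is_hom_\<kappa>])
  finally show ?thesis by blast
qed

text \<open>The fibre over \<open>X = 0\<close> must correspond to itself. Otherwise it would be isomorphic to a fibre that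
  is a line, on which \<open>z\<close>, being a root of \<open>P(0,Z)\<close>, is constant; then \<open>(z - c)/X\<close> would be regular
  for some constant \<open>c\<close>, which the bound on pole orders excludes.\<close>

lemma gX_proportional:
  obtains u p1 where "gX = \<kappa> u * mX" "p1 * u = 1"
proof -
  obtain u v p0 p1 where g: "gX = \<kappa> v + \<kappa> u * mX" "mX = \<kappa> p0 + \<kappa> p1 * gX" "p1 * u = 1" "p0 + p1 * v = 0"
    by (rule gX_linear)
  have "v = 0"
  proof (rule ccontr)
    assume v: "v \<noteq> 0"
    interpret danielewski_subring \<iota> P Q q "range E" \<kappa> mX by (rule model_subring)
    obtain m \<rho> b where eq: "gX ^ m * mZ = \<kappa> \<rho> + (gX - \<kappa> v) * H [:[:b:]:]"
      using special_fibre[OF v g(2,4)] by blast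
    have Z_in: "mZ \<in> range E" using model_simps(3)[of d e] by (metis rangeI)
    have \<kappa>_in: "\<kappa> r \<in> range E" for r by (rule c(2))
    have H_in: "H a \<in> range E" for a unfolding range_H[symmetric] by (rule rangeI)
    have g_in: "gX \<in> range E" unfolding gX_def by (rule H_in)
    have dg: "dvd_in (range E) mX (gX - \<kappa> v)"
      using dvd_in_self[OF C \<kappa>_in, of mX u] by (simp add: g(1) mult.commute)
    have dgk: "dvd_in (range E) mX (gX ^ k - \<kappa> v ^ k)" for k
    proof (induction k)
      case 0
      then show ?case using dvd_in_0[OF C] by simp
    next
      case (Suc k)
      have "gX ^ Suc k - \<kappa> v ^ Suc k = (gX - \<kappa> v) * gX ^ k + \<kappa> v * (gX ^ k - \<kappa> v ^ k)"
        by (simp add: algebra_simps)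
      then show ?case
        using dvd_in_add[OF C dvd_in_mult[OF C dg sc(7)[OF g_in]] dvd_in_mult_left[OF C Suc.IH
            \<kappa>_in]] by (simp only:)
    qed
    have "\<kappa> v ^ m * mZ - \<kappa> \<rho> = (gX - \<kappa> v) * H [:[:b:]:] - (gX ^ m - \<kappa> v ^ m) * mZ"
      using eq by (simp add: algebra_simps)
    moreover have "dvd_in (range E) mX ((gX - \<kappa> v) * H [:[:b:]:] - (gX ^ m - \<kappa> v ^ m) * mZ)"
      by (rule dvd_in_diff[OF C dvd_in_mult[OF C dg H_in] dvd_in_mult[OF C dgk Z_in]])
    \<comment> \<open>\<open>(v\<^sup>m z - \<rho>) / X\<close> would be regular with a leading coefficient of degree 1.\<close>
    ultimately obtain p where p: "\<kappa> v ^ m * mZ - \<kappa> \<rho> = mX * E p" unfolding dvd_in_def by auto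
    let ?b = "[:[:- \<rho>:], [:v ^ m:]:]"
    have "mX ^ 1 * E p = mbed ?b"
      unfolding power_one_right p[symmetric] mbed_def
      by (simp add: ev_pCons ev_0 is_hom_ev is_hom_\<kappa> hom_simps[OF is_hom_\<kappa>])
    moreover have "P_at0 ?b \<noteq> 0" using v by (simp add: P_at0_def map_poly_pCons)
    ultimately have "(1::nat) = 0" by (rule low_degree_regular[OF de(1)]) simp
    then show False by simp
  qed
  then have "gX = \<kappa> u * mX" using g(1) by (simp add: hom_0[OF is_hom_\<kappa>])
  then show thesis using g(3) by (rule that)
qed

text \<open>\<open>z\<close> and its counterpart are polynomials in each other over the Laurent polynomials in \<open>X\<close>, so both
  have degree 1 in each other, and there are no poles by the bound on pole orders. If the coefficient of
  \<open>z\<close> vanished at \<open>X = 0\<close>, the counterpart of \<open>z\<close> minus a constant would be divisible by \<open>X\<close>,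
  which the same bound excludes on the second surface.\<close>

lemma gZ_linear:
  obtains b where "gZ = mbed b" "degree (P_at0 b) = 1"
proof -
  obtain u p1 where u: "gX = \<kappa> u * mX" "p1 * u = 1" by (rule gX_proportional)
  have u0: "u \<noteq> 0" using u(2) by auto
  obtain L where L: "is_hom L" "\<And>r. L (const4 r) = const4 r" "\<And>a. H (L a) = E a"
    using pullback_exists by blast
  obtain gp where gp: "E gp = gX" using in_E[of vX] unfolding gX_def by blast
  obtain wp where wp: "E wp = gZ" using in_E[of vZ] unfolding gZ_def by blast
  have "E (gp - const4 u * vX) = 0" by (simp only: sE gp model_simps(1,2) u(1) diff_self)
  then have "poly_model (gp - const4 u * vX) = 0" by (rule poly_model_ker)
  then have "poly_model gp = fractC u * [:fractX:]"
    by (simp only: hom_simps[OF is_hom_poly_model] poly_model_simps(1,2) right_minus_eq)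
  then have pg: "poly_model gp = [:to_fract [:0, u:]:]"
    by (simp add: fractC_def fractX_def flip: to_fract_mult)
  obtain m b where mb: "mX ^ m * E' (L vZ) = mbed b" using reduced_form by blast
  have "E' (vX ^ m * L vZ - [:[:b:]:]) = 0"
    by (simp only: hom_simps[OF is_hom_model] model_simps(2) model_simps(6)[of d' e' b] mb diff_self)
  then have "H (vX ^ m * L vZ - [:[:b:]:]) = 0" using ker_H by blast
  then have "gX ^ m * mZ = ev2 \<kappa> gX gZ b"
    by (simp only: sH L(3) model_simps(3) gX_def[symmetric] H_poly[of b] right_minus_eq)
  then have "E (gp ^ m * vZ - ev2 const4 gp wp b) = 0"
    unfolding sE hom_ev2[OF is_hom_model is_hom_const4] gp wp model_simps(1,3) by simp
  then have "poly_model (gp ^ m * vZ - ev2 const4 gp wp b) = 0" by (rule poly_model_ker)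
  then have eq: "poly_model gp ^ m * [:0, 1:] = ev2 fractC (poly_model gp) (poly_model wp) b"
    unfolding hom_simps[OF is_hom_poly_model] hom_ev2[OF is_hom_poly_model is_hom_const4]
      poly_model_simps(1,3) by simp
  have "degree (poly_model gp ^ m * [:0, 1:]) = 1"
    unfolding pg using u0 by (simp add: poly_const_pow del: mult_pCons_right)
  then have "degree (ev2 fractC (poly_model gp) (poly_model wp) b) = 1" unfolding eq .
  moreover have "degree (ev2 fractC (poly_model gp) (poly_model wp) b) = degree b * degree
      (poly_model wp)"
  proof -
    have 1: "ev fractC (poly_model gp) a = [:to_fract (pcompose a [:0, u:]):]" for a
    proof -
      have h: "is_hom (\<lambda>a :: 'r poly. [:to_fract (pcompose a [:0, u:]):])"
        by (intro is_homI) (simp_all add: pcompose_add pcompose_mult pcompose_1 flip: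
            to_fract_mult to_fract_add)
      have "[:to_fract (pcompose a [:0, u:]):]
          = ev (\<lambda>r. [:to_fract (pcompose [:r:] [:0, u:]):]) [:to_fract (pcompose [:0, 1:] [:0, u:]):] a"
        by (rule hom_eq_ev[OF h])
      then show ?thesis by (simp add: pg fractC_def[abs_def] pcompose_pCons)
    qed
    then have "ev fractC (poly_model gp) = (\<lambda>a. [:to_fract (pcompose a [:0, u:]):])" by blast
    then have "ev2 fractC (poly_model gp) (poly_model wp) b
        = pcompose (map_poly (\<lambda>a. to_fract (pcompose a [:0, u:])) b) (poly_model wp)"
      by (simp add: pcompose_altdef map_poly_map_poly ev_def o_def)
    moreover have "degree (map_poly (\<lambda>a. to_fract (pcompose a [:0, u:])) b) = degree b"
      by (rule degree_map_poly) (use u0 in \<open>auto dest!: pcompose_eq_0\<close>)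
    ultimately show ?thesis by (simp add: degree_pcompose)
  qed
  ultimately have "degree (poly_model wp) = 1" by simp
  then obtain b7 where b7: "gZ = mbed b7" "degree b7 = 1" using regular_low_degree[of wp] wp by auto
  then obtain A0 A1 where A: "b7 = [:A0, A1:]" by (metis degree1_coeffs)
  have "poly A1 0 \<noteq> 0"
  proof
    assume A1: "poly A1 0 = 0"
    define \<rho> where "\<rho> = poly A0 0"
    have "[:[:0, 1:]:] dvd b7 - [:[:\<rho>:]:]"
      by (rule map_poly_kernel_multiples[OF is_hom_poly[of 0]])
        (use A1 in \<open>auto simp: A \<rho>_def poly_eq_0_iff_dvd hom_diff[OF is_hom_map_poly[OF
            is_hom_poly]] map_poly_pCons\<close>)
    then obtain b9 where "b7 - [:[:\<rho>:]:] = [:[:0, 1:]:] * b9" by (elim dvdE)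
    then have "mbed b7 - mbed [:[:\<rho>:]:] = mbed [:[:0, 1:]:] * mbed b9"
      unfolding hom_diff[OF is_hom_mbed, symmetric] hom_mult[OF is_hom_mbed, symmetric] by simp
    then have g9: "gZ - \<kappa> \<rho> = mX * E [:[:b9:]:]"
      unfolding model_simps(6) b7(1)[symmetric]
      by (simp add: mbed_def ev_const ev_var is_hom_ev is_hom_\<kappa>)
    obtain p9 where p9: "H p9 = E [:[:b9:]:]" using in_H by blast
    have "\<kappa> p1 * gX = mX"
      unfolding u(1) mult.assoc[symmetric] hom_mult[OF is_hom_\<kappa>, symmetric] u(2) hom_1[OF
          is_hom_\<kappa>] by simp
    then have "H (vZ - const4 \<rho> - const4 p1 * vX * p9) = 0"
      by (simp only: sH H_gens p9 g9 diff_self)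
    then have "E' (vZ - const4 \<rho> - const4 p1 * vX * p9) = 0" using ker_H by blast
    then have "mZ - \<kappa> \<rho> = \<kappa> p1 * mX * E' p9"
      by (simp only: hom_simps[OF is_hom_model] model_simps(1-3) right_minus_eq)
    then have "mX ^ 1 * E' (const4 p1 * p9) = mbed [:[:- \<rho>:], 1:]"
      unfolding mbed_def hom_mult[OF is_hom_model] model_simps(1)
      by (simp add: ev_pCons ev_0 is_hom_ev is_hom_\<kappa> hom_simps[OF is_hom_\<kappa>] hom_1[OF is_hom_ev[OF
          is_hom_\<kappa>]] algebra_simps)
    moreover have "P_at0 [:[:- \<rho>:], 1:] \<noteq> 0" by (simp add: P_at0_def map_poly_pCons)
    ultimately have "(1::nat) = 0" by (rule low_degree_regular[OF de'(1)]) simp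
    then show False by simp
  qed
  then have "degree (P_at0 b7) = 1" unfolding A P_at0_def by (simp add: map_poly_pCons)
  then show thesis using b7(1) that by blast
qed

text \<open>The isomorphism preserves pole orders and the degrees of leading coefficients, so the extremal
  functions \<open>y\<close> and \<open>t\<close> of the second surface obey the bound on the first.\<close>

theorem exponents_le: "d' \<le> d \<and> sQ * d' + e' \<le> sQ * d + e"
proof -
  obtain u p1 where u: "gX = \<kappa> u * mX" "p1 * u = 1" by (rule gX_proportional)
  obtain b where b: "gZ = mbed b" "degree (P_at0 b) = 1" by (rule gZ_linear)
  define cc :: "'r \<Rightarrow> 'r poly poly" where "cc r = [:[:r:]:]" for r
  have hcc: "is_hom cc" unfolding cc_def by (intro is_hom_comp[OF is_hom_const_poly] is_hom_const_poly)
  define S where "S = ev2 cc [:[:0, u:]:] b"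
  have gS: "ev2 \<kappa> gX gZ a = mbed (S a)" for a
  proof -
    have 1: "mbed (cc r) = \<kappa> r" for r by (simp add: mbed_def cc_def ev_const is_hom_ev is_hom_\<kappa>)
    have 2: "mbed [:[:0, u:]:] = gX"
      by (simp add: u(1) mbed_def ev_const ev_pCons ev_0 is_hom_ev is_hom_\<kappa> hom_0[OF is_hom_\<kappa>])
    have "mbed (S a) = ev2 (\<lambda>r. mbed (cc r)) (mbed [:[:0, u:]:]) (mbed b) a"
      unfolding S_def by (rule hom_ev2[OF is_hom_mbed hcc])
    then show ?thesis unfolding 1 2 b(1)[symmetric] by simp
  qed
  have S0: "degree (P_at0 (S a)) = degree (P_at0 a)" for a
  proof -
    have 1: "P_at0 (cc r) = [:r:]" for r by (simp add: P_at0_def cc_def map_poly_pCons)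
    have 2: "P_at0 [:[:0, u:]:] = 0" by (simp add: P_at0_def map_poly_pCons)
    have "P_at0 (S a) = ev2 (\<lambda>r. P_at0 (cc r)) (P_at0 [:[:0, u:]:]) (P_at0 b) a"
      unfolding S_def by (rule hom_ev2[OF is_hom_P_at0 hcc])
    also have "\<dots> = pcompose (P_at0 a) (P_at0 b)"
      unfolding 1 2 ev2_zero[OF is_hom_const_poly] by (simp add: pcompose_altdef ev_def)
    finally show ?thesis by (simp add: degree_pcompose b(2))
  qed
  \<comment> \<open>The unit \<open>u\<close> accounts for the difference between powers of \<open>gX\<close> and of \<open>X\<close>.\<close>
  have bound: "n \<le> (degree (P_at0 a) div rP) * d + (degree (P_at0 a) div (rP * sQ)) * e"
    if eq: "gX ^ n * H h = ev2 \<kappa> gX gZ a" and a: "degree (P_at0 a) > 0" for n h a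
  proof -
    obtain p where p: "E p = H h" using in_E by blast
    have "mX ^ n * E (const4 (u ^ n) * p) = gX ^ n * H h"
      unfolding hom_mult[OF is_hom_model] model_simps(1) p u(1) hom_power[OF is_hom_\<kappa>]
      by (simp add: power_mult_distrib algebra_simps)
    then have f: "mX ^ n * E (const4 (u ^ n) * p) = mbed (S a)" unfolding eq gS .
    have nz: "P_at0 (S a) \<noteq> 0" using S0[of a] a by auto
    show ?thesis using pole_bound[OF de(1) f nz] unfolding S0 .
  qed
  have y: "gX ^ d' * H vY = ev2 \<kappa> gX gZ P"
    using solution_H unfolding solution_def gY_def by blast
  have degP: "degree (P_at0 P) = rP" using deg_P0 by (simp add: P0_def)
  have rs: "rP > 0" "sQ > 1" using deg_P deg_Q by auto
  have "rP div (rP * sQ) = 0"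
    using rs by (simp add: div_mult2_eq)
  then have "d' \<le> d" using bound[OF y] degP rs by simp
  moreover have t: "gX ^ weight_T d' e' * H vT = ev2 \<kappa> gX gZ (hQ d')"
    using hQ_ev[OF is_hom_\<kappa> solution_H] unfolding gT_def .
  have degT: "degree (P_at0 (hQ d')) = rP * sQ"
    unfolding hQ_at0[OF de'(1)] using q_nonzero P0_nonzero by (simp add: degree_power_eq deg_P0)
  have "weight_T d' e' \<le> ((rP * sQ) div rP) * d + ((rP * sQ) div (rP * sQ)) * e"
    using bound[OF t] degT rs by simp
  ultimately show ?thesis using rs by simp
qed

end

context danielewski
begin

lemma not_R_isomorphic:
  assumes de: "d \<ge> 1" "e \<ge> 1" "d' \<ge> 1" "e' \<ge> 1" and ne: "(d, e) \<noteq> (d', e')"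
  shows "\<not> R_isomorphic (B_alg d e P Q) (B_alg d' e' P Q)"
proof
  have le: "d' \<le> d \<and> sQ * d' + e' \<le> sQ * d + e"
    if de: "d \<ge> 1" "e \<ge> 1" "d' \<ge> 1" "e' \<ge> 1" and iso: "R_isomorphic (B_alg d' e' P Q) (B_alg d e P Q)"
    for d e d' e'
  proof -
    obtain H where H: "is_hom H" "range H = range (model d e)" "\<And>a. H a = 0 \<longleftrightarrow> model d' e' a = 0"
      "\<And>r. H (const4 r) = \<kappa> r" using R_isomorphic_hom[OF de iso] by blast
    interpret danielewski_iso \<iota> P Q q d e d' e' H
      by unfold_locales (fact de H)+
    show ?thesis by (rule exponents_le)
  qed
  assume iso: "R_isomorphic (B_alg d e P Q) (B_alg d' e' P Q)"
  have iso': "R_isomorphic (B_alg d' e' P Q) (B_alg d e P Q)"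
  proof -
    interpret S: cring "quot_ring (B_ideal d e P Q)" by (rule cring_quot[OF ideal_B])
    obtain h where h: "h \<in> ring_iso (quot_ring (B_ideal d e P Q)) (quot_ring (B_ideal d' e' P Q))"
      "\<And>r. h (quot_map (B_ideal d e P Q) (const4 r)) = quot_map (B_ideal d' e' P Q) (const4 r)"
      using iso unfolding R_isomorphic_def B_alg_def by auto
    define k where "k = inv_into (carrier (quot_ring (B_ideal d e P Q))) h"
    have "k \<in> ring_iso (quot_ring (B_ideal d' e' P Q)) (quot_ring (B_ideal d e P Q))"
      unfolding k_def by (rule ring_iso_set_sym[OF S.ring_axioms h(1)])
    moreover have "k (quot_map (B_ideal d' e' P Q) (const4 r)) = quot_map (B_ideal d e P Q)
        (const4 r)" for r
      unfolding k_def h(2)[symmetric]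
      by (rule inv_into_f_f) (use h(1) quot_map_simps(4)[OF ideal_B] in \<open>auto simp: ring_iso_def
          bij_betw_def\<close>)
    ultimately show ?thesis unfolding R_isomorphic_def B_alg_def by auto
  qed
  have "d' = d" "sQ * d' + e' = sQ * d + e"
    using le[OF de iso'] le[OF de(3,4,1,2) iso] by linarith+
  then show False using ne by simp
qed

lemma gcp_counterexample_B:
  assumes "d \<ge> 1" "e \<ge> 1" "d' \<ge> 1" "e' \<ge> 1" "(d, e) \<noteq> (d', e')"
  shows "gcp_counterexample (B_alg d e P Q) (B_alg d' e' P Q)"
  unfolding gcp_counterexample_def
  using R_domain_B stably_isomorphic[OF assms(1-4)] not_R_isomorphic[OF assms] assms by blast

end

section \<open>The family\<close>

lemma unit_ideal_two: "unit_ideal {a, b} \<Longrightarrow> \<exists>u v. u * a + v * b = 1"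
proof -
  assume "unit_ideal {a, b}"
  then have "1 \<in> {u * a + v * b | u v. True}" unfolding unit_ideal_def Idl_two by simp
  then show ?thesis by auto
qed

lemma unit_ideal_three: "unit_ideal {a, b, c} \<Longrightarrow> \<exists>u v w. u * a + v * b + w * c = 1"
proof -
  assume "unit_ideal {a, b, c}"
  then have "1 \<in> {u * a + v * b + w * c | u v w. True}" unfolding unit_ideal_def Idl_three by simp
  then show ?thesis by auto
qed

lemma gcp_counterexample_admissible:
  fixes P :: "'r::idom poly poly"
  assumes adm: "admissible P Q" and de: "d \<ge> 1" "e \<ge> 1" "d' \<ge> 1" "e' \<ge> 1" "(d, e) \<noteq> (d', e')"
  shows "gcp_counterexample (B_alg d e P Q) (B_alg d' e' P Q)"
proof -
  obtain q where q: "q \<noteq> 0" "lead_coeff Q = [:[:q:]:]"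
    using almost_monic_lead_coeff adm unfolding admissible_def by metis
  interpret danielewski "\<lambda>r :: 'r. to_ac (to_fract r)" P Q q
  proof
    show "is_hom (\<lambda>r :: 'r. to_ac (to_fract r))" by (rule is_homI) simp_all
    show "\<exists>u v. u * P_at0 P + v * P_at0 (pderiv P) = 1"
      using adm unit_ideal_two unfolding admissible_def by blast
    show "\<exists>u v w. u * [:P_at0 P:] + v * Q_at0 Q + w * Q_at0 (pderiv Q) = 1"
      using adm unit_ideal_three unfolding admissible_def by blast
  qed (use adm q in \<open>auto simp: admissible_def\<close>)
  show ?thesis by (rule gcp_counterexample_B[OF de])
qed

text \<open>\<open>Z\<^sup>2 + Z\<close> and \<open>Y\<^sup>2 + Y\<close> have discriminant 1 over every ring.\<close>

lemma admissible_exists: "\<exists>(P :: 'r::idom poly poly) Q. admissible P Q"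
proof -
  let ?P = "[:0, 1, 1:] :: 'r poly poly" and ?Q = "[:0, 1, 1:] :: 'r poly poly poly"
  have P: "P_at0 ?P = [:0, 1, 1:]" "P_at0 (pderiv ?P) = [:1, 2:]"
    by (simp_all add: P_at0_def map_poly_pCons pderiv_pCons)
  have Q: "Q_at0 ?Q = [:0, 1, 1:]" "Q_at0 (pderiv ?Q) = [:1, 2:]"
  proof -
    have h0: "P_at0 0 = (0 :: 'r poly)" by (rule hom_0[OF is_hom_P_at0])
    have h1: "P_at0 1 = (1 :: 'r poly)" by (rule hom_1[OF is_hom_P_at0])
    have "P_at0 (1 + 1) = P_at0 1 + (P_at0 1 :: 'r poly)" by (rule hom_add[OF is_hom_P_at0])
    then have "P_at0 2 = (2 :: 'r poly)" by (simp add: h1)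
    note h = h0 h1 this
    show "Q_at0 ?Q = [:0, 1, 1:]" "Q_at0 (pderiv ?Q) = [:1, 2:]"
      by (simp_all add: Q_at0_def map_poly_pCons pderiv_pCons h)
  qed
  have disc: "[:1, 2:] * [:1, 2:] + [:- 4:] * [:0, 1, 1:] = (1 :: 'a::comm_ring_1 poly)"
    by (simp add: one_pCons)
  have "unit_ideal {P_at0 ?P, P_at0 (pderiv ?P)}"
    unfolding unit_ideal_def Idl_two P
  proof (intro equalityI subsetI UNIV_I CollectI)
    fix a :: "'r poly"
    have "a = a * ([:1, 2:] * [:1, 2:] + [:- 4:] * [:0, 1, 1:])" unfolding disc by simp
    then have "a = (a * [:- 4:]) * [:0, 1, 1:] + (a * [:1, 2:]) * [:1, 2:]"
      by (simp only: distrib_left mult.assoc add.commute)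
    then show "\<exists>u v. a = u * [:0, 1, 1:] + v * [:1, 2:] \<and> True" by blast
  qed
  moreover have "unit_ideal {[:P_at0 ?P:], Q_at0 ?Q, Q_at0 (pderiv ?Q)}"
    unfolding unit_ideal_def Idl_three Q
  proof (intro equalityI subsetI UNIV_I CollectI)
    fix a :: "'r poly poly"
    have "a = a * ([:1, 2:] * [:1, 2:] + [:- 4:] * [:0, 1, 1:])" unfolding disc by simp
    then have "a = 0 * [:P_at0 ?P:] + (a * [:- 4:]) * [:0, 1, 1:] + (a * [:1, 2:]) * [:1, 2:]"
      by (simp only: distrib_left mult.assoc add.commute mult_zero_left add_0_left)
    then show "\<exists>u v w. a = u * [:P_at0 ?P:] + v * [:0, 1, 1:] + w * [:1, 2:] \<and> True" by blast
  qed
  moreover have "almost_monic ?Q" unfolding almost_monic_def by (simp add: map_poly_pCons)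
  ultimately have "admissible ?P ?Q" unfolding admissible_def by simp
  then show ?thesis by blast
qed

theorem corollary3p6:
  fixes \<iota> :: "'k::field \<Rightarrow> 'r::idom"
  assumes "affine_algebra \<iota>"
    and "factorial_domain (ring_of_type_algebra :: 'r ring)"
  shows "(\<exists>S \<subseteq> (Omega3 :: ('r, 'r poly poly poly poly set, unit) R_alg set).
            infinite S \<and> pairwise gcp_counterexample S) \<and>
         (\<forall>A \<in> (Omega3 :: ('r, 'r poly poly poly poly set, unit) R_alg set).
            \<exists>B \<in> Omega3. gcp_counterexample A B) \<and>
         (\<forall>(P :: 'r poly poly) Q d e d' e'.
            admissible P Q \<and> d \<ge> 1 \<and> e \<ge> 1 \<and> d' \<ge> 1 \<and> e' \<ge> 1 \<and> (d, e) \<noteq> (d', e') \<longrightarrow>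
            gcp_counterexample (B_alg d e P Q) (B_alg d' e' P Q))"
proof (intro conjI ballI allI impI)
  obtain P :: "'r poly poly" and Q where PQ: "admissible P Q" using admissible_exists by blast
  define F where "F n = B_alg 1 (Suc n) P Q" for n
  have F: "gcp_counterexample (F m) (F n)" if "m \<noteq> n" for m n
    unfolding F_def by (rule gcp_counterexample_admissible[OF PQ]) (use that in auto)
  have "inj F"
  proof (rule injI)
    fix m n assume "F m = F n"
    then show "m = n" using F[of m n] R_isomorphic_refl[of "F n"] unfolding gcp_counterexample_def
        by metis
  qed
  then have "infinite (range F)" by (rule range_inj_infinite)
  moreover have "pairwise gcp_counterexample (range F)"
  proof (unfold pairwise_def, intro ballI impI)
    fix A B assume "A \<in> range F" "B \<in> range F" "A \<noteq> B"
    then obtain m n where mn: "A = F m" "B = F n" "m \<noteq> n" by auto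
    show "gcp_counterexample A B" unfolding mn(1,2) by (rule F[OF mn(3)])
  qed
  moreover have "range F \<subseteq> Omega3"
    unfolding Omega3_def F_def using PQ by force
  ultimately show "\<exists>S \<subseteq> (Omega3 :: ('r, 'r poly poly poly poly set, unit) R_alg set).
      infinite S \<and> pairwise gcp_counterexample S" by blast
next
  fix A :: "('r, 'r poly poly poly poly set, unit) R_alg"
  assume "A \<in> Omega3"
  then obtain d e P Q where A: "A = B_alg d e P Q" "d \<ge> 1" "e \<ge> 1" "admissible P Q"
    unfolding Omega3_def by blast
  have "gcp_counterexample A (B_alg (Suc d) e P Q)"
    unfolding A(1) by (rule gcp_counterexample_admissible[OF A(4)]) (use A in auto)
  moreover have "B_alg (Suc d) e P Q \<in> Omega3"
    unfolding Omega3_def using A by force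
  ultimately show "\<exists>B \<in> Omega3. gcp_counterexample A B" by blast
next
  fix P :: "'r poly poly" and Q and d e d' e' :: nat
  assume "admissible P Q \<and> d \<ge> 1 \<and> e \<ge> 1 \<and> d' \<ge> 1 \<and> e' \<ge> 1 \<and> (d, e) \<noteq> (d', e')"
  then show "gcp_counterexample (B_alg d e P Q) (B_alg d' e' P Q)"
    using gcp_counterexample_admissible by blast
qed

end
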